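(* Let $q\in\mathbb{C}$ be a primitive cube root of unity ($r=3$) and let $\mathrm{Max}=\delta\mathrm{d}:\Omega^1\to\Omega^1$ be the Maxwell operator on the reduced quantum group $\mathcal{A}=\mathbb{C}_q[SL_2]$. Let $E=\mathrm{d}\Omega^0\subset\ker\mathrm{Max}$ be the space of exact 1-forms, and call elements of $\ker\mathrm{Max}$ zero modes and two zero modes gauge equivalent if they differ by an element of $E$. (i) $\dim\ker\mathrm{Max}=54$ and $\dim(\ker\mathrm{Max}/E)=28$. The subspace of $\ker\mathrm{Max}/E$ of classes of $A$ with zero curvature $\mathrm{d}A=0$ is 4-dimensional, namely $H^1$ (with its basis of harmonic representatives). (ii) The space of zero modes in Lorentz gauge is 32-dimensional, and its image in $\ker\mathrm{Max}/E$ is 20-dimensional. (iii) The space of zero modes in temporal gauge is 32-dimensional, and its image in $\ker\mathrm{Max}/E$ is 20-dimensional. (iv) Every zero mode is gauge equivalent to the sum of a zero mode in Lorentz gauge and a zero mode in temporal gauge, and the intersection of the two 20-dimensional images in $\ker\mathrm{Max}/E$ from (ii) and (iii) is 12-dimensional.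
   Context: Here $q^3=1$, $q\ne1$, $\mu=1-q^{-2}$. $\mathcal{A}$ is the unital $\mathbb{C}$-algebra generated by $a,b,c,d$ with relations $ba=qab$, $ca=qac$, $db=qbd$, $dc=qcd$, $cb=bc$, $da-ad=q\mu bc$, $ad-q^{-1}bc=1$, $a^3=d^3=1$, $b^3=c^3=0$. It has dimension 27 with basis $\{a^mb^nc^k\}_{0\le m,n,k\le2}$. $\Lambda$ is the graded algebra generated by degree-1 elements $e_a,e_b,e_c,e_d$ with relations: $e_b,e_c,e_d$ pairwise anticommute and square to zero; $e_a\wedge e_a=\mu e_b\wedge e_c$; $e_a\wedge e_d+e_d\wedge e_a+\mu e_b\wedge e_c=0$; $e_a\wedge e_b+q^2e_b\wedge e_a-\mu e_b\wedge e_d=0$; $e_c\wedge e_a+q^2e_a\wedge e_c+\mu e_c\wedge e_d=0$. Write $e_{ij\cdots}=e_i\wedge e_j\wedge\cdots$; bases in degrees $2,3,4$ are $\{e_{ab},e_{ac},e_{ad},e_{bc},e_{bd},e_{cd}\}$, $\{e_{abc},e_{abd},e_{acd},e_{bcd}\}$, $\{e_{abcd}\}$. $\Omega=\Lambda\otimes\mathcal{A}$ is the free right $\mathcal{A}$-module on $\Lambda$, with algebra structure given by those of $\Lambda$, $\mathcal{A}$ and the following cross relations, where $(u,v)$ is either $(a,c)$ or $(b,d)$: $ve_b=e_bv$, $ue_c=e_cu$, $ue_d=q^{-1}e_du$, $ve_d=qe_dv$, $ue_b=e_bu+q\mu e_dv$, $ve_c=e_cv+q\mu e_du$, $ve_a=q^{-1}e_av+\mu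 e_bu$, $ue_a=qe_au+\mu e_cv+q\mu^2e_du$. The exterior derivative is $\mathrm{d}\omega=-(\theta\wedge\omega-(-1)^{|\omega|}\omega\wedge\theta)$, $\theta=e_a+e_d$. $H^1$ is the degree-1 cohomology of $(\Omega,\mathrm{d})$. The Hodge operator $\star:\Omega^i\to\Omega^{4-i}$ is the right $\mathcal{A}$-linear map with $\star1=e_{abcd}$, $\star e_{abcd}=1$, $\star e_a=-e_{abc}-\mu e_{bcd}$, $\star e_b=-e_{abd}$, $\star e_c=q^2e_{acd}$, $\star e_d=e_{bcd}$, $\star e_{ab}=-e_{ab}+2\mu e_{bd}$, $\star e_{ac}=e_{ac}$, $\star e_{ad}=\frac{1}{1+q^2}(2e_{bc}-q^2\mu e_{ad})$, $\star e_{bc}=\frac{q^2}{1+q^2}(2e_{ad}+\mu e_{bc})$, $\star e_{bd}=e_{bd}$, $\star e_{cd}=-e_{cd}$, $\star e_{abc}=-e_a-\mu e_d$, $\star e_{abd}=-e_b$, $\star e_{acd}=q^{-2}e_c$, $\star e_{bcd}=e_d$. Set $\delta=\star\circ\mathrm{d}\circ\star$. A form is harmonic if it is killed by both $\mathrm{d}$ and $\delta$. A 1-form $A$ is in Lorentz gauge if it is coclosed ($\delta A=0$), and in temporal gauge if it lies in $e_b\mathcal{A}\oplus e_c\mathcal{A}\oplus e_z\mathcal{A}$, where $e_z=qe_a-q^{-1}e_d$ (i.e. it has no $\theta$ component in the basis $e_b,e_c,e_z,\theta$). *)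

theory Defs
  imports Complex_Main "HOL-Library.Poly_Mapping"
begin

subsection \<open>Complex algebras\<close>

class complex_algebra = ring_1 +
  fixes scaleC :: "complex \<Rightarrow> 'a \<Rightarrow> 'a"  (infixr "*\<^sub>C" 75)
  assumes scaleC_add_right: "k *\<^sub>C (x + y) = k *\<^sub>C x + k *\<^sub>C y"
    and scaleC_add_left: "(k + l) *\<^sub>C x = k *\<^sub>C x + l *\<^sub>C x"
    and scaleC_scaleC: "k *\<^sub>C l *\<^sub>C x = (k * l) *\<^sub>C x"
    and scaleC_one: "1 *\<^sub>C x = x"
    and mult_scaleC_left: "(k *\<^sub>C x) * y = k *\<^sub>C (x * y)"
    and mult_scaleC_right: "x * (k *\<^sub>C y) = k *\<^sub>C (x * y)"

global_interpretation complex_vector: vector_space "scaleC :: complex \<Rightarrow> 'a \<Rightarrow> 'a::complex_algebra"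
  by unfold_locales
    (simp_all add: scaleC_add_right scaleC_add_left scaleC_scaleC scaleC_one)


subsection \<open>Quotients of vector spaces\<close>

definition coset :: "'w::complex_algebra set \<Rightarrow> 'w \<Rightarrow> 'w set" where
  "coset E x = {x + y | y. y \<in> E}"

text \<open>The image of \<^term>\<open>S\<close> in the quotient space modulo \<^term>\<open>E\<close>, as a set of cosets.\<close>

definition quot :: "'w::complex_algebra set \<Rightarrow> 'w set \<Rightarrow> 'w set set" where
  "quot S E = coset E ` S"

text \<open>The classes of the elements of \<^term>\<open>B\<close> form a basis of the space \<^term>\<open>Q\<close> of cosets of
  \<^term>\<open>E\<close>: every element of \<^term>\<open>Q\<close> is the class of a unique linear combination of
  \<^term>\<open>B\<close>, and all these classes lie in \<^term>\<open>Q\<close>.\<close>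

definition quot_basis :: "'w::complex_algebra set \<Rightarrow> 'w set set \<Rightarrow> 'w set \<Rightarrow> bool" where
  "quot_basis E Q B \<longleftrightarrow> finite B \<and>
     bij_betw (\<lambda>k. coset E (\<Sum>b\<in>B. k b *\<^sub>C b)) {k :: 'w \<Rightarrow> complex. \<forall>b. b \<notin> B \<longrightarrow> k b = 0} Q"

definition quot_dim :: "'w::complex_algebra set \<Rightarrow> 'w set set \<Rightarrow> nat" where
  "quot_dim E Q = (THE n. \<exists>B. quot_basis E Q B \<and> card B = n)"


subsection \<open>Generators and relations\<close>

text \<open>The words over an alphabet form a monoid under concatenation; its monoid algebra over the
  complex numbers is the free algebra on that alphabet.\<close>

instantiation list :: (type) monoid_add
begin

definition zero_list :: "'a list" where "zero_list = []"
definition plus_list :: "'a list \<Rightarrow> 'a list \<Rightarrow> 'a list" where "plus_list = (@)"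

instance
  by standard (simp_all add: zero_list_def plus_list_def)

end

type_synonym 'g free = "'g list \<Rightarrow>\<^sub>0 complex"

definition var :: "'g \<Rightarrow> 'g free" where
  "var x = Poly_Mapping.single [x] 1"

definition const :: "complex \<Rightarrow> 'g free" where
  "const k = Poly_Mapping.single [] k"

definition two_sided_ideal :: "'a::ring_1 set \<Rightarrow> bool" where
  "two_sided_ideal I \<longleftrightarrow> 0 \<in> I \<and> (\<forall>x\<in>I. \<forall>y\<in>I. x + y \<in> I) \<and> (\<forall>x\<in>I. \<forall>r. r * x \<in> I \<and> x * r \<in> I)"

definition free_eval :: "('g \<Rightarrow> 'w::complex_algebra) \<Rightarrow> 'g free \<Rightarrow> 'w" where
  "free_eval h x = (\<Sum>w\<in>Poly_Mapping.keys x. Poly_Mapping.lookup x w *\<^sub>C prod_list (map h w))"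

text \<open>The subalgebra generated by the elements \<^term>\<open>h\<close>.\<close>

definition generated :: "('g \<Rightarrow> 'w::complex_algebra) \<Rightarrow> 'w set" where
  "generated h = range (free_eval h)"

text \<open>The elements \<^term>\<open>h\<close> generate a copy of the algebra presented by the relators \<^term>\<open>R\<close>.\<close>

definition presented :: "('g \<Rightarrow> 'w::complex_algebra) \<Rightarrow> 'g free set \<Rightarrow> bool" where
  "presented h R \<longleftrightarrow> (\<forall>x. free_eval h x = 0 \<longleftrightarrow> x \<in> two_sided_ideal hull R)"

text \<open>The four letters index both the generators of \<open>\<A>\<close> and those of \<open>\<Lambda>\<close>.\<close>

datatype gen = Ga | Gb | Gc | Gd

definition mu :: "complex \<Rightarrow> complex" where
  "mu q = 1 - 1 / q^2"

definition A_relators :: "complex \<Rightarrow> gen free set" where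
  "A_relators q =
    (let a = var Ga; b = var Gb; c = var Gc; d = var Gd in
     {b * a - const q * a * b,
      c * a - const q * a * c,
      d * b - const q * b * d,
      d * c - const q * c * d,
      c * b - b * c,
      d * a - a * d - const (q * mu q) * b * c,
      a * d - const (1 / q) * b * c - 1,
      a^3 - 1, d^3 - 1, b^3, c^3})"

definition Lambda_relators :: "complex \<Rightarrow> gen free set" where
  "Lambda_relators q =
    (let a = var Ga; b = var Gb; c = var Gc; d = var Gd in
     {b * c + c * b, b * d + d * b, c * d + d * c,
      b * b, c * c, d * d,
      a * a - const (mu q) * b * c,
      a * d + d * a + const (mu q) * b * c,
      a * b + const (q^2) * b * a - const (mu q) * b * d,
      c * a + const (q^2) * a * c + const (mu q) * c * d})"


subsection \<open>The differential calculus on the reduced quantum group\<close>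

text \<open>The type \<^typ>\<open>'w\<close> is the algebra \<open>\<Omega>\<close> and its multiplication is the wedge product; \<open>g\<close> and
  \<open>e\<close> are the generators of the subalgebras \<open>\<A>\<close> and \<open>\<Lambda>\<close>. Freeness is expressed by a vector space
  basis \<open>B\<close> of \<open>\<Lambda>\<close> that is also a basis of \<open>\<Omega>\<close> as a right \<open>\<A>\<close>-module.\<close>

locale reduced_SL2_calculus =
  fixes q :: complex
    and g :: "gen \<Rightarrow> 'w::complex_algebra"
    and e :: "gen \<Rightarrow> 'w"
    and star :: "'w \<Rightarrow> 'w"
  assumes A_presented: "presented g (A_relators q)"
    and Lambda_presented: "presented e (Lambda_relators q)"
    and free_right_module:
      "\<exists>B. finite B \<and> complex_vector.independent B \<and> complex_vector.span B = generated e \<and>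
         (\<forall>\<omega>. \<exists>!x. (\<forall>\<beta>\<in>B. x \<beta> \<in> generated g) \<and> (\<forall>\<beta>. \<beta> \<notin> B \<longrightarrow> x \<beta> = 0) \<and>
            \<omega> = (\<Sum>\<beta>\<in>B. \<beta> * x \<beta>))"
    and cross_relations:
      "\<And>u v. (u, v) \<in> {(g Ga, g Gc), (g Gb, g Gd)} \<Longrightarrow>
         v * e Gb = e Gb * v \<and>
         u * e Gc = e Gc * u \<and>
         u * e Gd = (1 / q) *\<^sub>C (e Gd * u) \<and>
         v * e Gd = q *\<^sub>C (e Gd * v) \<and>
         u * e Gb = e Gb * u + (q * mu q) *\<^sub>C (e Gd * v) \<and>
         v * e Gc = e Gc * v + (q * mu q) *\<^sub>C (e Gd * u) \<and>
         v * e Ga = (1 / q) *\<^sub>C (e Ga * v) + mu q *\<^sub>C (e Gb * u) \<and>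
         u * e Ga = q *\<^sub>C (e Ga * u) + mu q *\<^sub>C (e Gc * v) + (q * (mu q)^2) *\<^sub>C (e Gd * u)"
    and star_add: "\<And>\<omega> \<eta>. star (\<omega> + \<eta>) = star \<omega> + star \<eta>"
    and star_right_linear: "\<And>\<omega> x. x \<in> generated g \<Longrightarrow> star (\<omega> * x) = star \<omega> * x"
    and star_0: "star 1 = e Ga * e Gb * e Gc * e Gd"
    and star_4: "star (e Ga * e Gb * e Gc * e Gd) = 1"
    and star_a: "star (e Ga) = - (e Ga * e Gb * e Gc) - mu q *\<^sub>C (e Gb * e Gc * e Gd)"
    and star_b: "star (e Gb) = - (e Ga * e Gb * e Gd)"
    and star_c: "star (e Gc) = q^2 *\<^sub>C (e Ga * e Gc * e Gd)"
    and star_d: "star (e Gd) = e Gb * e Gc * e Gd"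
    and star_ab: "star (e Ga * e Gb) = - (e Ga * e Gb) + (2 * mu q) *\<^sub>C (e Gb * e Gd)"
    and star_ac: "star (e Ga * e Gc) = e Ga * e Gc"
    and star_ad: "star (e Ga * e Gd) =
        (1 / (1 + q^2)) *\<^sub>C (2 *\<^sub>C (e Gb * e Gc) - (q^2 * mu q) *\<^sub>C (e Ga * e Gd))"
    and star_bc: "star (e Gb * e Gc) =
        (q^2 / (1 + q^2)) *\<^sub>C (2 *\<^sub>C (e Ga * e Gd) + mu q *\<^sub>C (e Gb * e Gc))"
    and star_bd: "star (e Gb * e Gd) = e Gb * e Gd"
    and star_cd: "star (e Gc * e Gd) = - (e Gc * e Gd)"
    and star_abc: "star (e Ga * e Gb * e Gc) = - e Ga - mu q *\<^sub>C e Gd"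
    and star_abd: "star (e Ga * e Gb * e Gd) = - e Gb"
    and star_acd: "star (e Ga * e Gc * e Gd) = (1 / q^2) *\<^sub>C e Gc"
    and star_bcd: "star (e Gb * e Gc * e Gd) = e Gd"

definition Omega :: "(gen \<Rightarrow> 'w::complex_algebra) \<Rightarrow> (gen \<Rightarrow> 'w) \<Rightarrow> nat \<Rightarrow> 'w set" where
  "Omega g e i =
     complex_vector.span {prod_list (map e w) * x | w x. length w = i \<and> x \<in> generated g}"

definition theta :: "(gen \<Rightarrow> 'w::complex_algebra) \<Rightarrow> 'w" where
  "theta e = e Ga + e Gd"

text \<open>The exterior derivative and the codifferential on forms of degree \<open>i\<close>; the degree is passed
  explicitly because of the sign.\<close>

definition ext_d :: "(gen \<Rightarrow> 'w::complex_algebra) \<Rightarrow> nat \<Rightarrow> 'w \<Rightarrow> 'w" where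
  "ext_d e i \<omega> = - (theta e * \<omega> - (-1)^i * (\<omega> * theta e))"

definition codiff :: "(gen \<Rightarrow> 'w::complex_algebra) \<Rightarrow> ('w \<Rightarrow> 'w) \<Rightarrow> nat \<Rightarrow> 'w \<Rightarrow> 'w" where
  "codiff e star i = star \<circ> ext_d e (4 - i) \<circ> star"

definition Maxwell :: "(gen \<Rightarrow> 'w::complex_algebra) \<Rightarrow> ('w \<Rightarrow> 'w) \<Rightarrow> 'w \<Rightarrow> 'w" where
  "Maxwell e star = codiff e star 2 \<circ> ext_d e 1"

definition zero_modes ::
    "(gen \<Rightarrow> 'w::complex_algebra) \<Rightarrow> (gen \<Rightarrow> 'w) \<Rightarrow> ('w \<Rightarrow> 'w) \<Rightarrow> 'w set" where
  "zero_modes g e star = {A \<in> Omega g e 1. Maxwell e star A = 0}"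

definition exact_1_forms :: "(gen \<Rightarrow> 'w::complex_algebra) \<Rightarrow> (gen \<Rightarrow> 'w) \<Rightarrow> 'w set" where
  "exact_1_forms g e = ext_d e 0 ` Omega g e 0"

definition closed_1_forms :: "(gen \<Rightarrow> 'w::complex_algebra) \<Rightarrow> (gen \<Rightarrow> 'w) \<Rightarrow> 'w set" where
  "closed_1_forms g e = {A \<in> Omega g e 1. ext_d e 1 A = 0}"

definition H1 :: "(gen \<Rightarrow> 'w::complex_algebra) \<Rightarrow> (gen \<Rightarrow> 'w) \<Rightarrow> 'w set set" where
  "H1 g e = quot (closed_1_forms g e) (exact_1_forms g e)"

definition lorentz_gauge ::
    "(gen \<Rightarrow> 'w::complex_algebra) \<Rightarrow> (gen \<Rightarrow> 'w) \<Rightarrow> ('w \<Rightarrow> 'w) \<Rightarrow> 'w set" where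
  "lorentz_gauge g e star = {A \<in> Omega g e 1. codiff e star 1 A = 0}"

definition harmonic_1_forms ::
    "(gen \<Rightarrow> 'w::complex_algebra) \<Rightarrow> (gen \<Rightarrow> 'w) \<Rightarrow> ('w \<Rightarrow> 'w) \<Rightarrow> 'w set" where
  "harmonic_1_forms g e star =
     {A \<in> Omega g e 1. ext_d e 1 A = 0 \<and> codiff e star 1 A = 0}"

definition temporal_gauge ::
    "complex \<Rightarrow> (gen \<Rightarrow> 'w::complex_algebra) \<Rightarrow> (gen \<Rightarrow> 'w) \<Rightarrow> 'w set" where
  "temporal_gauge q g e =
     (let e\<^sub>z = q *\<^sub>C e Ga - (1 / q) *\<^sub>C e Gd in
      {e Gb * x + e Gc * y + e\<^sub>z * z | x y z.
         x \<in> generated g \<and> y \<in> generated g \<and> z \<in> generated g})"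

definition gauge_equivalent ::
    "(gen \<Rightarrow> 'w::complex_algebra) \<Rightarrow> (gen \<Rightarrow> 'w) \<Rightarrow> 'w \<Rightarrow> 'w \<Rightarrow> bool" where
  "gauge_equivalent g e A A' \<longleftrightarrow> A - A' \<in> exact_1_forms g e"

end

theory Submission
  imports Defs
begin

text \<open>
  All structure constants lie in $\mathbb{Z}[q]$, because $1 + q^2 = -q$ and $\mu = 1 - q$, so the
  proposition is linear algebra over $\mathbb{Q}(q)$ in the basis $e_I a^m b^n c^k$ of $\Omega$.
  That these elements are independent follows by evaluating the presentations in explicit
  representations. Every dimension is then obtained in the same way: if $z_1, \dots, z_r$ are
  independent elements of the kernel of a linear map $f$ on an $n$-dimensional space and
  $f y_1, \dots, f y_{n-r}$ are independent, then the $z_i$ span the kernel. Suitable $z_i$ and $y_j$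
  are sparse vectors over $\mathbb{Z}[q]$, and independence is witnessed by a triangular system of covectors.

  This yields the dimensions of the spaces $Z$, $F$, $E$, $L$, $T$ of zero modes, closed and exact
  forms, and zero modes in the two gauges, and $\dim (L \cap E) = \dim (T \cap E) = 12$. The
  quotients follow from the dimension formula; in particular $Z = L + T + E$ gives
  $\dim ((L + E) \cap (T + E)) = 46 + 46 - 54 = 38$, whence $38 - 26 = 12$ in (iv).
\<close>

subsection \<open>Linear algebra\<close>

definition linC :: "('v::complex_algebra \<Rightarrow> 'w::complex_algebra) \<Rightarrow> bool" where
  "linC f \<longleftrightarrow> (\<forall>x y. f (x + y) = f x + f y) \<and> (\<forall>c x. f (c *\<^sub>C x) = c *\<^sub>C f x)"

definition functional :: "('w::complex_algebra \<Rightarrow> complex) \<Rightarrow> bool" where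
  "functional f \<longleftrightarrow> (\<forall>x y. f (x + y) = f x + f y) \<and> (\<forall>c x. f (c *\<^sub>C x) = c * f x)"

lemma linC_add: "linC f \<Longrightarrow> f (x + y) = f x + f y"
  and linC_scale: "linC f \<Longrightarrow> f (c *\<^sub>C x) = c *\<^sub>C f x"
  by (auto simp: linC_def)

lemma linC_zero: "linC f \<Longrightarrow> f 0 = 0"
  using linC_add[of f 0 0] by simp

lemma linC_minus: "linC f \<Longrightarrow> f (- x) = - f x"
  using linC_add[of f x "- x"] by (simp add: linC_zero eq_neg_iff_add_eq_0 add.commute)

lemma linC_diff: "linC f \<Longrightarrow> f (x - y) = f x - f y"
  using linC_add[of f x "- y"] by (simp add: linC_minus)

lemma linC_sum: "linC f \<Longrightarrow> f (sum g S) = (\<Sum>i\<in>S. f (g i))"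
  by (induction S rule: infinite_finite_induct) (auto simp: linC_zero linC_add)

lemma functional_zero: "functional f \<Longrightarrow> f 0 = 0"
  unfolding functional_def by (metis add_cancel_left_left)

lemma functional_vanishes_on_span:
  assumes "functional f" "x \<in> complex_vector.span S" "\<And>v. v \<in> S \<Longrightarrow> f v = 0"
  shows "f x = 0"
  using assms(2,1,3)
  by (induction rule: complex_vector.span_induct_alt) (auto simp: functional_zero functional_def)

lemma linC_vanishes_on_span:
  assumes "linC f" "x \<in> complex_vector.span S" "\<And>v. v \<in> S \<Longrightarrow> f v = 0"
  shows "f x = 0"
  using assms(2,1,3)
  by (induction rule: complex_vector.span_induct_alt) (auto simp: linC_zero linC_def)

lemma linC_maps_span:
  assumes "linC f" "x \<in> complex_vector.span S" "\<And>v. v \<in> S \<Longrightarrow> f v \<in> complex_vector.span T"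
  shows "f x \<in> complex_vector.span T"
  using assms(2,1,3)
  by (induction rule: complex_vector.span_induct_alt)
    (auto simp: linC_zero linC_def complex_vector.span_zero complex_vector.span_add complex_vector.span_scale)

lemma linC_image_span:
  assumes "linC f"
  shows "f ` complex_vector.span S = complex_vector.span (f ` S)"
proof
  show "f ` complex_vector.span S \<subseteq> complex_vector.span (f ` S)"
  proof (rule image_subsetI)
    fix x assume x: "x \<in> complex_vector.span S"
    show "f x \<in> complex_vector.span (f ` S)"
      by (rule linC_maps_span[OF assms x]) (simp add: complex_vector.span_base)
  qed
next
  have "complex_vector.subspace (f ` complex_vector.span S)"
  proof (rule complex_vector.subspaceI)
    show "0 \<in> f ` complex_vector.span S"
      by (rule image_eqI[where x = 0]) (simp_all add: linC_zero assms complex_vector.span_zero)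
  next
    fix x y assume "x \<in> f ` complex_vector.span S" "y \<in> f ` complex_vector.span S"
    then obtain u v where "u \<in> complex_vector.span S" "v \<in> complex_vector.span S" "x + y = f (u + v)"
      by (auto simp: linC_add assms)
    thus "x + y \<in> f ` complex_vector.span S" by (auto intro: complex_vector.span_add)
  next
    fix c x assume "x \<in> f ` complex_vector.span S"
    then obtain u where "u \<in> complex_vector.span S" "c *\<^sub>C x = f (c *\<^sub>C u)"
      by (auto simp: linC_scale assms)
    thus "c *\<^sub>C x \<in> f ` complex_vector.span S" by (auto intro: complex_vector.span_scale)
  qed
  thus "complex_vector.span (f ` S) \<subseteq> f ` complex_vector.span S"
    by (intro complex_vector.span_minimal image_mono complex_vector.span_superset)
qed

fun separated :: "('w::complex_algebra \<Rightarrow> complex) list \<Rightarrow> 'w list \<Rightarrow> bool" where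
  "separated [] [] = True"
| "separated (f # fs) (v # vs) \<longleftrightarrow> functional f \<and> f v \<noteq> 0 \<and> (\<forall>u\<in>set vs. f u = 0) \<and> separated fs vs"
| "separated _ _ = False"

definition indep_list :: "'w::complex_algebra list \<Rightarrow> bool" where
  "indep_list vs \<longleftrightarrow> distinct vs \<and> complex_vector.independent (set vs)"

lemma separated_indep:
  assumes "separated fs vs"
  shows "indep_list vs"
  using assms
proof (induction fs vs rule: separated.induct)
  case (2 f fs v vs)
  hence "v \<notin> complex_vector.span (set vs)"
    using functional_vanishes_on_span[of f v "set vs"] by auto
  thus ?case
    using 2 complex_vector.span_base[of v "set vs"]
    by (auto simp: indep_list_def complex_vector.independent_insert)
qed (auto simp: indep_list_def complex_vector.independent_empty)

lemma indep_list_card: "indep_list vs \<Longrightarrow> card (set vs) = length vs"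
  by (simp add: indep_list_def distinct_card)

lemma indep_list_append1: "indep_list (us @ vs) \<Longrightarrow> indep_list us"
  using complex_vector.independent_mono[of "set us \<union> set vs" "set us"] by (auto simp: indep_list_def)

lemma dim_span_indep_list: "indep_list vs \<Longrightarrow> complex_vector.dim (complex_vector.span (set vs)) = length vs"
  by (simp add: indep_list_def complex_vector.dim_eq_card_independent distinct_card)

lemma full_independent_spans:
  assumes "finite B" "complex_vector.independent S" "S \<subseteq> complex_vector.span B" "card B \<le> card S"
  shows "complex_vector.span S = complex_vector.span B"
proof
  show "complex_vector.span S \<subseteq> complex_vector.span B"
    by (simp add: assms(3) complex_vector.span_minimal)
  have "B \<subseteq> complex_vector.span S"
  proof
    fix b assume b: "b \<in> B"
    show "b \<in> complex_vector.span S"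
    proof (rule ccontr)
      assume n: "b \<notin> complex_vector.span S"
      hence "complex_vector.independent (insert b S)"
        using assms(2) complex_vector.independent_insertI by blast
      moreover have "insert b S \<subseteq> complex_vector.span B"
        using assms(3) b complex_vector.span_base by auto
      ultimately have "finite (insert b S) \<and> card (insert b S) \<le> card B"
        by (rule complex_vector.independent_span_bound[OF assms(1)])
      moreover have "b \<notin> S" using n complex_vector.span_base by auto
      ultimately show False using assms(4) by auto
    qed
  qed
  thus "complex_vector.span B \<subseteq> complex_vector.span S"
    by (simp add: complex_vector.span_minimal)
qed

lemma kernel_span:
  assumes f: "linC f" and U: "indep_list us"
    and zs: "indep_list zs" "set zs \<subseteq> complex_vector.span (set us)" "\<And>z. z \<in> set zs \<Longrightarrow> f z = 0"
    and ys: "indep_list (map f ys)" "set ys \<subseteq> complex_vector.span (set us)"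
    and len: "length zs + length ys = length us"
  shows "{x \<in> complex_vector.span (set us). f x = 0} = complex_vector.span (set zs)" (is ?ker)
    and "complex_vector.span (set us) = complex_vector.span (set zs \<union> set ys)" (is ?full)
proof -
  have inj: "inj_on f (set ys)" and dy: "distinct ys" and indf: "complex_vector.independent (f ` set ys)"
    using ys(1) by (auto simp: indep_list_def distinct_map)
  have key: "v \<in> complex_vector.span (set zs) \<and> (\<forall>y\<in>set ys. u y = 0)"
    if "f v = 0" "v = (\<Sum>z\<in>set zs. u z *\<^sub>C z) + (\<Sum>y\<in>set ys. u y *\<^sub>C y)" for u v
  proof -
    have "f v = (\<Sum>z\<in>set zs. u z *\<^sub>C f z) + (\<Sum>y\<in>set ys. u y *\<^sub>C f y)"
      by (simp add: that(2) f linC_add linC_sum linC_scale)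
    also have "(\<Sum>z\<in>set zs. u z *\<^sub>C f z) = 0" by (simp add: zs(3))
    also have "(\<Sum>y\<in>set ys. u y *\<^sub>C f y) = (\<Sum>x\<in>f ` set ys. u (inv_into (set ys) f x) *\<^sub>C x)"
      by (simp add: sum.reindex[OF inj] inj)
    finally have s: "(\<Sum>x\<in>f ` set ys. u (inv_into (set ys) f x) *\<^sub>C x) = 0"
      using that(1) by simp
    have "u y = 0" if "y \<in> set ys" for y
      using complex_vector.independentD[OF indf _ _ s, of "f y"] that inj by simp
    moreover from this have "v = (\<Sum>z\<in>set zs. u z *\<^sub>C z)" using that(2) by simp
    hence "v \<in> complex_vector.span (set zs)"
      by (simp add: complex_vector.span_sum complex_vector.span_scale complex_vector.span_base)
    ultimately show ?thesis by blast
  qed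
  have disj: "set zs \<inter> set ys = {}"
  proof (rule ccontr)
    assume "set zs \<inter> set ys \<noteq> {}"
    then obtain y where y: "y \<in> set ys" "f y = 0" using zs(3) by blast
    with indf show False using complex_vector.dependent_zero by (metis imageI)
  qed
  have ind: "complex_vector.independent (set zs \<union> set ys)"
  proof (rule complex_vector.independent_if_scalars_zero)
    fix u x assume s: "(\<Sum>x\<in>set zs \<union> set ys. u x *\<^sub>C x) = 0" and x: "x \<in> set zs \<union> set ys"
    have e: "(\<Sum>x\<in>set zs \<union> set ys. u x *\<^sub>C x) = (\<Sum>z\<in>set zs. u z *\<^sub>C z) + (\<Sum>y\<in>set ys. u y *\<^sub>C y)"
      using disj by (simp add: sum.union_disjoint)
    have uy: "\<forall>y\<in>set ys. u y = 0"
      by (rule key[OF linC_zero[OF f] e[unfolded s], THEN conjunct2])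
    hence "(\<Sum>y\<in>set ys. u y *\<^sub>C y) = 0" by simp
    hence uz: "(\<Sum>z\<in>set zs. u z *\<^sub>C z) = 0" using e unfolding s by simp
    have "u z = 0" if "z \<in> set zs" for z
      by (rule complex_vector.independentD[OF _ _ subset_refl uz that])
        (use zs(1) in \<open>auto simp: indep_list_def\<close>)
    with uy x show "u x = 0" by auto
  qed simp
  have "card (set zs \<union> set ys) = length us"
    using disj dy zs(1) len by (simp add: card_Un_disjoint distinct_card indep_list_def)
  thus full: ?full
    using full_independent_spans[of "set us" "set zs \<union> set ys"] ind zs(2) ys(2) U
    by (simp add: indep_list_card)
  show ?ker
  proof safe
    fix x assume x: "x \<in> complex_vector.span (set us)" "f x = 0"
    then obtain u where "x = (\<Sum>x\<in>set zs \<union> set ys. u x *\<^sub>C x)"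
      unfolding full by (auto simp: complex_vector.span_finite)
    hence "x = (\<Sum>z\<in>set zs. u z *\<^sub>C z) + (\<Sum>y\<in>set ys. u y *\<^sub>C y)"
      using disj by (simp add: sum.union_disjoint)
    with key x show "x \<in> complex_vector.span (set zs)" by blast
  next
    fix x assume x: "x \<in> complex_vector.span (set zs)"
    show "x \<in> complex_vector.span (set us)"
      using x zs(2) by (metis complex_vector.span_minimal complex_vector.subspace_span subsetD)
    show "f x = 0" using linC_vanishes_on_span[OF f x] zs(3) by blast
  qed
qed

subsection \<open>Dimensions of quotients\<close>

abbreviation plus_space :: "'w::complex_algebra set \<Rightarrow> 'w set \<Rightarrow> 'w set" where
  "plus_space S T \<equiv> {x + y | x y. x \<in> S \<and> y \<in> T}"

lemma coset_eq_iff: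
  assumes "complex_vector.subspace E"
  shows "coset E x = coset E y \<longleftrightarrow> x - y \<in> E"
proof
  assume "coset E x = coset E y"
  moreover have "x \<in> coset E x"
    using assms complex_vector.subspace_0 by (force simp: coset_def)
  ultimately show "x - y \<in> E" by (auto simp: coset_def)
next
  have sub: "coset E x \<subseteq> coset E y" if "x - y \<in> E" for x y
  proof
    fix z assume "z \<in> coset E x"
    then obtain u where "u \<in> E" "z = y + ((x - y) + u)" by (auto simp: coset_def)
    moreover have "(x - y) + u \<in> E"
      using assms that \<open>u \<in> E\<close> complex_vector.subspace_add by blast
    ultimately show "z \<in> coset E y" unfolding coset_def by blast
  qed
  assume "x - y \<in> E"
  moreover from this have "y - x \<in> E"
    using assms complex_vector.subspace_neg by fastforce
  ultimately show "coset E x = coset E y" using sub by blast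
qed

lemma Union_quot: "\<Union> (quot S E) = plus_space S E"
  by (auto simp: quot_def coset_def)

lemma independent_Un_iff_inter_span:
  assumes "finite B" "finite C" "complex_vector.independent (B \<union> C)" "B \<inter> C = {}"
    and "(\<Sum>b\<in>B. k b *\<^sub>C b) \<in> complex_vector.span C" "b \<in> B"
  shows "k b = 0"
proof -
  obtain u where u: "(\<Sum>b\<in>B. k b *\<^sub>C b) = (\<Sum>c\<in>C. u c *\<^sub>C c)"
    using assms(2,5) by (auto simp: complex_vector.span_finite)
  define h where "h x = (if x \<in> B then k x else - u x)" for x
  have "(\<Sum>x\<in>B \<union> C. h x *\<^sub>C x) = (\<Sum>b\<in>B. h b *\<^sub>C b) + (\<Sum>c\<in>C. h c *\<^sub>C c)"
    using assms by (simp add: sum.union_disjoint)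
  also have "(\<Sum>b\<in>B. h b *\<^sub>C b) = (\<Sum>b\<in>B. k b *\<^sub>C b)" by (simp add: h_def)
  also have "(\<Sum>c\<in>C. h c *\<^sub>C c) = (\<Sum>c\<in>C. - (u c *\<^sub>C c))"
    using assms(4) by (intro sum.cong) (auto simp: h_def)
  finally have "(\<Sum>x\<in>B \<union> C. h x *\<^sub>C x) = 0" by (simp add: u sum_negf)
  hence "h b = 0"
    using complex_vector.independentD[OF assms(3), of "B \<union> C" h b] assms by auto
  thus ?thesis using assms(6) by (simp add: h_def)
qed

lemma quot_basis_card:
  assumes E: "complex_vector.subspace E" and Be: "finite Be" "complex_vector.independent Be" "E = complex_vector.span Be"
    and B: "quot_basis E Q B"
  shows "card B + card Be = complex_vector.dim (\<Union> Q)"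
proof -
  let ?S = "\<lambda>k. \<Sum>b\<in>B. k b *\<^sub>C b"
  let ?K = "{k :: 'a \<Rightarrow> complex. \<forall>b. b \<notin> B \<longrightarrow> k b = 0}"
  have fin: "finite B" and bij: "bij_betw (\<lambda>k. coset E (?S k)) ?K Q"
    using B by (auto simp: quot_basis_def)
  have zero: "k = (\<lambda>_. 0)" if "k \<in> ?K" "?S k \<in> E" for k
  proof -
    have "coset E (?S k) = coset E (?S (\<lambda>_. 0))" using that E by (simp add: coset_eq_iff)
    thus ?thesis using bij that(1) by (auto simp: bij_betw_def inj_on_def)
  qed
  have disj: "B \<inter> Be = {}"
  proof (rule ccontr)
    assume "B \<inter> Be \<noteq> {}"
    then obtain b where b: "b \<in> B" "b \<in> Be" by blast
    let ?k = "\<lambda>x. if x = b then 1 else 0"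
    have "?S ?k = b" using b(1) fin by (simp add: if_distrib[of "\<lambda>c. c *\<^sub>C _"] sum.delta cong: if_cong)
    hence E: "?S ?k \<in> E" using b Be complex_vector.span_base by auto
    have K: "?k \<in> ?K" using b(1) by auto
    show False using fun_cong[OF zero[OF K E], of b] by simp
  qed
  have ind: "complex_vector.independent (B \<union> Be)"
  proof (rule complex_vector.independent_if_scalars_zero)
    fix u x assume s: "(\<Sum>x\<in>B \<union> Be. u x *\<^sub>C x) = 0" and x: "x \<in> B \<union> Be"
    have e: "?S u + (\<Sum>y\<in>Be. u y *\<^sub>C y) = 0"
      using s disj fin Be(1) by (simp add: sum.union_disjoint)
    let ?k = "\<lambda>b. if b \<in> B then u b else 0"
    have "?S u = - (\<Sum>y\<in>Be. u y *\<^sub>C y)" using e by (simp add: eq_neg_iff_add_eq_0)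
    hence uE: "?S u \<in> E"
      by (simp add: Be(3) complex_vector.span_neg complex_vector.span_sum complex_vector.span_scale complex_vector.span_base)
    have "?S ?k = ?S u" by (intro sum.cong) auto
    hence E: "?S ?k \<in> E" using uE by simp
    have K: "?k \<in> ?K" by simp
    have uB: "u b = 0" if "b \<in> B" for b
      using fun_cong[OF zero[OF K E], of b] that by simp
    hence "(\<Sum>y\<in>Be. u y *\<^sub>C y) = 0" using e uB by simp
    hence "\<forall>y\<in>Be. u y = 0" using complex_vector.independentD[OF Be(2,1)] by blast
    with uB x show "u x = 0" by auto
  qed (use fin Be in auto)
  have "\<Union> Q = complex_vector.span (B \<union> Be)"
  proof -
    have "range ?S \<subseteq> ?S ` ?K"
    proof safe
      fix k :: "'a \<Rightarrow> complex"
      have "?S k = ?S (\<lambda>b. if b \<in> B then k b else 0)" by (intro sum.cong) auto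
      thus "?S k \<in> ?S ` ?K" by (rule image_eqI[where x = "\<lambda>b. if b \<in> B then k b else 0"]) simp
    qed
    hence "?S ` ?K = complex_vector.span B" using fin by (auto simp: complex_vector.span_finite)
    moreover have "Q = (\<lambda>x. coset E x) ` ?S ` ?K" using bij by (simp add: bij_betw_def image_image)
    ultimately show ?thesis unfolding complex_vector.span_Un Be(3) by (auto simp: coset_def)
  qed
  hence "complex_vector.dim (\<Union> Q) = card (B \<union> Be)"
    using ind by (simp add: complex_vector.dim_eq_card_independent)
  thus ?thesis using disj fin Be(1) by (simp add: card_Un_disjoint)
qed

lemma quot_basis_exists:
  assumes E: "complex_vector.subspace E" and Be: "finite Be" "complex_vector.independent Be" "E = complex_vector.span Be"
    and S: "complex_vector.subspace S" "finite C" "S \<subseteq> complex_vector.span C"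
  obtains B where "B \<subseteq> S" "quot_basis E (quot S E) B"
proof -
  obtain B' where B': "Be \<subseteq> B'" "B' \<subseteq> Be \<union> S" "complex_vector.independent B'" "Be \<union> S \<subseteq> complex_vector.span B'"
    using complex_vector.maximal_independent_subset_extend[of Be "Be \<union> S"] Be(2) by auto
  define B where "B = B' - Be"
  have B'eq: "B' = B \<union> Be" "B \<inter> Be = {}" using B'(1) by (auto simp: B_def)
  have "B' \<subseteq> complex_vector.span (Be \<union> C)"
    using B'(2) S(3) complex_vector.span_mono[of C "Be \<union> C"] complex_vector.span_superset[of "Be \<union> C"] by blast
  hence "finite B'"
    using complex_vector.independent_span_bound[of "Be \<union> C" B'] B'(3) Be(1) S(2) by auto
  hence fin: "finite B" by (simp add: B_def)
  have BS: "B \<subseteq> S" using B'(2) by (auto simp: B_def)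
  let ?S = "\<lambda>k. \<Sum>b\<in>B. k b *\<^sub>C b"
  let ?K = "{k :: 'a \<Rightarrow> complex. \<forall>b. b \<notin> B \<longrightarrow> k b = 0}"
  have "inj_on (\<lambda>k. coset E (?S k)) ?K"
  proof (rule inj_onI)
    fix k l assume kl: "k \<in> ?K" "l \<in> ?K" "coset E (?S k) = coset E (?S l)"
    have "(\<Sum>b\<in>B. (k b - l b) *\<^sub>C b) = ?S k - ?S l"
      by (simp add: complex_vector.scale_left_diff_distrib sum_subtractf)
    hence "(\<Sum>b\<in>B. (k b - l b) *\<^sub>C b) \<in> complex_vector.span Be"
      using kl(3) E Be(3) by (simp add: coset_eq_iff)
    hence eq: "k b - l b = 0" if "b \<in> B" for b
      using independent_Un_iff_inter_span[of B Be "\<lambda>b. k b - l b" b] fin Be(1) B'(3) B'eq that by auto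
    show "k = l"
    proof
      fix b show "k b = l b" using eq[of b] kl(1,2) by (cases "b \<in> B") auto
    qed
  qed
  moreover have "(\<lambda>k. coset E (?S k)) ` ?K = quot S E"
  proof (intro equalityI subsetI)
    fix X assume "X \<in> (\<lambda>k. coset E (?S k)) ` ?K"
    then obtain k where "X = coset E (?S k)" by blast
    moreover have "?S k \<in> S"
      by (intro complex_vector.subspace_sum[OF S(1)] complex_vector.subspace_scale[OF S(1)]) (use BS in auto)
    ultimately show "X \<in> quot S E" by (auto simp: quot_def)
  next
    fix X assume "X \<in> quot S E"
    then obtain s where s: "s \<in> S" "X = coset E s" by (auto simp: quot_def)
    hence "s \<in> complex_vector.span (B \<union> Be)" using B'(4) B'eq(1) by blast
    then obtain x y where xy: "s = x + y" "x \<in> complex_vector.span B" "y \<in> E"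
      unfolding complex_vector.span_Un Be(3) by blast
    obtain k where k: "x = ?S k" using xy(2) fin by (auto simp: complex_vector.span_finite)
    define k' where "k' b = (if b \<in> B then k b else 0)" for b
    have "x = ?S k'" "k' \<in> ?K" by (auto simp: k k'_def)
    moreover have "X = coset E x" using xy s E by (simp add: coset_eq_iff)
    ultimately show "X \<in> (\<lambda>k. coset E (?S k)) ` ?K" by blast
  qed
  ultimately have "quot_basis E (quot S E) B"
    unfolding quot_basis_def bij_betw_def by (intro conjI fin)
  with BS that show thesis by blast
qed

context
  fixes C :: "'w::complex_algebra set"
  assumes finite_C: "finite C" and span_C: "complex_vector.span C = UNIV"
begin

lemma finite_basis_exists:
  assumes sub: "complex_vector.subspace (S :: 'w set)"
  obtains B where "finite B" "complex_vector.independent B" "complex_vector.span B = S"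
proof -
  obtain B where B: "B \<subseteq> S" "complex_vector.independent B" "S \<subseteq> complex_vector.span B"
    using complex_vector.maximal_independent_subset by blast
  have "finite B" using complex_vector.independent_span_bound[OF finite_C B(2)] span_C by simp
  moreover have "complex_vector.span B = S"
    using B(1,3) sub by (simp add: complex_vector.span_minimal subset_antisym)
  ultimately show thesis using B(2) that by blast
qed

lemma dim_plus_Int:
  assumes "complex_vector.subspace S" "complex_vector.subspace (T :: 'w set)"
  shows "complex_vector.dim (plus_space S T) + complex_vector.dim (S \<inter> T) = complex_vector.dim S + complex_vector.dim T"
proof -
  obtain B :: "'w set" where "finite B" "complex_vector.independent B" "complex_vector.span B = UNIV"
    using finite_basis_exists[OF complex_vector.subspace_UNIV] by blast
  then interpret finite_dimensional_vector_space "scaleC :: complex \<Rightarrow> 'w \<Rightarrow> 'w" B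
    by unfold_locales
  show ?thesis by (rule dim_sums_Int[OF assms])
qed

lemma quot_dim_eqI:
  assumes E: "complex_vector.subspace E" and B: "quot_basis E Q (B :: 'w set)"
  shows "quot_dim E Q = card B" and "card B + complex_vector.dim E = complex_vector.dim (\<Union> Q)"
proof -
  obtain Be where Be: "finite Be" "complex_vector.independent Be" "complex_vector.span Be = E"
    using finite_basis_exists[OF E] by blast
  note card = quot_basis_card[OF E Be(1,2) Be(3)[symmetric]]
  show "card B + complex_vector.dim E = complex_vector.dim (\<Union> Q)"
    using card[OF B] Be(2,3) complex_vector.dim_span_eq_card_independent by metis
  show "quot_dim E Q = card B" unfolding quot_dim_def
  proof (rule the_equality)
    show "\<exists>B'. quot_basis E Q B' \<and> card B' = card B" using B by blast
    fix n assume "\<exists>B'. quot_basis E Q B' \<and> card B' = n"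
    then obtain B' where "quot_basis E Q B'" "card B' = n" by blast
    with card[OF this(1)] show "n = card B" using card[OF B] by linarith
  qed
qed

lemma quot_dim_quot:
  assumes E: "complex_vector.subspace E" and S: "complex_vector.subspace (S :: 'w set)"
  shows "quot_dim E (quot S E) + complex_vector.dim E = complex_vector.dim (plus_space S E)"
    and "\<exists>B\<subseteq>S. quot_basis E (quot S E) B \<and> card B = quot_dim E (quot S E)"
proof -
  obtain Be where Be: "finite Be" "complex_vector.independent Be" "complex_vector.span Be = E"
    using finite_basis_exists[OF E] by blast
  obtain B where B: "B \<subseteq> S" "quot_basis E (quot S E) B"
    using quot_basis_exists[OF E Be(1,2) Be(3)[symmetric] S finite_C] span_C by auto
  show "quot_dim E (quot S E) + complex_vector.dim E = complex_vector.dim (plus_space S E)"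
    using quot_dim_eqI[OF E B(2)] by (simp add: Union_quot)
  show "\<exists>B\<subseteq>S. quot_basis E (quot S E) B \<and> card B = quot_dim E (quot S E)"
    using B quot_dim_eqI[OF E B(2)] by auto
qed

end

lemma plus_space_absorb:
  assumes "complex_vector.subspace S" "complex_vector.subspace E" "E \<subseteq> S"
  shows "plus_space S E = S"
proof
  show "plus_space S E \<subseteq> S" using assms complex_vector.subspace_add[OF assms(1)] by blast
  have "x = x + 0" "0 \<in> E" for x :: 'a using assms(2) by (simp_all add: complex_vector.subspace_0)
  thus "S \<subseteq> plus_space S E" by blast
qed

lemma quot_Int:
  assumes E: "complex_vector.subspace E"
  shows "quot S E \<inter> quot T E = quot (plus_space S E \<inter> plus_space T E) E"
proof (intro equalityI subsetI)
  fix X assume "X \<in> quot S E \<inter> quot T E"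
  then obtain s t where "s \<in> S" "t \<in> T" "X = coset E s" "X = coset E t" by (auto simp: quot_def)
  moreover from this have "s - t \<in> E" using E by (simp add: coset_eq_iff[symmetric])
  moreover have "s = s + 0" "s = t + (s - t)" "0 \<in> E" using E by (auto simp: complex_vector.subspace_0)
  ultimately show "X \<in> quot (plus_space S E \<inter> plus_space T E) E"
    unfolding quot_def by blast
next
  fix X assume "X \<in> quot (plus_space S E \<inter> plus_space T E) E"
  then obtain s t u v where st: "s \<in> S" "t \<in> T" "u \<in> E" "v \<in> E" "s + u = t + v" "X = coset E (s + u)"
    by (auto simp: quot_def)
  have "X = coset E s" using E st(3,6) by (simp add: coset_eq_iff)
  moreover have "X = coset E t" unfolding st(6) st(5) using E st(4) by (simp add: coset_eq_iff)
  ultimately show "X \<in> quot S E \<inter> quot T E" using st(1,2) by (auto simp: quot_def)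
qed

subsection \<open>Evaluation of free algebras\<close>

lemma free_eval_superset:
  assumes "finite S" "Poly_Mapping.keys x \<subseteq> S"
  shows "free_eval h x = (\<Sum>w\<in>S. Poly_Mapping.lookup x w *\<^sub>C prod_list (map h w))"
  unfolding free_eval_def
  using assms by (intro sum.mono_neutral_left) (auto simp: in_keys_iff)

lemma free_eval_add: "free_eval h (x + y) = free_eval h x + free_eval h y"
proof -
  let ?S = "Poly_Mapping.keys x \<union> Poly_Mapping.keys y"
  have "free_eval h (x + y) = (\<Sum>w\<in>?S. Poly_Mapping.lookup (x + y) w *\<^sub>C prod_list (map h w))"
    by (rule free_eval_superset) (use Poly_Mapping.keys_add[of x y] in auto)
  also have "\<dots> = free_eval h x + free_eval h y"
    using free_eval_superset[of ?S x h] free_eval_superset[of ?S y h]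
    by (simp add: lookup_add scaleC_add_left sum.distrib)
  finally show ?thesis .
qed

lemma free_eval_zero: "free_eval h 0 = 0"
  by (simp add: free_eval_def)

lemma free_eval_minus: "free_eval h (- x) = - free_eval h x"
  using free_eval_add[of h x "- x"] by (simp add: free_eval_zero eq_neg_iff_add_eq_0 add.commute)

lemma free_eval_diff: "free_eval h (x - y) = free_eval h x - free_eval h y"
  using free_eval_add[of h x "- y"] by (simp add: free_eval_minus)

lemma free_eval_sum: "free_eval h (sum f S) = (\<Sum>i\<in>S. free_eval h (f i))"
  by (induction S rule: infinite_finite_induct) (auto simp: free_eval_zero free_eval_add)

lemma free_eval_single: "free_eval h (Poly_Mapping.single w c) = c *\<^sub>C prod_list (map h w)"
  by (simp add: free_eval_def)

lemma poly_mapping_sum_single: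
  "x = (\<Sum>k\<in>Poly_Mapping.keys x. Poly_Mapping.single k (Poly_Mapping.lookup x k))"
  by (rule poly_mapping_eqI) (auto simp: lookup_sum lookup_single when_def in_keys_iff)

lemma free_eval_mult: "free_eval h (x * y) = free_eval h x * free_eval h y"
proof -
  have "free_eval h (x * y) = free_eval h ((\<Sum>k\<in>Poly_Mapping.keys x. Poly_Mapping.single k (Poly_Mapping.lookup x k)) *
      (\<Sum>l\<in>Poly_Mapping.keys y. Poly_Mapping.single l (Poly_Mapping.lookup y l)))"
    using poly_mapping_sum_single[of x] poly_mapping_sum_single[of y] by simp
  also have "\<dots> = (\<Sum>k\<in>Poly_Mapping.keys x. \<Sum>l\<in>Poly_Mapping.keys y.
      (Poly_Mapping.lookup x k * Poly_Mapping.lookup y l) *\<^sub>C (prod_list (map h k) * prod_list (map h l)))"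
    by (simp add: sum_product mult_single free_eval_sum free_eval_single plus_list_def)
  also have "\<dots> = free_eval h x * free_eval h y"
    by (simp add: free_eval_def sum_product mult_scaleC_left mult_scaleC_right scaleC_scaleC
        mult.commute[where 'a = complex])
  finally show ?thesis .
qed

lemma free_eval_one:
  fixes h :: "'g \<Rightarrow> 'w::complex_algebra"
  shows "free_eval h 1 = 1"
proof -
  have "(1 :: 'g free) = Poly_Mapping.single [] 1" by (simp add: single_one[symmetric] zero_list_def del: single_one)
  thus ?thesis using free_eval_single[of h "[]" 1] by (simp add: scaleC_one)
qed

lemma free_eval_power: "free_eval h (x ^ n) = free_eval h x ^ n"
  by (induction n) (simp_all add: free_eval_one free_eval_mult)

lemma free_eval_const: "free_eval h (const k) = k *\<^sub>C 1"
  by (simp add: const_def free_eval_single)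

lemma free_eval_var: "free_eval h (var x) = h x"
  by (simp add: var_def free_eval_single scaleC_one)

lemmas free_eval_simps = free_eval_add free_eval_zero free_eval_minus free_eval_diff free_eval_mult
  free_eval_one free_eval_power free_eval_const free_eval_var

lemma presented_relation:
  assumes "presented h R" "r \<in> R"
  shows "free_eval h r = 0"
  using assms hull_subset[of R two_sided_ideal] unfolding presented_def by blast

lemma two_sided_ideal_kernel: "two_sided_ideal {x. free_eval h x = 0}"
  by (simp add: two_sided_ideal_def free_eval_simps)

lemma presented_lift_zero:
  assumes "presented h R" "\<And>r. r \<in> R \<Longrightarrow> free_eval k r = 0" "free_eval h x = 0"
  shows "free_eval k x = 0"
proof -
  have "two_sided_ideal hull R \<subseteq> {x. free_eval k x = 0}"
    using assms(2) by (intro hull_minimal two_sided_ideal_kernel) auto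
  thus ?thesis using assms(1,3) unfolding presented_def by blast
qed

lemma presented_lift_relation:
  assumes "presented h R" "\<And>r. r \<in> R \<Longrightarrow> free_eval k r = 0"
    and "(\<Sum>i\<in>I. c i *\<^sub>C prod_list (map h (w i))) = 0"
  shows "(\<Sum>i\<in>I. c i *\<^sub>C prod_list (map k (w i))) = 0"
proof -
  let ?x = "\<Sum>i\<in>I. Poly_Mapping.single (w i) (c i)"
  have "free_eval h ?x = 0" using assms(3) by (simp add: free_eval_sum free_eval_single)
  with assms(1,2) have "free_eval k ?x = 0" by (rule presented_lift_zero)
  thus ?thesis by (simp add: free_eval_sum free_eval_single)
qed

lemma generated_eq_span: "generated h = complex_vector.span (range (\<lambda>w. prod_list (map h w)))"
proof
  show "generated h \<subseteq> complex_vector.span (range (\<lambda>w. prod_list (map h w)))"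
    by (auto simp: generated_def free_eval_def intro!: complex_vector.span_sum complex_vector.span_scale
        intro: complex_vector.span_base)
  have "complex_vector.subspace (generated h)"
  proof (rule complex_vector.subspaceI)
    show "0 \<in> generated h" unfolding generated_def by (metis free_eval_zero rangeI)
    show "x + y \<in> generated h" if "x \<in> generated h" "y \<in> generated h" for x y
      using that unfolding generated_def by (auto simp: free_eval_add[symmetric])
    show "c *\<^sub>C x \<in> generated h" if x: "x \<in> generated h" for c x
    proof -
      obtain y where "x = free_eval h y" using x by (auto simp: generated_def)
      hence "c *\<^sub>C x = free_eval h (const c * y)" by (simp add: free_eval_simps mult_scaleC_left)
      thus ?thesis by (simp add: generated_def)
    qed
  qed
  moreover have "range (\<lambda>w. prod_list (map h w)) \<subseteq> generated h"
  proof safe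
    fix w
    have "prod_list (map h w) = free_eval h (Poly_Mapping.single w 1)" by (simp add: free_eval_single scaleC_one)
    thus "prod_list (map h w) \<in> generated h" by (simp add: generated_def)
  qed
  ultimately show "complex_vector.span (range (\<lambda>w. prod_list (map h w))) \<subseteq> generated h"
    by (simp add: complex_vector.span_minimal)
qed

lemma subspace_generated: "complex_vector.subspace (generated h)"
  by (simp add: generated_eq_span)

lemma word_in_generated: "prod_list (map h w) \<in> generated h"
  by (simp add: generated_eq_span complex_vector.span_base)

subsection \<open>Linear operators on function spaces\<close>

typedef 'i op = "{f :: ('i \<Rightarrow> complex) \<Rightarrow> 'i \<Rightarrow> complex.
    \<forall>c u v. f (\<lambda>i. c * u i + v i) = (\<lambda>i. c * f u i + f v i)}"
  by (rule exI[where x = id]) simp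

setup_lifting type_definition_op

instantiation op :: (type) complex_algebra
begin

lift_definition zero_op :: "'a op" is "\<lambda>_ _. 0" by simp
lift_definition one_op :: "'a op" is "\<lambda>f. f" by simp
lift_definition plus_op :: "'a op \<Rightarrow> 'a op \<Rightarrow> 'a op" is "\<lambda>S T f i. S f i + T f i"
  by (simp add: algebra_simps)
lift_definition minus_op :: "'a op \<Rightarrow> 'a op \<Rightarrow> 'a op" is "\<lambda>S T f i. S f i - T f i"
  by (simp add: algebra_simps)
lift_definition uminus_op :: "'a op \<Rightarrow> 'a op" is "\<lambda>S f i. - S f i"
  by (simp add: algebra_simps)
lift_definition times_op :: "'a op \<Rightarrow> 'a op \<Rightarrow> 'a op" is "\<lambda>S T f. S (T f)"
  by simp
lift_definition scaleC_op :: "complex \<Rightarrow> 'a op \<Rightarrow> 'a op" is "\<lambda>c S f i. c * S f i"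
  by (simp add: algebra_simps)

instance
proof
  fix S T U :: "'a op" and k l :: complex
  show "S * T * U = S * (T * U)" by transfer simp
  show "1 * S = S" "S * 1 = S" by (transfer; simp)+
  show "(S + T) * U = S * U + T * U" by transfer simp
  show "S * (T + U) = S * T + S * U"
  proof transfer
    fix S T U :: "('a \<Rightarrow> complex) \<Rightarrow> 'a \<Rightarrow> complex"
    assume S: "\<forall>c u v. S (\<lambda>i. c * u i + v i) = (\<lambda>i. c * S u i + S v i)"
    show "(\<lambda>f. S (\<lambda>i. T f i + U f i)) = (\<lambda>f i. S (T f) i + S (U f) i)"
      using S[rule_format, of 1] by (simp add: fun_eq_iff)
  qed
  show "S * (k *\<^sub>C T) = k *\<^sub>C (S * T)"
  proof transfer
    fix k and S T :: "('a \<Rightarrow> complex) \<Rightarrow> 'a \<Rightarrow> complex"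
    assume S: "\<forall>c u v. S (\<lambda>i. c * u i + v i) = (\<lambda>i. c * S u i + S v i)"
    have "S (\<lambda>i. 0) = (\<lambda>i. 0)" using S[rule_format, of "-1" "\<lambda>_. 0" "\<lambda>_. 0"] by (simp add: fun_eq_iff)
    thus "(\<lambda>f. S (\<lambda>i. k * T f i)) = (\<lambda>f i. k * S (T f) i)"
      using S[rule_format, of k _ "\<lambda>_. 0"] by (simp add: fun_eq_iff)
  qed
  show "(0 :: 'a op) \<noteq> 1" by transfer (metis one_neq_zero)
qed (transfer; simp add: algebra_simps)+

end

lemma Rep_op_sum: "Rep_op (sum S I) f i = (\<Sum>j\<in>I. Rep_op (S j) f i)"
  by (induction I rule: infinite_finite_induct) (auto simp: zero_op.rep_eq plus_op.rep_eq)

subsection \<open>Monomials\<close>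

definition mon :: "(gen \<Rightarrow> 'w::complex_algebra) \<Rightarrow> nat \<times> nat \<times> nat \<Rightarrow> 'w" where
  "mon h = (\<lambda>(m, n, k). h Ga ^ m * h Gb ^ n * h Gc ^ k)"

definition form :: "(gen \<Rightarrow> 'w::complex_algebra) \<Rightarrow> gen list \<Rightarrow> 'w" where
  "form h w = prod_list (map h w)"

definition exps :: "(nat \<times> nat \<times> nat) list" where
  "exps = List.product [0,1,2] (List.product [0,1,2] [0,1,2])"

lemma exps_iff: "(m, n, k) \<in> set exps \<longleftrightarrow> m < 3 \<and> n < 3 \<and> k < 3"
proof -
  have "set [0, 1, 2] = {i::nat. i < 3}" by auto
  thus ?thesis unfolding exps_def set_product by (simp only: mem_Sigma_iff mem_Collect_eq)
qed

definition mon_word :: "nat \<times> nat \<times> nat \<Rightarrow> gen list" where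
  "mon_word = (\<lambda>(m, n, k). replicate m Ga @ replicate n Gb @ replicate k Gc)"

lemma mon_eq_word: "mon h i = prod_list (map h (mon_word i))"
proof -
  have "prod_list (replicate m x) = x ^ m" for m and x :: 'a by (induction m) auto
  thus ?thesis by (simp add: mon_def mon_word_def split_beta mult.assoc)
qed

text \<open>The regular representation with the powers of \<open>a\<close> Fourier-transformed: \<open>a\<close> acts diagonally
  and \<open>b\<close>, \<open>c\<close> shift its eigenvalue, so that no index has to be reduced modulo 3.\<close>

definition quantum_op :: "complex \<Rightarrow> gen \<Rightarrow> (nat \<times> nat \<times> nat \<Rightarrow> complex) \<Rightarrow> nat \<times> nat \<times> nat \<Rightarrow> complex" where
  "quantum_op q x f = (\<lambda>(m, n, k). case x of
      Ga \<Rightarrow> q ^ m * f (m, n, k)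
    | Gb \<Rightarrow> if n = 1 \<or> n = 2 then f (m + 1, n - 1, k) else 0
    | Gc \<Rightarrow> if k = 1 \<or> k = 2 then f (m + 1, n, k - 1) else 0
    | Gd \<Rightarrow> q ^ m * q ^ m * (f (m, n, k) +
         (if (n = 1 \<or> n = 2) \<and> (k = 1 \<or> k = 2) then q ^ 2 * f (m + 2, n - 1, k - 1) else 0)))"

lift_definition quantum_rep :: "complex \<Rightarrow> gen \<Rightarrow> (nat \<times> nat \<times> nat) op" is quantum_op
  by (auto simp: quantum_op_def fun_eq_iff algebra_simps split: gen.split)

lemma root_of_unity_eqs:
  assumes "q ^ 3 = 1" "q \<noteq> (1 :: complex)"
  shows "q ^ 2 = - 1 - q" "q * q = - 1 - q" "q * (q * x) = - x - q * x" "1 / q = - 1 - q" "q \<noteq> 0"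
    "mu q = 1 - q"
proof -
  have "(q - 1) * (q ^ 2 + q + 1) = q ^ 3 - 1" by algebra
  hence "q ^ 2 + q + 1 = 0" using assms by simp
  thus q2: "q ^ 2 = - 1 - q" by algebra
  show qq: "q * q = - 1 - q" using q2 by (simp add: power2_eq_square)
  show "q * (q * x) = - x - q * x" using arg_cong[OF qq, of "\<lambda>y. y * x"] by (simp add: algebra_simps)
  show q0: "q \<noteq> 0" using assms(1) by auto
  have "q * (- 1 - q) = 1" using qq by algebra
  thus "1 / q = - 1 - q" using q0 by (metis nonzero_mult_div_cancel_left)
  have "1 / q ^ 2 = q" using assms(1) q0 by (simp add: field_simps power3_eq_cube power2_eq_square)
  thus "mu q = 1 - q" by (simp add: mu_def)
qed

lemma quantum_rep_basic:
  assumes q: "q ^ 3 = 1" "q \<noteq> 1"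
  defines "A \<equiv> quantum_rep q Ga" and "B \<equiv> quantum_rep q Gb" and "C \<equiv> quantum_rep q Gc"
  shows "B * A = q *\<^sub>C (A * B)" "C * A = q *\<^sub>C (A * C)" "C * B = B * C" "A * (A * A) = 1"
    "B * (B * B) = 0" "C * (C * C) = 0"
    "quantum_rep q Gd = A * A + (q ^ 2) *\<^sub>C (A * (A * (B * C)))"
proof -
  have powm: "q ^ m * (q ^ m * (q ^ m * x)) = x" for m x
  proof -
    have "q ^ m * (q ^ m * (q ^ m * x)) = (q ^ m) ^ 3 * x" by (simp add: power3_eq_cube)
    also have "(q ^ m) ^ 3 = (q ^ 3) ^ m" by (metis power_mult mult.commute)
    finally show ?thesis by (simp add: q(1))
  qed
  show "B * A = q *\<^sub>C (A * B)" "C * A = q *\<^sub>C (A * C)" "C * B = B * C"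
    unfolding A_def B_def C_def by (transfer fixing: q; auto simp: quantum_op_def fun_eq_iff)+
  show "A * (A * A) = 1" unfolding A_def by (transfer fixing: q; auto simp: quantum_op_def fun_eq_iff powm)
  show "B * (B * B) = 0" unfolding B_def by (transfer fixing: q; auto simp: quantum_op_def fun_eq_iff)
  show "C * (C * C) = 0" unfolding C_def by (transfer fixing: q; auto simp: quantum_op_def fun_eq_iff)
  show "quantum_rep q Gd = A * A + (q ^ 2) *\<^sub>C (A * (A * (B * C)))"
    unfolding A_def B_def C_def by (transfer fixing: q; auto simp: quantum_op_def fun_eq_iff algebra_simps numeral_2_eq_2)
qed

lemma scaleC_numeral:
  fixes x :: "'w::complex_algebra"
  shows "2 *\<^sub>C x = x + x" "(c * 2) *\<^sub>C x = c *\<^sub>C x + c *\<^sub>C x"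
    "3 *\<^sub>C x = x + x + x" "(c * 3) *\<^sub>C x = c *\<^sub>C x + c *\<^sub>C x + c *\<^sub>C x"
    "(2 * c) *\<^sub>C x = c *\<^sub>C x + c *\<^sub>C x" "(3 * c) *\<^sub>C x = c *\<^sub>C x + c *\<^sub>C x + c *\<^sub>C x"
proof -
  have "2 = (1 + 1 :: complex)" "3 = (1 + 1 + 1 :: complex)" by simp_all
  thus "2 *\<^sub>C x = x + x" "(c * 2) *\<^sub>C x = c *\<^sub>C x + c *\<^sub>C x"
    "3 *\<^sub>C x = x + x + x" "(c * 3) *\<^sub>C x = c *\<^sub>C x + c *\<^sub>C x + c *\<^sub>C x"
    "(2 * c) *\<^sub>C x = c *\<^sub>C x + c *\<^sub>C x" "(3 * c) *\<^sub>C x = c *\<^sub>C x + c *\<^sub>C x + c *\<^sub>C x"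
    by (simp_all only: scaleC_add_left scaleC_one distrib_left distrib_right mult_1_left mult_1_right)
qed

lemmas scaleC_expand = scaleC_numeral scaleC_add_left complex_vector.scale_left_diff_distrib
  complex_vector.scale_minus_left complex_vector.scale_one complex_vector.scale_zero_left
  complex_vector.scale_zero_right complex_vector.scale_minus_right scaleC_add_right
  complex_vector.scale_right_diff_distrib scaleC_scaleC mult_scaleC_left mult_scaleC_right

lemma quantum_rep_relations:
  assumes q: "q ^ 3 = 1" "q \<noteq> 1" and r: "r \<in> A_relators q"
  shows "free_eval (quantum_rep q) r = 0"
proof -
  define A where "A = quantum_rep q Ga"
  define B where "B = quantum_rep q Gb"
  define C where "C = quantum_rep q Gc"
  note b = quantum_rep_basic[OF q, folded A_def B_def C_def]
  note e = root_of_unity_eqs[OF q]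
  have b': "B * (A * x) = q *\<^sub>C (A * (B * x))" "C * (A * x) = q *\<^sub>C (A * (C * x))"
    "C * (B * x) = B * (C * x)" "A * (A * (A * x)) = x" "B * (B * (B * x)) = 0" "C * (C * (C * x)) = 0" for x
    using arg_cong[OF b(1), of "\<lambda>y. y * x"] arg_cong[OF b(2), of "\<lambda>y. y * x"] arg_cong[OF b(3), of "\<lambda>y. y * x"]
      arg_cong[OF b(4), of "\<lambda>y. y * x"] arg_cong[OF b(5), of "\<lambda>y. y * x"] arg_cong[OF b(6), of "\<lambda>y. y * x"]
    by (simp_all add: mult.assoc mult_scaleC_left)
  define D where "D = quantum_rep q Gd"
  define X where "X = B * C"
  have X: "X * A = (- 1 - q) *\<^sub>C (A * X)" "X * (A * x) = (- 1 - q) *\<^sub>C (A * (X * x))" "X * (X * X) = 0" for x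
    by (simp_all add: X_def b b' e mult.assoc scaleC_expand)
  have D: "D = A * A + (- 1 - q) *\<^sub>C (A * (A * X))" by (simp add: D_def X_def b(7) e)
  have DD: "D * D = A - q *\<^sub>C (A * X) + (- 1 - q) *\<^sub>C (A * (X * X))"
    unfolding D by (simp add: X b' e scaleC_expand distrib_left distrib_right left_diff_distrib right_diff_distrib mult.assoc)
  have "D * (D * D) = 1"
    unfolding DD unfolding D
    by (simp add: X b(4) b' e scaleC_expand distrib_left distrib_right left_diff_distrib right_diff_distrib mult.assoc)
  hence D3: "free_eval (quantum_rep q) (var Gd ^ 3 - 1) = 0"
    by (simp add: free_eval_simps power3_eq_cube mult.assoc D_def)
  have DBC: "quantum_rep q Gd = A * A - A * (A * (B * C)) - q *\<^sub>C (A * (A * (B * C)))"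
    by (simp add: b(7) e scaleC_expand)
  show ?thesis
    using r unfolding A_relators_def Let_def
    by (elim insertE emptyE; hypsubst; (rule D3)?; simp add: free_eval_simps b b' A_def[symmetric] B_def[symmetric] C_def[symmetric] DBC e
        scaleC_expand distrib_left distrib_right left_diff_distrib right_diff_distrib mult.assoc power3_eq_cube)
qed


lemma quantum_rep_monomial:
  assumes "n < 3" "k < 3"
  shows "Rep_op (mon (quantum_rep q) (m, n, k)) (\<lambda>(m', n', k'). if n' = 0 \<and> k' = 0 then 1 else 0) (m', n', k') =
    (if n' = n \<and> k' = k then q ^ (m * m') else 0)"
proof -
  let ?f = "\<lambda>(m', n', k'). if n' = 0 \<and> k' = 0 then 1 else 0 :: complex"
  have c: "Rep_op (quantum_rep q Gc ^ k) ?f = (\<lambda>(m', n', k'). if n' = 0 \<and> k' = k then 1 else 0)"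
    using \<open>k < 3\<close>
    by (induction k) (auto simp: one_op.rep_eq times_op.rep_eq quantum_rep.rep_eq quantum_op_def fun_eq_iff)
  have b: "Rep_op (quantum_rep q Gb ^ n) (\<lambda>(m', n', k'). if n' = 0 \<and> k' = k then 1 else 0) =
      (\<lambda>(m', n', k'). if n' = n \<and> k' = k then 1 else 0)"
    using \<open>n < 3\<close>
    by (induction n) (auto simp: one_op.rep_eq times_op.rep_eq quantum_rep.rep_eq quantum_op_def fun_eq_iff)
  have a: "Rep_op (quantum_rep q Ga ^ m) (\<lambda>(m', n', k'). if n' = n \<and> k' = k then 1 else 0) =
      (\<lambda>(m', n', k'). if n' = n \<and> k' = k then q ^ (m * m') else 0)"
    by (induction m) (auto simp: one_op.rep_eq times_op.rep_eq quantum_rep.rep_eq quantum_op_def fun_eq_iff power_add)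
  show ?thesis by (simp add: mon_def times_op.rep_eq c b a)
qed

lemma vandermonde3:
  assumes q: "q ^ 3 = 1" "q \<noteq> (1 :: complex)"
    and "x + y + z = 0" "x + y * q + z * q ^ 2 = 0" "x + y * q ^ 2 + z * q ^ 4 = 0"
  shows "x = 0 \<and> y = 0 \<and> z = 0"
proof -
  note e = root_of_unity_eqs[OF q]
  have "q ^ 4 = q" using q(1) by (simp add: eval_nat_numeral algebra_simps)
  with assms have 1: "x + y + z = 0" "x + y * q + z * (- 1 - q) = 0" "x + y * (- 1 - q) + z * q = 0"
    by (simp_all add: e(1))
  from 1(2,3) have "2 * x - y - z = 0" by algebra
  with 1(1) have x: "x = 0" by algebra
  hence "z = - y" using 1(1) by algebra
  with 1(2) x have "y * (2 * q + 1) = 0" by algebra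
  moreover have "2 * q + 1 \<noteq> 0"
  proof
    assume "2 * q + 1 = 0"
    hence "4 * (q * q) = 1" by algebra
    hence "4 * (- 1 - q) = 1" by (simp only: e(2))
    hence "4 * q = - 5" by algebra
    moreover have "4 * q = - 2" using \<open>2 * q + 1 = 0\<close> by algebra
    ultimately show False by simp
  qed
  ultimately show ?thesis using x \<open>z = - y\<close> by simp
qed

lemma A_monomials_independent:
  assumes q: "q ^ 3 = 1" "q \<noteq> 1" and g: "presented g (A_relators q)"
    and s: "(\<Sum>i\<in>set exps. c i *\<^sub>C mon g i) = 0" and i: "i \<in> set exps"
  shows "c i = 0"
proof -
  let ?f = "\<lambda>(m', n', k'). if n' = 0 \<and> k' = 0 then 1 else 0 :: complex"
  have z: "(\<Sum>i\<in>set exps. c i *\<^sub>C mon (quantum_rep q) i) = 0"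
    using presented_lift_relation[OF g quantum_rep_relations[OF q], of c mon_word "set exps"] s
    by (simp add: mon_eq_word)
  have eqn: "(\<Sum>m<3. c (m, n, k) * q ^ (m * M)) = 0" if nk: "n < 3" "k < 3" for n k M
  proof -
    have "0 = Rep_op (\<Sum>i\<in>set exps. c i *\<^sub>C mon (quantum_rep q) i) ?f (M, n, k)"
      by (simp add: z zero_op.rep_eq)
    also have "\<dots> = (\<Sum>i\<in>set exps. c i * Rep_op (mon (quantum_rep q) i) ?f (M, n, k))"
      by (simp add: Rep_op_sum scaleC_op.rep_eq)
    also have "\<dots> = (\<Sum>i\<in>set exps. if snd i = (n, k) then c i * q ^ (fst i * M) else 0)"
      by (intro sum.cong) (auto simp: exps_iff quantum_rep_monomial)
    also have "\<dots> = (\<Sum>i\<in>(\<lambda>m. (m, n, k)) ` {..<3}. c i * q ^ (fst i * M))"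
      using nk by (intro sum.mono_neutral_cong_right) (auto simp: exps_iff)
    also have "\<dots> = (\<Sum>m<3. c (m, n, k) * q ^ (m * M))"
      by (subst sum.reindex) (auto simp: inj_on_def)
    finally show ?thesis by simp
  qed
  obtain m n k where mnk: "i = (m, n, k)" "m < 3" "n < 3" "k < 3" using i exps_iff by (metis prod_cases3)
  have "c (0, n, k) = 0 \<and> c (1, n, k) = 0 \<and> c (2, n, k) = 0"
    using eqn[OF mnk(3,4), of 0] eqn[OF mnk(3,4), of 1] eqn[OF mnk(3,4), of 2]
    by (intro vandermonde3[OF q]) (simp_all add: numeral_3_eq_3 eval_nat_numeral)
  thus ?thesis using mnk by (auto simp: numeral_3_eq_3 less_Suc_eq numeral_2_eq_2)
qed

subsection \<open>Sparse vectors over the Eisenstein integers\<close>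

text \<open>\<open>Eis x y\<close> stands for $x + y q$.\<close>

datatype eis = Eis int int

instantiation eis :: "{zero, plus, times}"
begin

definition zero_eis :: eis where "zero_eis = Eis 0 0"

fun plus_eis :: "eis \<Rightarrow> eis \<Rightarrow> eis" where
  "plus_eis (Eis a b) (Eis c d) = Eis (a + c) (b + d)"

fun times_eis :: "eis \<Rightarrow> eis \<Rightarrow> eis" where
  "times_eis (Eis a b) (Eis c d) = (let t = b * d in Eis (a * c - t) (a * d + b * c - t))"

instance ..

end

fun of_eis :: "complex \<Rightarrow> eis \<Rightarrow> complex" where
  "of_eis q (Eis a b) = of_int a + of_int b * q"

lemma of_eis_zero: "of_eis q 0 = 0"
  by (simp add: zero_eis_def)

lemma of_eis_add: "of_eis q (c + d) = of_eis q c + of_eis q d"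
  by (cases c; cases d) (simp add: algebra_simps)

lemma of_eis_mult:
  assumes "q ^ 3 = 1" "q \<noteq> 1"
  shows "of_eis q (c * d) = of_eis q c * of_eis q d"
  by (cases c; cases d) (simp add: root_of_unity_eqs(2,3)[OF assms] Let_def algebra_simps)

text \<open>The norm $x^2 - xy + y^2$ of $x + yq$ is a nonzero integer unless $x = y = 0$.\<close>

lemma of_eis_eq_0_iff:
  assumes "q ^ 3 = 1" "q \<noteq> 1"
  shows "of_eis q c = 0 \<longleftrightarrow> c = 0"
proof (cases c)
  case (Eis x y)
  have "(of_int x + of_int y * q) * (of_int x - of_int y - of_int y * q) = of_int (x * x - x * y + y * y)"
    by (simp add: root_of_unity_eqs(2,3)[OF assms] algebra_simps)
  moreover have "x = 0 \<and> y = 0" if "x * x - x * y + y * y = 0"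
  proof -
    have "(2 * x - y) ^ 2 + 3 * y ^ 2 = 4 * (x * x - x * y + y * y)" by (simp add: power2_eq_square algebra_simps)
    hence *: "(2 * x - y) ^ 2 + 3 * y ^ 2 = 0" using that by simp
    have "y ^ 2 = 0" using * zero_le_power2[of "2 * x - y"] zero_le_power2[of y] by linarith
    moreover from this * have "(2 * x - y) ^ 2 = 0" by simp
    ultimately show ?thesis by simp
  qed
  ultimately have "x = 0 \<and> y = 0" if "of_int x + of_int y * q = 0"
    using that by (metis mult_zero_left of_int_eq_0_iff)
  thus ?thesis using Eis by (auto simp: zero_eis_def)
qed

type_synonym 'k vec = "('k \<times> eis) list"

fun add_term :: "'k \<Rightarrow> eis \<Rightarrow> 'k vec \<Rightarrow> 'k vec" where
  "add_term k c [] = [(k, c)]"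
| "add_term k c ((k', c') # r) = (if k = k' then (k', c + c') # r else (k', c') # add_term k c r)"

fun add_scaled :: "eis \<Rightarrow> 'k vec \<Rightarrow> 'k vec \<Rightarrow> 'k vec" where
  "add_scaled s [] v = v"
| "add_scaled s ((k, c) # r) v = add_scaled s r (add_term k (s * c) v)"

fun lin :: "('j \<Rightarrow> 'k vec) \<Rightarrow> 'j vec \<Rightarrow> 'k vec" where
  "lin f [] = []"
| "lin f ((k, c) # r) = (if c = 0 then lin f r else add_scaled c (f k) (lin f r))"

definition is_zero :: "'k vec \<Rightarrow> bool" where
  "is_zero v \<longleftrightarrow> (\<forall>(k, c)\<in>set v. c = 0)"

fun coefficient :: "'k \<Rightarrow> 'k vec \<Rightarrow> eis" where
  "coefficient k [] = 0"
| "coefficient k ((k', c) # r) = (if k = k' then c + coefficient k r else coefficient k r)"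

fun dot :: "'k vec \<Rightarrow> 'k vec \<Rightarrow> eis" where
  "dot [] v = 0"
| "dot ((k, c) # r) v = c * coefficient k v + dot r v"

fun triangular :: "'k vec list \<Rightarrow> 'k vec list \<Rightarrow> bool" where
  "triangular [] [] = True"
| "triangular (w # ws) (v # vs) \<longleftrightarrow> dot w v \<noteq> 0 \<and> (\<forall>u\<in>set vs. dot w u = 0) \<and> triangular ws vs"
| "triangular _ _ = False"

definition vec_value :: "complex \<Rightarrow> ('k \<Rightarrow> 'w::complex_algebra) \<Rightarrow> 'k vec \<Rightarrow> 'w" where
  "vec_value q b v = (\<Sum>(k, c)\<leftarrow>v. of_eis q c *\<^sub>C b k)"

lemma vec_value_simps [simp]:
  "vec_value q b [] = 0"
  "vec_value q b ((k, c) # v) = of_eis q c *\<^sub>C b k + vec_value q b v"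
  by (simp_all add: vec_value_def)

lemma vec_value_append: "vec_value q b (u @ v) = vec_value q b u + vec_value q b v"
  by (induction u) auto

lemma vec_value_is_zero: "is_zero v \<Longrightarrow> vec_value q b v = 0"
  by (induction v) (auto simp: is_zero_def of_eis_zero)

lemma keys_add_term: "fst ` set (add_term k c v) = insert k (fst ` set v)"
  by (induction k c v rule: add_term.induct) auto

lemma keys_add_scaled: "fst ` set (add_scaled s u v) = fst ` set u \<union> fst ` set v"
  by (induction s u v rule: add_scaled.induct) (auto simp: keys_add_term)

lemma keys_lin:
  assumes "\<And>k. k \<in> fst ` set v \<Longrightarrow> fst ` set (F k) \<subseteq> S"
  shows "fst ` set (lin F v) \<subseteq> S"
  using assms by (induction F v rule: lin.induct) (auto simp: keys_add_scaled)

lemma vec_value_in_span: "fst ` set v \<subseteq> K \<Longrightarrow> vec_value q b v \<in> complex_vector.span (b ` K)"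
  by (induction v)
    (auto simp: complex_vector.span_add complex_vector.span_scale complex_vector.span_base complex_vector.span_zero)

context
  fixes q :: complex
  assumes q: "q ^ 3 = 1" "q \<noteq> 1"
begin

lemma vec_value_add_term: "vec_value q b (add_term k c v) = of_eis q c *\<^sub>C b k + vec_value q b v"
  by (induction k c v rule: add_term.induct) (auto simp: of_eis_add scaleC_add_left)

lemma vec_value_add_scaled: "vec_value q b (add_scaled s u v) = of_eis q s *\<^sub>C vec_value q b u + vec_value q b v"
  by (induction s u v rule: add_scaled.induct)
    (auto simp: vec_value_add_term of_eis_mult[OF q] scaleC_scaleC scaleC_add_right)

lemma vec_value_lin:
  assumes "linC f" "\<And>k. k \<in> fst ` set v \<Longrightarrow> f (b k) = vec_value q b' (F k)"
  shows "vec_value q b' (lin F v) = f (vec_value q b v)"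
  using assms(2)
  by (induction v)
    (auto simp: linC_zero[OF assms(1)] linC_add[OF assms(1)] linC_scale[OF assms(1)] vec_value_add_scaled of_eis_zero)

lemma triangular_indep:
  assumes tri: "triangular ws vs"
    and phi: "\<And>k. functional (phi k)" "\<And>k k'. k \<in> K \<Longrightarrow> k' \<in> K \<Longrightarrow> phi k (b k') = (if k = k' then 1 else 0)"
    and ws: "\<And>w. w \<in> set ws \<Longrightarrow> fst ` set w \<subseteq> K" and vs: "\<And>v. v \<in> set vs \<Longrightarrow> fst ` set v \<subseteq> K"
  shows "indep_list (map (vec_value q b) vs)"
proof -
  define F where "F w x = (\<Sum>(k, c)\<leftarrow>w. of_eis q c * phi k x)" for w x
  have fF: "functional (F w)" for w
    using phi(1) unfolding F_def functional_def
    by (induction w) (auto simp: algebra_simps)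
  have co: "phi k (vec_value q b v) = of_eis q (coefficient k v)" if "k \<in> K" "fst ` set v \<subseteq> K" for k v
    using that(2)
    by (induction v) (use phi that(1) in \<open>auto simp: functional_zero of_eis_zero of_eis_add functional_def\<close>)
  have dot: "F w (vec_value q b v) = of_eis q (dot w v)" if "fst ` set w \<subseteq> K" "fst ` set v \<subseteq> K" for w v
    using that(1)
    by (induction w) (auto simp: F_def of_eis_zero of_eis_add of_eis_mult[OF q] co that(2))
  have "separated (map F ws) (map (vec_value q b) vs)"
    using tri ws vs
    by (induction ws vs rule: triangular.induct) (auto simp: fF dot of_eis_eq_0_iff[OF q] of_eis_zero)
  thus ?thesis by (rule separated_indep)
qed

end

subsection \<open>The calculus in coordinates\<close>

type_synonym idx = "gen list \<times> nat \<times> nat \<times> nat"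

fun eis_q_power :: "nat \<Rightarrow> eis" where
  "eis_q_power 0 = Eis 1 0"
| "eis_q_power (Suc m) = Eis 0 1 * eis_q_power m"

definition pred3 :: "nat \<Rightarrow> nat" where
  "pred3 m = (if m = 0 then 2 else m - 1)"

definition succ3 :: "nat \<Rightarrow> nat" where
  "succ3 m = (if m = 2 then 0 else Suc m)"

text \<open>Here \<open>d = a\<^sup>2 (1 + q\<^sup>2 b c)\<close>, since \<open>a d = 1 + q\<^sup>2 b c\<close> and \<open>a\<^sup>3 = 1\<close>.\<close>

fun mult_mon :: "gen \<Rightarrow> nat \<times> nat \<times> nat \<Rightarrow> (nat \<times> nat \<times> nat) vec" where
  "mult_mon Ga (m, n, k) = [((succ3 m, n, k), Eis 1 0)]"
| "mult_mon Gb (m, n, k) = (if n = 2 then [] else [((m, Suc n, k), eis_q_power m)])"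
| "mult_mon Gc (m, n, k) = (if k = 2 then [] else [((m, n, Suc k), eis_q_power m)])"
| "mult_mon Gd (m, n, k) = ((pred3 m, n, k), Eis 1 0) #
     (if n = 2 \<or> k = 2 then [] else [((pred3 m, Suc n, Suc k), Eis (-1) (-1) * eis_q_power (2 * m))])"

text \<open>An entry \<open>(c, w', y)\<close> of \<open>cross x w\<close> is the term \<open>c e\<^bsub>w'\<^esub> y\<close> of \<open>x e\<^sub>w\<close>.\<close>

fun cross :: "gen \<Rightarrow> gen \<Rightarrow> (eis \<times> gen \<times> gen) list" where
  "cross Ga Ga = [(Eis 0 1, Ga, Ga), (Eis 1 (-1), Gc, Gc), (Eis 3 3, Gd, Ga)]"
| "cross Ga Gb = [(Eis 1 0, Gb, Ga), (Eis 1 2, Gd, Gc)]"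
| "cross Ga Gc = [(Eis 1 0, Gc, Ga)]"
| "cross Ga Gd = [(Eis (-1) (-1), Gd, Ga)]"
| "cross Gc Ga = [(Eis (-1) (-1), Ga, Gc), (Eis 1 (-1), Gb, Ga)]"
| "cross Gc Gb = [(Eis 1 0, Gb, Gc)]"
| "cross Gc Gc = [(Eis 1 0, Gc, Gc), (Eis 1 2, Gd, Ga)]"
| "cross Gc Gd = [(Eis 0 1, Gd, Gc)]"
| "cross Gb Ga = [(Eis 0 1, Ga, Gb), (Eis 1 (-1), Gc, Gd), (Eis 3 3, Gd, Gb)]"
| "cross Gb Gb = [(Eis 1 0, Gb, Gb), (Eis 1 2, Gd, Gd)]"
| "cross Gb Gc = [(Eis 1 0, Gc, Gb)]"
| "cross Gb Gd = [(Eis (-1) (-1), Gd, Gb)]"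
| "cross Gd Ga = [(Eis (-1) (-1), Ga, Gd), (Eis 1 (-1), Gb, Gb)]"
| "cross Gd Gb = [(Eis 1 0, Gb, Gd)]"
| "cross Gd Gc = [(Eis 1 0, Gc, Gd), (Eis 1 2, Gd, Gb)]"
| "cross Gd Gd = [(Eis 0 1, Gd, Gd)]"

fun mult_1form :: "gen \<Rightarrow> gen \<times> nat \<times> nat \<times> nat \<Rightarrow> (gen \<times> nat \<times> nat \<times> nat) vec" where
  "mult_1form x (w, i) = concat (map (\<lambda>(c, w', y). map (\<lambda>(i', c'). ((w', i'), c * c')) (mult_mon y i)) (cross x w))"

fun mon_theta_rec :: "nat \<times> nat \<times> nat \<Rightarrow> (gen \<times> nat \<times> nat \<times> nat) vec" where
  "mon_theta_rec (m, n, k) = (lin (mult_1form Ga) ^^ m) ((lin (mult_1form Gb) ^^ n)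
     ((lin (mult_1form Gc) ^^ k) [((Ga, 0, 0, 0), Eis 1 0), ((Gd, 0, 0, 0), Eis 1 0)]))"

definition sgn3 :: "nat \<Rightarrow> eis" where
  "sgn3 j = (if j = 0 \<or> j = 3 then Eis 0 0 else if j = 1 \<or> j = 4 then Eis 1 0 else Eis (-1) 0)"

text \<open>The coordinates of \<open>a\<^sup>mb\<^sup>nc\<^sup>k \<theta>\<close> in closed form, read off from the 27 values of the recursion.\<close>

fun mon_theta :: "nat \<times> nat \<times> nat \<Rightarrow> (gen \<times> nat \<times> nat \<times> nat) vec" where
  "mon_theta (m, n, k) =
     [((Ga, m, n, k), eis_q_power (m + n + 2 * k)),
      ((Gd, m, n, k), eis_q_power (k + 2 * m + 2 * n) + Eis 3 3 * (sgn3 (m + n) * sgn3 (Suc k)))]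
   @ (if k = 0 then [] else [((Gb, succ3 m, n, k - 1), Eis 1 (-1) * (eis_q_power n * sgn3 k))])
   @ (if n = 0 then [] else [((Gc, pred3 m, n - 1, k), Eis 1 (-1) * (eis_q_power (2 * k) * sgn3 n))])
   @ (if k = 2 then [] else [((Gc, pred3 m, n, Suc k), Eis 1 (-1) * (eis_q_power (2 * k + m + 2) * sgn3 (m + n)))])
   @ (if n = 0 \<or> k = 0 then [] else
        [((Gd, m, n - 1, k - 1), Eis (-3) 0 * (eis_q_power (2 + 2 * m) * (sgn3 n * sgn3 k)))])"

definition forms :: "gen list list" where
  "forms = [[], [Ga], [Gb], [Gc], [Gd], [Ga, Gb], [Ga, Gc], [Ga, Gd], [Gb, Gc], [Gb, Gd], [Gc, Gd], [Ga, Gb, Gc], [Ga, Gb, Gd], [Ga, Gc, Gd], [Gb, Gc, Gd], [Ga, Gb, Gc, Gd]]"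

definition wedge_table :: "((gen \<times> gen list) \<times> gen list vec) list" where
  "wedge_table =
    [((Ga, [Ga]), [([Gb, Gc], Eis 1 (-1))]),
     ((Ga, [Ga, Gd]), [([Gb, Gc, Gd], Eis 1 (-1))]),
     ((Gb, [Ga]), [([Ga, Gb], Eis 0 (-1)), ([Gb, Gd], Eis 1 2)]),
     ((Gb, [Ga, Gc]), [([Ga, Gb, Gc], Eis 0 (-1)), ([Gb, Gc, Gd], Eis (-1) (-2))]),
     ((Gb, [Ga, Gd]), [([Ga, Gb, Gd], Eis 0 (-1))]),
     ((Gb, [Ga, Gc, Gd]), [([Ga, Gb, Gc, Gd], Eis 0 (-1))]),
     ((Gc, [Ga]), [([Ga, Gc], Eis 1 1), ([Gc, Gd], Eis (-1) 1)]),
     ((Gc, [Gb]), [([Gb, Gc], Eis (-1) 0)]),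
     ((Gc, [Ga, Gb]), [([Ga, Gb, Gc], Eis (-1) (-1)), ([Gb, Gc, Gd], Eis (-1) 1)]),
     ((Gc, [Ga, Gd]), [([Ga, Gc, Gd], Eis 1 1)]),
     ((Gc, [Gb, Gd]), [([Gb, Gc, Gd], Eis (-1) 0)]),
     ((Gc, [Ga, Gb, Gd]), [([Ga, Gb, Gc, Gd], Eis (-1) (-1))]),
     ((Gd, [Ga]), [([Ga, Gd], Eis (-1) 0), ([Gb, Gc], Eis (-1) 1)]),
     ((Gd, [Gb]), [([Gb, Gd], Eis (-1) 0)]),
     ((Gd, [Gc]), [([Gc, Gd], Eis (-1) 0)]),
     ((Gd, [Ga, Gb]), [([Ga, Gb, Gd], Eis 1 0)]),
     ((Gd, [Ga, Gc]), [([Ga, Gc, Gd], Eis 1 0)]),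
     ((Gd, [Ga, Gd]), [([Gb, Gc, Gd], Eis (-1) 1)]),
     ((Gd, [Gb, Gc]), [([Gb, Gc, Gd], Eis 1 0)]),
     ((Gd, [Ga, Gb, Gc]), [([Ga, Gb, Gc, Gd], Eis (-1) 0)])]"

definition wedge :: "gen \<Rightarrow> gen list \<Rightarrow> gen list vec" where
  "wedge x w = (case map_of wedge_table (x, w) of Some v \<Rightarrow> v
     | None \<Rightarrow> if x # w \<in> set forms then [(x # w, Eis 1 0)] else [])"

definition hodge_table :: "(gen list \<times> gen list vec) list" where
  "hodge_table =
    [([], [([Ga, Gb, Gc, Gd], Eis 1 0)]),
     ([Ga], [([Ga, Gb, Gc], Eis (-1) 0), ([Gb, Gc, Gd], Eis (-1) 1)]),
     ([Gb], [([Ga, Gb, Gd], Eis (-1) 0)]),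
     ([Gc], [([Ga, Gc, Gd], Eis (-1) (-1))]),
     ([Gd], [([Gb, Gc, Gd], Eis 1 0)]),
     ([Ga, Gb], [([Ga, Gb], Eis (-1) 0), ([Gb, Gd], Eis 2 (-2))]),
     ([Ga, Gc], [([Ga, Gc], Eis 1 0)]),
     ([Ga, Gd], [([Gb, Gc], Eis 2 2), ([Ga, Gd], Eis 1 2)]),
     ([Gb, Gc], [([Ga, Gd], Eis 0 (-2)), ([Gb, Gc], Eis (-1) (-2))]),
     ([Gb, Gd], [([Gb, Gd], Eis 1 0)]),
     ([Gc, Gd], [([Gc, Gd], Eis (-1) 0)]),
     ([Ga, Gb, Gc], [([Ga], Eis (-1) 0), ([Gd], Eis (-1) 1)]),
     ([Ga, Gb, Gd], [([Gb], Eis (-1) 0)]),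
     ([Ga, Gc, Gd], [([Gc], Eis 0 1)]),
     ([Gb, Gc, Gd], [([Gd], Eis 1 0)]),
     ([Ga, Gb, Gc, Gd], [([], Eis 1 0)])]"

definition hodge :: "gen list \<Rightarrow> gen list vec" where
  "hodge w = the (map_of hodge_table w)"

fun wedge_idx :: "gen \<Rightarrow> idx \<Rightarrow> idx vec" where
  "wedge_idx x (w, i) = map (\<lambda>(w', c). ((w', i), c)) (wedge x w)"

fun hodge_idx :: "idx \<Rightarrow> idx vec" where
  "hodge_idx (w, i) = map (\<lambda>(w', c). ((w', i), c)) (hodge w)"

fun d_idx :: "idx \<Rightarrow> idx vec" where
  "d_idx (w, i) = add_scaled (if even (length w) then Eis 1 0 else Eis (-1) 0)
     (foldr (\<lambda>x. lin (wedge_idx x)) w (map (\<lambda>((x, i'), c). (([x], i'), c)) (mon_theta i)))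
     (add_scaled (Eis (-1) 0) (wedge_idx Ga (w, i)) (add_scaled (Eis (-1) 0) (wedge_idx Gd (w, i)) []))"

fun tau_idx :: "idx \<Rightarrow> idx vec" where
  "tau_idx (w, i) = (if w = [Ga] then [(([], i), Eis (-1) (-1))] else if w = [Gd] then [(([], i), Eis 0 1)] else [])"

definition d_vec :: "idx vec \<Rightarrow> idx vec" where "d_vec = lin d_idx"
definition codiff_vec :: "idx vec \<Rightarrow> idx vec" where "codiff_vec v = lin hodge_idx (d_vec (lin hodge_idx v))"
definition maxwell_vec :: "idx vec \<Rightarrow> idx vec" where "maxwell_vec v = codiff_vec (d_vec v)"

lemma mon_theta_rec_eq: "\<forall>i\<in>set exps. is_zero (add_scaled (Eis (-1) 0) (mon_theta i) (mon_theta_rec i))"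
  by code_simp

lemma keys_mon_theta: "\<forall>i\<in>set exps. \<forall>((x, i'), c)\<in>set (mon_theta i). i' \<in> set exps"
  by code_simp

lemma keys_wedge:
  "\<forall>x\<in>set [Ga, Gb, Gc, Gd]. \<forall>w\<in>set forms. \<forall>(w', c)\<in>set (wedge x w). w' \<in> set forms \<and> length w' = Suc (length w)"
  by code_simp

lemma keys_hodge:
  "\<forall>w\<in>set forms. \<forall>(w', c)\<in>set (hodge w). w' \<in> set forms \<and> length w' = 4 - length w"
  by code_simp

subsection \<open>The exterior algebra\<close>

lemma of_eis_q_power:
  assumes "q ^ 3 = 1" "q \<noteq> 1"
  shows "of_eis q (eis_q_power m) = q ^ m"
  by (induction m) (simp_all add: of_eis_mult[OF assms])

lemma wedge_table_pairs:
  "map (\<lambda>x. map (\<lambda>y. wedge x [y]) [Ga, Gb, Gc, Gd]) [Ga, Gb, Gc, Gd] = 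
  [[ [([Gb, Gc], Eis 1 (-1))],  [([Ga, Gb], Eis 1 0)],
   [([Ga, Gc], Eis 1 0)],  [([Ga, Gd], Eis 1 0)]],
   [[([Ga, Gb], Eis 0 (-1)), ([Gb, Gd], Eis 1 2)],  [], [([Gb, Gc], Eis 1 0)],  [([Gb, Gd], Eis 1 0)]],
   [[([Ga, Gc], Eis 1 1), ([Gc, Gd], Eis (-1) 1)],  [([Gb, Gc], Eis (-1) 0)], [], [([Gc, Gd], Eis 1 0)]],
   [[([Ga, Gd], Eis (-1) 0), ([Gb, Gc], Eis (-1) 1)],  [([Gb, Gd], Eis (-1) 0)], [([Gc, Gd], Eis (-1) 0)],  []]]"
  by code_simp

lemma wedge_pairs:
  "wedge Ga [Ga] = [([Gb, Gc], Eis 1 (-1))]" "wedge Ga [Gb] = [([Ga, Gb], Eis 1 0)]"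
  "wedge Ga [Gc] = [([Ga, Gc], Eis 1 0)]" "wedge Ga [Gd] = [([Ga, Gd], Eis 1 0)]"
  "wedge Gb [Ga] = [([Ga, Gb], Eis 0 (-1)), ([Gb, Gd], Eis 1 2)]" "wedge Gb [Gb] = []"
  "wedge Gb [Gc] = [([Gb, Gc], Eis 1 0)]" "wedge Gb [Gd] = [([Gb, Gd], Eis 1 0)]"
  "wedge Gc [Ga] = [([Ga, Gc], Eis 1 1), ([Gc, Gd], Eis (-1) 1)]" "wedge Gc [Gb] = [([Gb, Gc], Eis (-1) 0)]"
  "wedge Gc [Gc] = []" "wedge Gc [Gd] = [([Gc, Gd], Eis 1 0)]"
  "wedge Gd [Ga] = [([Ga, Gd], Eis (-1) 0), ([Gb, Gc], Eis (-1) 1)]" "wedge Gd [Gb] = [([Gb, Gd], Eis (-1) 0)]"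
  "wedge Gd [Gc] = [([Gc, Gd], Eis (-1) 0)]" "wedge Gd [Gd] = []"
  using wedge_table_pairs by simp_all

text \<open>Left multiplication on the exterior algebra truncated above degree 2. As the relations are
  quadratic, they only have to be checked on the unit.\<close>

definition lambda_op :: "complex \<Rightarrow> gen \<Rightarrow> (gen list \<Rightarrow> complex) \<Rightarrow> gen list \<Rightarrow> complex" where
  "lambda_op q x f w = (if length w = 1 then (if w = [x] then f [] else 0)
     else if length w = 2 then (\<Sum>t\<leftarrow>[Ga, Gb, Gc, Gd]. of_eis q (coefficient w (wedge x [t])) * f [t]) else 0)"

lift_definition lambda_rep :: "complex \<Rightarrow> gen \<Rightarrow> gen list op" is lambda_op
  by (auto simp: lambda_op_def fun_eq_iff distrib_left mult.left_commute)

lemma lambda_rep_mult: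
  "Rep_op (lambda_rep q x * lambda_rep q y) f w =
    (if length w = 2 then of_eis q (coefficient w (wedge x [y])) * f [] else 0)"
  by (cases y) (auto simp: times_op.rep_eq lambda_rep.rep_eq lambda_op_def)

lemma lambda_rep_relations:
  assumes q: "q ^ 3 = 1" "q \<noteq> 1" and r: "r \<in> Lambda_relators q"
  shows "free_eval (lambda_rep q) r = 0"
proof -
  note e = root_of_unity_eqs[OF q]
  have "Rep_op (free_eval (lambda_rep q) r) f w = 0" for f w
    using r unfolding Lambda_relators_def Let_def
    by (elim insertE emptyE; hypsubst;
        simp add: free_eval_simps plus_op.rep_eq minus_op.rep_eq scaleC_op.rep_eq zero_op.rep_eq
          mult_scaleC_left mult_scaleC_right lambda_rep_mult wedge_pairs zero_eis_def e algebra_simps)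
  hence "Rep_op (free_eval (lambda_rep q) r) = Rep_op 0" by (simp add: fun_eq_iff zero_op.rep_eq)
  thus ?thesis by (simp only: Rep_op_inject)
qed

definition low_forms :: "gen list list" where
  "low_forms = [[], [Ga], [Gb], [Gc], [Gd], [Ga, Gb], [Ga, Gc], [Ga, Gd], [Gb, Gc], [Gb, Gd], [Gc, Gd]]"

lemma lambda_rep_form:
  assumes "w \<in> set low_forms"
  shows "Rep_op (form (lambda_rep q) w) (\<lambda>u. if u = [] then 1 else 0) w' = (if w' = w then 1 else 0)"
  using assms
  by (auto simp: low_forms_def form_def one_op.rep_eq lambda_rep_mult wedge_pairs zero_eis_def lambda_rep.rep_eq lambda_op_def)

lemma low_forms_independent:
  assumes q: "q ^ 3 = 1" "q \<noteq> 1" and e: "presented e (Lambda_relators q)"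
    and s: "(\<Sum>w\<in>set low_forms. c w *\<^sub>C form e w) = 0" and w: "w \<in> set low_forms"
  shows "c w = 0"
proof -
  have z: "(\<Sum>w\<in>set low_forms. c w *\<^sub>C form (lambda_rep q) w) = 0"
    using presented_lift_relation[OF e lambda_rep_relations[OF q], of c "\<lambda>w. w" "set low_forms"] s
    by (simp add: form_def)
  have "0 = Rep_op (\<Sum>w\<in>set low_forms. c w *\<^sub>C form (lambda_rep q) w) (\<lambda>u. if u = [] then 1 else 0) w"
    by (simp add: z zero_op.rep_eq)
  also have "\<dots> = (\<Sum>w'\<in>set low_forms. c w' * (if w = w' then 1 else 0))"
    unfolding Rep_op_sum scaleC_op.rep_eq by (intro sum.cong refl) (simp add: lambda_rep_form)
  also have "\<dots> = c w" using w by (simp add: if_distrib[of "\<lambda>x. _ * x"] cong: if_cong)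
  finally show ?thesis by simp
qed

lemma free_module_independent:
  fixes lam :: "'j \<Rightarrow> 'w::complex_algebra"
  assumes B: "finite B" "complex_vector.span B = generated e"
    and free: "\<And>\<omega>. \<exists>!x. (\<forall>\<beta>\<in>B. x \<beta> \<in> generated g) \<and> (\<forall>\<beta>. \<beta> \<notin> B \<longrightarrow> x \<beta> = 0) \<and> \<omega> = (\<Sum>\<beta>\<in>B. \<beta> * x \<beta>)"
    and J: "finite J" "\<And>j. j \<in> J \<Longrightarrow> lam j \<in> generated e"
      "\<And>c j. (\<Sum>j\<in>J. c j *\<^sub>C lam j) = 0 \<Longrightarrow> j \<in> J \<Longrightarrow> c j = 0"
    and K: "finite K" "\<And>k. k \<in> K \<Longrightarrow> m k \<in> generated g"
      "\<And>c k. (\<Sum>k\<in>K. c k *\<^sub>C m k) = 0 \<Longrightarrow> k \<in> K \<Longrightarrow> c k = 0"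
    and s: "(\<Sum>(j, k)\<in>J \<times> K. c (j, k) *\<^sub>C (lam j * m k)) = 0" and jk: "j \<in> J" "k \<in> K"
  shows "c (j, k) = 0"
proof -
  let ?P = "\<lambda>\<omega> x. (\<forall>\<beta>\<in>B. x \<beta> \<in> generated g) \<and> (\<forall>\<beta>. \<beta> \<notin> B \<longrightarrow> x \<beta> = 0) \<and> \<omega> = (\<Sum>\<beta>\<in>B. \<beta> * x \<beta>)"
  have "\<exists>r. lam j = (\<Sum>\<beta>\<in>B. r \<beta> *\<^sub>C \<beta>)" if "j \<in> J" for j
  proof -
    have "lam j \<in> range (\<lambda>r. \<Sum>\<beta>\<in>B. r \<beta> *\<^sub>C \<beta>)"
      using J(2)[OF that] unfolding B(2)[symmetric] complex_vector.span_finite[OF B(1)] .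
    thus ?thesis by auto
  qed
  then obtain r where r: "\<And>j. j \<in> J \<Longrightarrow> lam j = (\<Sum>\<beta>\<in>B. r j \<beta> *\<^sub>C \<beta>)" by metis
  define x where "x \<beta> = (if \<beta> \<in> B then \<Sum>k\<in>K. (\<Sum>j\<in>J. c (j, k) * r j \<beta>) *\<^sub>C m k else 0)" for \<beta>
  have "0 = (\<Sum>j\<in>J. \<Sum>k\<in>K. c (j, k) *\<^sub>C (lam j * m k))"
    using s by (simp add: sum.cartesian_product)
  also have "\<dots> = (\<Sum>j\<in>J. \<Sum>k\<in>K. c (j, k) *\<^sub>C ((\<Sum>\<beta>\<in>B. r j \<beta> *\<^sub>C \<beta>) * m k))"
    by (intro sum.cong refl) (simp only: r)
  also have "\<dots> = (\<Sum>j\<in>J. \<Sum>k\<in>K. \<Sum>\<beta>\<in>B. (c (j, k) * r j \<beta>) *\<^sub>C (\<beta> * m k))"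
    by (simp add: sum_distrib_right complex_vector.scale_sum_right mult_scaleC_left scaleC_scaleC)
  also have "\<dots> = (\<Sum>k\<in>K. \<Sum>\<beta>\<in>B. \<Sum>j\<in>J. (c (j, k) * r j \<beta>) *\<^sub>C (\<beta> * m k))"
    by (subst sum.swap, intro sum.cong refl, rule sum.swap)
  also have "\<dots> = (\<Sum>\<beta>\<in>B. \<Sum>k\<in>K. \<Sum>j\<in>J. (c (j, k) * r j \<beta>) *\<^sub>C (\<beta> * m k))"
    by (rule sum.swap)
  also have "\<dots> = (\<Sum>\<beta>\<in>B. \<beta> * x \<beta>)"
    by (intro sum.cong refl)
      (simp add: x_def sum_distrib_left mult_scaleC_right complex_vector.scale_sum_left)
  finally have "(\<Sum>\<beta>\<in>B. \<beta> * x \<beta>) = 0" by simp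
  moreover have "x \<beta> \<in> generated g" for \<beta>
    unfolding x_def using K(2)
    by (auto intro!: complex_vector.subspace_sum complex_vector.subspace_scale subspace_generated
        complex_vector.subspace_0)
  moreover have "\<forall>\<beta>. \<beta> \<notin> B \<longrightarrow> x \<beta> = 0" by (simp add: x_def)
  ultimately have x: "?P 0 x" by simp
  have zero: "?P 0 (\<lambda>_. 0)" by (simp add: complex_vector.subspace_0[OF subspace_generated])
  have x0: "x = (\<lambda>_. 0)"
    by (rule trans[OF the1_equality[where P = "?P 0", OF free x, symmetric] the1_equality[where P = "?P 0", OF free zero]])
  have zk: "(\<Sum>k\<in>K. (\<Sum>j\<in>J. c (j, k) * r j \<beta>) *\<^sub>C m k) = 0" if "\<beta> \<in> B" for \<beta>
    using fun_cong[OF x0, of \<beta>] that by (simp add: x_def)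
  have z: "(\<Sum>j\<in>J. c (j, k) * r j \<beta>) = 0" if "\<beta> \<in> B" for \<beta>
    by (rule K(3)[of "\<lambda>k. \<Sum>j\<in>J. c (j, k) * r j \<beta>", OF zk[OF that] jk(2)])
  have "(\<Sum>j\<in>J. c (j, k) *\<^sub>C lam j) = (\<Sum>j\<in>J. \<Sum>\<beta>\<in>B. (c (j, k) * r j \<beta>) *\<^sub>C \<beta>)"
    using r by (simp add: complex_vector.scale_sum_right scaleC_scaleC)
  also have "\<dots> = (\<Sum>\<beta>\<in>B. (\<Sum>j\<in>J. c (j, k) * r j \<beta>) *\<^sub>C \<beta>)"
    by (subst sum.swap) (simp add: complex_vector.scale_sum_left)
  also have "\<dots> = 0" by (simp add: z)
  finally show ?thesis by (rule J(3)[of "\<lambda>j. c (j, k)", OF _ jk(1)])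
qed

subsection \<open>Correctness of the coordinates\<close>

locale SL2_root3 = reduced_SL2_calculus q g e star
  for q :: complex and g e :: "gen \<Rightarrow> 'w::complex_algebra" and star :: "'w \<Rightarrow> 'w" +
  assumes root: "q ^ 3 = 1" "q \<noteq> 1"
begin

lemmas eqs = root_of_unity_eqs[OF root]

lemma A_rel: "r \<in> A_relators q \<Longrightarrow> free_eval g r = 0"
  using presented_relation[OF A_presented] .

lemma Lambda_rel: "r \<in> Lambda_relators q \<Longrightarrow> free_eval e r = 0"
  using presented_relation[OF Lambda_presented] .

lemma A_relations:
  "g Gb * g Ga = q *\<^sub>C (g Ga * g Gb)" "g Gc * g Ga = q *\<^sub>C (g Ga * g Gc)"
  "g Gc * g Gb = g Gb * g Gc" "g Ga * g Gd = (1 / q) *\<^sub>C (g Gb * g Gc) + 1"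
  "g Ga ^ 3 = 1" "g Gb ^ 3 = 0" "g Gc ^ 3 = 0"
  using A_rel[of "var Gb * var Ga - const q * var Ga * var Gb"]
    A_rel[of "var Gc * var Ga - const q * var Ga * var Gc"]
    A_rel[of "var Gc * var Gb - var Gb * var Gc"]
    A_rel[of "var Ga * var Gd - const (1 / q) * var Gb * var Gc - 1"]
    A_rel[of "var Ga ^ 3 - 1"] A_rel[of "var Gb ^ 3"] A_rel[of "var Gc ^ 3"]
  by (simp_all add: A_relators_def Let_def free_eval_simps mult_scaleC_left algebra_simps)

lemma Lambda_relations:
  "e Gc * e Gb = - (e Gb * e Gc)" "e Gd * e Gb = - (e Gb * e Gd)" "e Gd * e Gc = - (e Gc * e Gd)"
  "e Gb * e Gb = 0" "e Gc * e Gc = 0" "e Gd * e Gd = 0"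
  "e Ga * e Ga = mu q *\<^sub>C (e Gb * e Gc)"
  "e Gd * e Ga = - (e Ga * e Gd) - mu q *\<^sub>C (e Gb * e Gc)"
  "e Gc * e Ga = - (q ^ 2 *\<^sub>C (e Ga * e Gc)) - mu q *\<^sub>C (e Gc * e Gd)"
proof -
  note [simp] = Lambda_relators_def Let_def free_eval_simps mult_scaleC_left add.commute
  show "e Gc * e Gb = - (e Gb * e Gc)"
    using Lambda_rel[of "var Gb * var Gc + var Gc * var Gb"] by (simp add: eq_neg_iff_add_eq_0)
  show "e Gd * e Gb = - (e Gb * e Gd)"
    using Lambda_rel[of "var Gb * var Gd + var Gd * var Gb"] by (simp add: eq_neg_iff_add_eq_0)
  show "e Gd * e Gc = - (e Gc * e Gd)"
    using Lambda_rel[of "var Gc * var Gd + var Gd * var Gc"] by (simp add: eq_neg_iff_add_eq_0)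
  show "e Gb * e Gb = 0" using Lambda_rel[of "var Gb * var Gb"] by simp
  show "e Gc * e Gc = 0" using Lambda_rel[of "var Gc * var Gc"] by simp
  show "e Gd * e Gd = 0" using Lambda_rel[of "var Gd * var Gd"] by simp
  show "e Ga * e Ga = mu q *\<^sub>C (e Gb * e Gc)"
    using Lambda_rel[of "var Ga * var Ga - const (mu q) * var Gb * var Gc"] by simp
  have "e Ga * e Gd + e Gd * e Ga + mu q *\<^sub>C (e Gb * e Gc) = 0"
    using Lambda_rel[of "var Ga * var Gd + var Gd * var Ga + const (mu q) * var Gb * var Gc"]
    by (simp del: add.commute)
  moreover have "e Gd * e Ga = (e Ga * e Gd + e Gd * e Ga + mu q *\<^sub>C (e Gb * e Gc)) - e Ga * e Gd - mu q *\<^sub>C (e Gb * e Gc)"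
    by (simp add: algebra_simps)
  ultimately show "e Gd * e Ga = - (e Ga * e Gd) - mu q *\<^sub>C (e Gb * e Gc)" by simp
  have "e Gc * e Ga + q ^ 2 *\<^sub>C (e Ga * e Gc) + mu q *\<^sub>C (e Gc * e Gd) = 0"
    using Lambda_rel[of "var Gc * var Ga + const (q^2) * var Ga * var Gc + const (mu q) * var Gc * var Gd"]
    by (simp del: add.commute)
  moreover have "e Gc * e Ga = (e Gc * e Ga + q ^ 2 *\<^sub>C (e Ga * e Gc) + mu q *\<^sub>C (e Gc * e Gd)) -
      q ^ 2 *\<^sub>C (e Ga * e Gc) - mu q *\<^sub>C (e Gc * e Gd)"
    by (simp add: algebra_simps)
  ultimately show "e Gc * e Ga = - (q ^ 2 *\<^sub>C (e Ga * e Gc)) - mu q *\<^sub>C (e Gc * e Gd)" by simp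
qed

lemma Lambda_relation_ba: "e Gb * e Ga = - (q *\<^sub>C (e Ga * e Gb)) + (q * mu q) *\<^sub>C (e Gb * e Gd)"
proof -
  have "e Ga * e Gb + q ^ 2 *\<^sub>C (e Gb * e Ga) - mu q *\<^sub>C (e Gb * e Gd) = 0"
    using Lambda_rel[of "var Ga * var Gb + const (q^2) * var Gb * var Ga - const (mu q) * var Gb * var Gd"]
    by (simp add: Lambda_relators_def Let_def free_eval_simps mult_scaleC_left)
  hence "q *\<^sub>C (e Ga * e Gb + q ^ 2 *\<^sub>C (e Gb * e Ga) - mu q *\<^sub>C (e Gb * e Gd)) = 0" by simp
  moreover have "q * q ^ 2 = 1" using root(1) by (simp add: power3_eq_cube power2_eq_square mult.assoc)
  ultimately have "q *\<^sub>C (e Ga * e Gb) + e Gb * e Ga - (q * mu q) *\<^sub>C (e Gb * e Gd) = 0"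
    by (simp add: scaleC_add_right complex_vector.scale_right_diff_distrib scaleC_scaleC scaleC_one)
  thus ?thesis by (simp add: algebra_simps)
qed

lemma mult_a_mon: "g Ga * mon g (m, n, k) = mon g (succ3 m, n, k)"
proof -
  have "g Ga * g Ga ^ m = g Ga ^ succ3 m"
    using A_relations(5) by (auto simp: succ3_def numeral_3_eq_3 numeral_2_eq_2)
  thus ?thesis by (simp add: mon_def mult.assoc[symmetric])
qed

lemma mult_aa_mon: "g Ga * (g Ga * mon g (m, n, k)) = mon g (pred3 m, n, k)"
proof (cases m)
  case 0
  thus ?thesis by (simp add: mult_a_mon succ3_def pred3_def numeral_2_eq_2)
next
  case (Suc m')
  have "g Ga * (g Ga * g Ga ^ m) = g Ga ^ 3 * g Ga ^ m'"
    by (simp add: Suc power3_eq_cube mult.assoc power_commutes)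
  hence "g Ga * (g Ga * g Ga ^ m) = g Ga ^ pred3 m" using A_relations(5) Suc by (simp add: pred3_def)
  thus ?thesis by (simp add: mon_def mult.assoc[symmetric])
qed

lemma q_commute_power:
  assumes "y * x = q *\<^sub>C (x * (y :: 'w))"
  shows "y * x ^ m = q ^ m *\<^sub>C (x ^ m * y)"
proof (induction m)
  case (Suc m)
  have "y * x ^ Suc m = (y * x) * x ^ m" by (simp add: mult.assoc)
  also have "\<dots> = q *\<^sub>C (x * (y * x ^ m))" by (simp add: assms mult_scaleC_left mult.assoc)
  finally show ?case by (simp add: Suc mult_scaleC_right scaleC_scaleC mult.assoc)
qed (simp add: scaleC_one)

lemma mult_b_mon: "g Gb * mon g (m, n, k) = q ^ m *\<^sub>C mon g (m, Suc n, k)"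
proof -
  have "g Gb * mon g (m, n, k) = (g Gb * g Ga ^ m) * (g Gb ^ n * g Gc ^ k)"
    by (simp add: mon_def mult.assoc)
  also have "\<dots> = q ^ m *\<^sub>C (g Ga ^ m * (g Gb * (g Gb ^ n * g Gc ^ k)))"
    by (simp add: q_commute_power[OF A_relations(1)] mult_scaleC_left mult.assoc)
  finally show ?thesis by (simp add: mon_def mult.assoc)
qed

lemma mult_c_mon: "g Gc * mon g (m, n, k) = q ^ m *\<^sub>C mon g (m, n, Suc k)"
proof -
  have c: "g Gc * g Gb ^ n = g Gb ^ n * g Gc"
    by (induction n) (simp_all add: mult.assoc[symmetric] A_relations(3), simp add: mult.assoc)
  have "g Gc * mon g (m, n, k) = (g Gc * g Ga ^ m) * (g Gb ^ n * g Gc ^ k)"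
    by (simp add: mon_def mult.assoc)
  also have "\<dots> = q ^ m *\<^sub>C (g Ga ^ m * ((g Gc * g Gb ^ n) * g Gc ^ k))"
    by (simp add: q_commute_power[OF A_relations(2)] mult_scaleC_left mult.assoc)
  finally show ?thesis by (simp add: c mon_def mult.assoc)
qed

lemma mon_3: "mon g (m, 3, k) = 0" "mon g (m, n, 3) = 0"
  by (simp_all add: mon_def A_relations(6,7))

lemma d_eq: "g Gd = g Ga * (g Ga * (1 + (- 1 - q) *\<^sub>C (g Gb * g Gc)))"
proof -
  have "g Ga * (g Ga * (g Ga * g Gd)) = g Ga ^ 3 * g Gd" by (simp add: power3_eq_cube mult.assoc)
  thus ?thesis by (simp add: A_relations(4,5) eqs(4) add.commute)
qed

lemma mult_mon_sound: "g x * mon g i = vec_value q (mon g) (mult_mon x i)"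
proof -
  obtain m n k where i: "i = (m, n, k)" by (cases i)
  note qp = of_eis_q_power[OF root]
  show ?thesis
  proof (cases x)
    case Ga
    thus ?thesis by (simp add: i mult_a_mon scaleC_one)
  next
    case Gb
    thus ?thesis using mon_3 by (simp add: i mult_b_mon qp numeral_3_eq_3 numeral_2_eq_2)
  next
    case Gc
    thus ?thesis using mon_3 by (simp add: i mult_c_mon qp numeral_3_eq_3 numeral_2_eq_2)
  next
    case Gd
    have "g Gd * mon g i = g Ga * (g Ga * (mon g (m, n, k) + (- 1 - q) *\<^sub>C (g Gb * (g Gc * mon g (m, n, k)))))"
      by (simp add: d_eq i distrib_right mult_scaleC_left mult.assoc)
    also have "\<dots> = mon g (pred3 m, n, k) + ((- 1 - q) * q ^ (2 * m)) *\<^sub>C mon g (pred3 m, Suc n, Suc k)"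
      by (simp add: mult_b_mon mult_c_mon mult_aa_mon distrib_left mult_scaleC_right scaleC_scaleC mult_2 power_add
        mult.assoc)
    finally show ?thesis using Gd mon_3
      by (auto simp: i qp of_eis_mult[OF root] scaleC_one numeral_3_eq_3 numeral_2_eq_2)
  qed
qed

definition form1 :: "gen \<times> nat \<times> nat \<times> nat \<Rightarrow> 'w" where
  "form1 = (\<lambda>(w, i). e w * mon g i)"

definition bas :: "idx \<Rightarrow> 'w" where
  "bas = (\<lambda>(w, i). form e w * mon g i)"

lemma cross_sound: "g x * e w = (\<Sum>(c, w', y)\<leftarrow>cross x w. of_eis q c *\<^sub>C (e w' * g y))"
proof -
  note ac = cross_relations[of "g Ga" "g Gc", simplified]
  note bd = cross_relations[of "g Gb" "g Gd", simplified]
  show ?thesis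
    by (cases x; cases w)
      (simp_all add: ac bd eqs power2_eq_square scaleC_expand algebra_simps)
qed

lemma vec_value_scaled_map:
  "vec_value q b (map (\<lambda>(i, c'). (f i, c * c')) v) = of_eis q c *\<^sub>C vec_value q (\<lambda>i. b (f i)) v"
  by (induction v) (auto simp: of_eis_mult[OF root] scaleC_scaleC scaleC_add_right)

lemma mult_1form_sound: "g x * form1 p = vec_value q form1 (mult_1form x p)"
proof -
  obtain w i where p: "p = (w, i)" by (cases p)
  have "g x * form1 p = (\<Sum>(c, w', y)\<leftarrow>cross x w. of_eis q c *\<^sub>C (e w' * (g y * mon g i)))"
  proof -
    have "(\<Sum>(c, w', y)\<leftarrow>xs. of_eis q c *\<^sub>C (e w' * g y)) * z = (\<Sum>(c, w', y)\<leftarrow>xs. of_eis q c *\<^sub>C (e w' * (g y * z)))"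
      for xs z
      by (induction xs) (auto simp: distrib_right mult_scaleC_left mult.assoc)
    thus ?thesis by (simp add: p form1_def mult.assoc[symmetric] cross_sound)
  qed
  also have "\<dots> = (\<Sum>(c, w', y)\<leftarrow>cross x w. of_eis q c *\<^sub>C vec_value q (\<lambda>i. form1 (w', i)) (mult_mon y i))"
  proof -
    have "e w' * vec_value q (mon g) v = vec_value q (\<lambda>i. form1 (w', i)) v" for w' v
      by (induction v) (auto simp: form1_def distrib_left mult_scaleC_right)
    thus ?thesis by (simp add: mult_mon_sound)
  qed
  also have "\<dots> = vec_value q form1 (mult_1form x p)"
  proof -
    have "vec_value q form1 (concat (map (\<lambda>(c, w', y). map (\<lambda>(i', c'). ((w', i'), c * c')) (mult_mon y i)) xs)) =
      (\<Sum>(c, w', y)\<leftarrow>xs. of_eis q c *\<^sub>C vec_value q (\<lambda>i. form1 (w', i)) (mult_mon y i))" for xs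
      by (induction xs) (auto simp: vec_value_append vec_value_scaled_map)
    thus ?thesis by (simp add: p)
  qed
  finally show ?thesis .
qed

lemma linC_mult_left: "linC (\<lambda>\<omega>. x * \<omega> :: 'w)"
  by (simp add: linC_def distrib_left mult_scaleC_right)

lemma mult_1form_vec: "g x * vec_value q form1 v = vec_value q form1 (lin (mult_1form x) v)"
  using vec_value_lin[OF root linC_mult_left, of v "g x" form1 form1 "mult_1form x"] mult_1form_sound by simp

lemma mon_theta_rec_sound: "mon g i * theta e = vec_value q form1 (mon_theta_rec i)"
proof -
  obtain m n k where i: "i = (m, n, k)" by (cases i)
  have pow: "g x ^ m * vec_value q form1 v = vec_value q form1 ((lin (mult_1form x) ^^ m) v)" for x m v
    by (induction m) (simp_all add: mult.assoc mult_1form_vec)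
  have "theta e = vec_value q form1 [((Ga, 0, 0, 0), Eis 1 0), ((Gd, 0, 0, 0), Eis 1 0)]"
    by (simp add: theta_def form1_def mon_def scaleC_one)
  thus ?thesis by (simp add: i mon_def mult.assoc pow del: vec_value_simps)
qed

lemma mon_theta_sound:
  assumes "i \<in> set exps"
  shows "mon g i * theta e = vec_value q form1 (mon_theta i)"
proof -
  have "vec_value q form1 (add_scaled (Eis (-1) 0) (mon_theta i) (mon_theta_rec i)) = 0"
    using mon_theta_rec_eq assms by (intro vec_value_is_zero) blast
  thus ?thesis
    by (simp add: vec_value_add_scaled[OF root] mon_theta_rec_sound complex_vector.scale_minus_left scaleC_one)
qed

lemma wedge_sound:
  assumes "w \<in> set forms"
  shows "e x * form e w = vec_value q (form e) (wedge x w)"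
proof -
  have assoc: "e x * (e y * z) = (e x * e y) * z" for x y z by (simp add: mult.assoc)
  note R = Lambda_relations Lambda_relation_ba
  have R': "e Gc * (e Gb * z) = - (e Gb * (e Gc * z))" "e Gd * (e Gb * z) = - (e Gb * (e Gd * z))"
    "e Gd * (e Gc * z) = - (e Gc * (e Gd * z))" "e Gb * (e Gb * z) = 0" "e Gc * (e Gc * z) = 0" "e Gd * (e Gd * z) = 0"
    "e Ga * (e Ga * z) = mu q *\<^sub>C (e Gb * (e Gc * z))"
    "e Gd * (e Ga * z) = - (e Ga * (e Gd * z)) - mu q *\<^sub>C (e Gb * (e Gc * z))"
    "e Gc * (e Ga * z) = - (q ^ 2 *\<^sub>C (e Ga * (e Gc * z))) - mu q *\<^sub>C (e Gc * (e Gd * z))"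
    "e Gb * (e Ga * z) = - (q *\<^sub>C (e Ga * (e Gb * z))) + (q * mu q) *\<^sub>C (e Gb * (e Gd * z))" for z
    unfolding assoc R by (simp_all add: distrib_right left_diff_distrib mult_scaleC_left)
  show ?thesis
    using assms unfolding forms_def
    by (cases x; simp; elim disjE; hypsubst;
      simp add: form_def wedge_def wedge_table_def forms_def R R' eqs scaleC_expand algebra_simps)
qed

lemma linC_star: "linC star"
proof -
  have "star (c *\<^sub>C \<omega>) = c *\<^sub>C star \<omega>" for c \<omega>
  proof -
    have "c *\<^sub>C 1 \<in> generated g"
      using complex_vector.subspace_scale[OF subspace_generated word_in_generated[of g "[]"]] by simp
    hence "star (\<omega> * (c *\<^sub>C 1)) = star \<omega> * (c *\<^sub>C 1)" by (rule star_right_linear)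
    thus ?thesis by (simp add: mult_scaleC_right)
  qed
  thus ?thesis by (simp add: linC_def star_add)
qed

lemma hodge_sound:
  assumes "w \<in> set forms"
  shows "star (form e w) = vec_value q (form e) (hodge w)"
proof -
  have h: "1 / (1 + q\<^sup>2) = 1 + q" "q\<^sup>2 / (1 + q\<^sup>2) = - q" "1 / q\<^sup>2 = q"
  proof -
    show "1 / (1 + q\<^sup>2) = 1 + q" "q\<^sup>2 / (1 + q\<^sup>2) = - q"
      using eqs(2,5) by (simp_all add: eqs(1) field_simps)
    show "1 / q\<^sup>2 = q" using eqs(6) by (simp add: mu_def)
  qed
  note s = star_0 star_4 star_a star_b star_c star_d star_ab star_ac star_ad star_bc star_bd star_cd
    star_abc star_abd star_acd star_bcd
  show ?thesis
    using assms unfolding forms_def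
    by (simp; elim disjE; hypsubst;
      simp add: form_def hodge_def hodge_table_def s[unfolded mult.assoc h] eqs scaleC_expand algebra_simps)
qed

end

definition idx_set :: "nat \<Rightarrow> idx set" where
  "idx_set n = {(w, i). w \<in> set forms \<and> length w = n \<and> i \<in> set exps}"

lemma keys_wedge_forms:
  assumes "w \<in> set forms"
  shows "fst ` set (wedge x w) \<subseteq> {w' \<in> set forms. length w' = Suc (length w)}"
  using keys_wedge assms by (cases x) (fastforce simp: split_beta)+

lemma keys_wedge_idx: "k \<in> idx_set n \<Longrightarrow> fst ` set (wedge_idx x k) \<subseteq> idx_set (Suc n)"
  using keys_wedge_forms[of "fst k" x] by (cases k) (fastforce simp: idx_set_def)

lemma keys_hodge_idx: "k \<in> idx_set n \<Longrightarrow> fst ` set (hodge_idx k) \<subseteq> idx_set (4 - n)"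
  using keys_hodge by (cases k) (fastforce simp: idx_set_def split_beta)

lemma keys_mult_mon:
  "\<forall>x\<in>set [Ga, Gb, Gc, Gd]. \<forall>i\<in>set exps. \<forall>(i', c)\<in>set (mult_mon x i). i' \<in> set exps"
  by code_simp

lemma idx_set_low: "n \<le> 2 \<Longrightarrow> idx_set n \<subseteq> set low_forms \<times> set exps"
proof -
  have "\<forall>w\<in>set forms. length w \<le> 2 \<longrightarrow> w \<in> set low_forms" by code_simp
  thus "n \<le> 2 \<Longrightarrow> idx_set n \<subseteq> set low_forms \<times> set exps" by (auto simp: idx_set_def)
qed

definition theta_vec :: "nat \<times> nat \<times> nat \<Rightarrow> idx vec" where
  "theta_vec i = map (\<lambda>((x, i'), c). (([x], i'), c)) (mon_theta i)"

lemma keys_theta_vec: "i \<in> set exps \<Longrightarrow> fst ` set (theta_vec i) \<subseteq> idx_set 1"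
proof -
  have "[x] \<in> set forms" for x by (cases x) (auto simp: forms_def)
  thus "i \<in> set exps \<Longrightarrow> fst ` set (theta_vec i) \<subseteq> idx_set 1"
    using keys_mon_theta by (fastforce simp: theta_vec_def idx_set_def split_beta)
qed

lemma keys_foldr_wedge:
  "fst ` set v \<subseteq> idx_set n \<Longrightarrow> fst ` set (foldr (\<lambda>x. lin (wedge_idx x)) w v) \<subseteq> idx_set (n + length w)"
proof (induction w)
  case (Cons x w)
  have "fst ` set (lin (wedge_idx x) (foldr (\<lambda>x. lin (wedge_idx x)) w v)) \<subseteq> idx_set (Suc (n + length w))"
  proof (rule keys_lin)
    fix k assume "k \<in> fst ` set (foldr (\<lambda>x. lin (wedge_idx x)) w v)"
    hence "k \<in> idx_set (n + length w)" using Cons by blast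
    thus "fst ` set (wedge_idx x k) \<subseteq> idx_set (Suc (n + length w))" by (rule keys_wedge_idx)
  qed
  thus ?case by simp
qed simp

lemma keys_d_idx: "k \<in> idx_set n \<Longrightarrow> fst ` set (d_idx k) \<subseteq> idx_set (Suc n)"
proof -
  assume k: "k \<in> idx_set n"
  obtain w i where wi: "k = (w, i)" by (cases k)
  have "fst ` set (foldr (\<lambda>x. lin (wedge_idx x)) w (theta_vec i)) \<subseteq> idx_set (Suc n)"
    using keys_foldr_wedge[OF keys_theta_vec, of i w] k wi by (auto simp: idx_set_def)
  thus ?thesis
    using keys_wedge_idx[OF k, of Ga] keys_wedge_idx[OF k, of Gd]
    by (simp add: wi keys_add_scaled theta_vec_def del: wedge_idx.simps)
qed

lemma keys_d_vec:
  assumes "fst ` set v \<subseteq> idx_set n"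
  shows "fst ` set (d_vec v) \<subseteq> idx_set (Suc n)"
  unfolding d_vec_def by (rule keys_lin[OF keys_d_idx[OF subsetD[OF assms]]])

lemma keys_hodge_vec:
  assumes "fst ` set v \<subseteq> idx_set n"
  shows "fst ` set (lin hodge_idx v) \<subseteq> idx_set (4 - n)"
  by (rule keys_lin[OF keys_hodge_idx[OF subsetD[OF assms]]])

lemma keys_codiff_vec: "fst ` set v \<subseteq> idx_set n \<Longrightarrow> fst ` set (codiff_vec v) \<subseteq> idx_set (4 - Suc (4 - n))"
  unfolding codiff_vec_def by (intro keys_hodge_vec keys_d_vec)

lemma keys_tau_vec: "fst ` set v \<subseteq> idx_set n \<Longrightarrow> fst ` set (lin tau_idx v) \<subseteq> idx_set 0"
proof (rule keys_lin)
  fix k assume "fst ` set v \<subseteq> idx_set n" "k \<in> fst ` set v"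
  hence "k \<in> idx_set n" by blast
  thus "fst ` set (tau_idx k) \<subseteq> idx_set 0" by (cases k) (auto simp: idx_set_def forms_def)
qed

lemma functionals_exist:
  assumes "finite I" "\<And>c i. (\<Sum>i\<in>I. c i *\<^sub>C (b i :: 'w::complex_algebra)) = 0 \<Longrightarrow> i \<in> I \<Longrightarrow> c i = 0"
  shows "inj_on b I" and "complex_vector.independent (b ` I)"
    and "\<exists>phi. (\<forall>k. functional (phi k)) \<and> (\<forall>k\<in>I. \<forall>k'\<in>I. phi k (b k') = (if k = k' then 1 else 0))"
proof -
  show inj: "inj_on b I"
  proof (rule inj_onI, rule ccontr)
    fix i j assume ij: "i \<in> I" "j \<in> I" "b i = b j" "i \<noteq> j"
    let ?c = "\<lambda>k. (if k = i then 1 else 0) - (if k = j then 1 else 0) :: complex"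
    have "(\<Sum>k\<in>I. ?c k *\<^sub>C b k) = (\<Sum>k\<in>I. (if k = i then b k else 0) - (if k = j then b k else 0))"
      by (intro sum.cong refl) (simp add: complex_vector.scale_left_diff_distrib scaleC_one complex_vector.scale_minus_left)
    also have "\<dots> = 0" using ij assms(1) by (simp add: sum_subtractf)
    finally have "?c i = 0" by (rule assms(2)[of ?c, OF _ ij(1)])
    thus False using ij(4) by simp
  qed
  show ind: "complex_vector.independent (b ` I)"
  proof (rule complex_vector.independent_if_scalars_zero)
    fix f x assume s: "(\<Sum>x\<in>b ` I. f x *\<^sub>C x) = 0" and "x \<in> b ` I"
    then obtain i where i: "i \<in> I" "x = b i" by blast
    have "(\<Sum>i\<in>I. f (b i) *\<^sub>C b i) = 0" using s by (simp add: sum.reindex[OF inj])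
    thus "f x = 0" using assms(2)[of "\<lambda>i. f (b i)"] i by blast
  qed (simp add: assms(1))
  interpret vector_space_pair "scaleC :: complex \<Rightarrow> 'w \<Rightarrow> 'w" "(*) :: complex \<Rightarrow> complex \<Rightarrow> complex"
    by unfold_locales (simp_all add: algebra_simps)
  have "\<exists>f. functional f \<and> (\<forall>k'\<in>I. f (b k') = (if k = k' then 1 else 0))" for k
  proof -
    obtain f where f: "Vector_Spaces.linear scaleC (*) f" "\<forall>x\<in>b ` I. f x = (if inv_into I b x = k then 1 else 0)"
      using linear_independent_extend[OF ind, of "\<lambda>x. if inv_into I b x = k then 1 else 0"] by blast
    interpret f: Vector_Spaces.linear scaleC "(*)" f by (rule f(1))
    have "functional f" by (simp add: functional_def f.add f.scale)
    thus ?thesis using f(2) inj by auto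
  qed
  hence "\<forall>k. \<exists>f. functional f \<and> (\<forall>k'\<in>I. f (b k') = (if k = k' then 1 else 0))" by blast
  thus "\<exists>phi. (\<forall>k. functional (phi k)) \<and> (\<forall>k\<in>I. \<forall>k'\<in>I. phi k (b k') = (if k = k' then 1 else 0))"
    by (metis (no_types, lifting))
qed

lemma linC_extension:
  assumes "complex_vector.independent (b ` I)" "inj_on b I"
  shows "\<exists>F :: 'w::complex_algebra \<Rightarrow> 'w. linC F \<and> (\<forall>i\<in>I. F (b i) = f i)"
proof -
  interpret vector_space_pair "scaleC :: complex \<Rightarrow> 'w \<Rightarrow> 'w" "scaleC :: complex \<Rightarrow> 'w \<Rightarrow> 'w"
    by unfold_locales
  obtain F where F: "Vector_Spaces.linear scaleC scaleC F" "\<forall>x\<in>b ` I. F x = f (inv_into I b x)"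
    using linear_independent_extend[OF assms(1), of "\<lambda>x. f (inv_into I b x)"] by blast
  interpret F: Vector_Spaces.linear scaleC scaleC F by (rule F(1))
  have "linC F" by (simp add: linC_def F.add F.scale)
  thus ?thesis using F(2) assms(2) by auto
qed

context SL2_root3
begin

lemma generated_g_span: "generated g = complex_vector.span (mon g ` set exps)"
proof
  have keys: "fst ` set (mult_mon x i) \<subseteq> set exps" if "i \<in> set exps" for x i
    using keys_mult_mon that by (cases x) (fastforce simp: split_beta)+
  have "prod_list (map g w) \<in> complex_vector.span (mon g ` set exps)" for w
  proof (induction w)
    case Nil
    have "1 = mon g (0, 0, 0)" "(0, 0, 0) \<in> set exps" by (simp_all add: mon_def exps_iff)
    thus ?case by (metis complex_vector.span_base image_eqI list.simps(8) prod_list.Nil)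
  next
    case (Cons x w)
    have "g x * prod_list (map g w) \<in> complex_vector.span (mon g ` set exps)"
    proof (rule linC_maps_span[OF linC_mult_left Cons])
      fix v assume "v \<in> mon g ` set exps"
      thus "g x * v \<in> complex_vector.span (mon g ` set exps)"
        using vec_value_in_span[OF keys] by (auto simp: mult_mon_sound)
    qed
    thus ?case by simp
  qed
  thus "generated g \<subseteq> complex_vector.span (mon g ` set exps)"
    unfolding generated_eq_span by (intro complex_vector.span_minimal) auto
  show "complex_vector.span (mon g ` set exps) \<subseteq> generated g"
    by (intro complex_vector.span_minimal subspace_generated) (auto simp: mon_eq_word word_in_generated)
qed

lemma mon_in_generated: "mon g i \<in> generated g"
  by (simp add: mon_eq_word word_in_generated)

lemma bas_relation_zero:
  assumes "(\<Sum>k\<in>set low_forms \<times> set exps. c k *\<^sub>C bas k) = 0" "k \<in> set low_forms \<times> set exps"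
  shows "c k = 0"
proof -
  obtain w i where k: "k = (w, i)" by (cases k)
  obtain B where B: "finite B" "complex_vector.span B = generated e"
    and free: "\<And>\<omega>. \<exists>!x. (\<forall>\<beta>\<in>B. x \<beta> \<in> generated g) \<and> (\<forall>\<beta>. \<beta> \<notin> B \<longrightarrow> x \<beta> = 0) \<and> \<omega> = (\<Sum>\<beta>\<in>B. \<beta> * x \<beta>)"
    using free_right_module by auto
  show ?thesis unfolding k
  proof (rule free_module_independent[OF B free, where lam = "form e" and m = "mon g" and J = "set low_forms" and K = "set exps"])
    show "(\<Sum>(j, k)\<in>set low_forms \<times> set exps. c (j, k) *\<^sub>C (form e j * mon g k)) = 0"
      using assms(1) by (simp add: bas_def split_beta)
  qed (use assms(2) k low_forms_independent[OF root Lambda_presented] A_monomials_independent[OF root A_presented]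
      in \<open>auto simp: mon_in_generated form_def word_in_generated\<close>)
qed

lemma bas_basis:
  shows "inj_on bas (set low_forms \<times> set exps)"
    and "complex_vector.independent (bas ` (set low_forms \<times> set exps))"
    and "\<exists>phi. (\<forall>k. functional (phi k)) \<and>
      (\<forall>k\<in>set low_forms \<times> set exps. \<forall>k'\<in>set low_forms \<times> set exps. phi k (bas k') = (if k = k' then 1 else 0))"
proof -
  have fin: "finite (set low_forms \<times> set exps)" by simp
  have rel: "c k = 0" if "(\<Sum>k\<in>set low_forms \<times> set exps. c k *\<^sub>C bas k) = 0" "k \<in> set low_forms \<times> set exps" for c k
    by (rule bas_relation_zero[of c, OF that])
  show "inj_on bas (set low_forms \<times> set exps)"
    by (rule functionals_exist(1)[OF fin]) (rule rel)
  show "complex_vector.independent (bas ` (set low_forms \<times> set exps))"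
    by (rule functionals_exist(2)[OF fin]) (rule rel)
  show "\<exists>phi. (\<forall>k. functional (phi k)) \<and>
      (\<forall>k\<in>set low_forms \<times> set exps. \<forall>k'\<in>set low_forms \<times> set exps. phi k (bas k') = (if k = k' then 1 else 0))"
    by (rule functionals_exist(3)[OF fin]) (rule rel)
qed

lemma finite_spanning: "\<exists>C. finite C \<and> complex_vector.span C = (UNIV :: 'w set)"
proof -
  obtain B where B: "finite B"
    and free: "\<And>\<omega>. \<exists>!x. (\<forall>\<beta>\<in>B. x \<beta> \<in> generated g) \<and> (\<forall>\<beta>. \<beta> \<notin> B \<longrightarrow> x \<beta> = 0) \<and> \<omega> = (\<Sum>\<beta>\<in>B. \<beta> * x \<beta>)"
    using free_right_module by auto
  define C where "C = (\<lambda>(\<beta>, i). \<beta> * mon g i) ` (B \<times> set exps)"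
  have "\<beta> * x \<in> complex_vector.span C" if "\<beta> \<in> B" "x \<in> generated g" for \<beta> x
  proof (rule linC_maps_span[OF linC_mult_left])
    show "x \<in> complex_vector.span (mon g ` set exps)" using that(2) generated_g_span by simp
    show "\<beta> * v \<in> complex_vector.span C" if "v \<in> mon g ` set exps" for v
      using that \<open>\<beta> \<in> B\<close> by (auto simp: C_def intro!: complex_vector.span_base)
  qed
  hence "\<omega> \<in> complex_vector.span C" for \<omega>
    using ex1_implies_ex[OF free[of \<omega>]] by (auto intro!: complex_vector.span_sum)
  moreover have "finite C" using B by (simp add: C_def)
  ultimately show ?thesis by blast
qed

lemma linC_ext_d: "linC (ext_d e n)"
proof (cases "even n")
  case True
  hence "ext_d e n = (\<lambda>\<omega>. \<omega> * theta e - theta e * \<omega>)" by (simp add: ext_d_def fun_eq_iff)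
  thus ?thesis
    by (simp add: linC_def distrib_left distrib_right mult_scaleC_left mult_scaleC_right
        complex_vector.scale_right_diff_distrib)
next
  case False
  hence "ext_d e n = (\<lambda>\<omega>. - (theta e * \<omega>) - \<omega> * theta e)" by (simp add: ext_d_def fun_eq_iff)
  thus ?thesis
    by (simp add: linC_def distrib_left distrib_right mult_scaleC_left mult_scaleC_right
        complex_vector.scale_right_diff_distrib complex_vector.scale_minus_right)
qed

lemma linC_codiff: "linC (codiff e star n)"
  using linC_star linC_ext_d[of "4 - n"] by (simp add: codiff_def linC_def)

lemma linC_maxwell: "linC (Maxwell e star)"
  using linC_codiff[of 2] linC_ext_d[of 1] by (simp add: Maxwell_def linC_def)

abbreviation val :: "idx vec \<Rightarrow> 'w" where "val \<equiv> vec_value q bas"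

lemma val_slice: "val (map (\<lambda>(w', c). ((w', i), c)) v) = vec_value q (form e) v * mon g i"
  by (induction v) (auto simp: bas_def distrib_right mult_scaleC_left)

lemma bas_Pair: "bas (w, i) = form e w * mon g i"
  by (simp add: bas_def)

lemma wedge_idx_sound: "k \<in> idx_set n \<Longrightarrow> e x * bas k = val (wedge_idx x k)"
  by (cases k) (auto simp: idx_set_def val_slice wedge_sound[symmetric] bas_Pair mult.assoc)

lemma wedge_vec_sound:
  assumes "fst ` set v \<subseteq> idx_set n"
  shows "e x * val v = val (lin (wedge_idx x) v)"
  by (rule vec_value_lin[OF root linC_mult_left wedge_idx_sound[OF subsetD[OF assms]], symmetric])

lemma foldr_wedge_sound:
  "fst ` set v \<subseteq> idx_set n \<Longrightarrow> form e w * val v = val (foldr (\<lambda>x. lin (wedge_idx x)) w v)"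
proof (induction w)
  case (Cons x w)
  have "form e (x # w) * val v = e x * val (foldr (\<lambda>x. lin (wedge_idx x)) w v)"
    using Cons by (simp add: form_def mult.assoc)
  thus ?case using wedge_vec_sound[OF keys_foldr_wedge[OF Cons.prems]] by simp
qed (simp add: form_def)

lemma theta_vec_sound: "i \<in> set exps \<Longrightarrow> mon g i * theta e = val (theta_vec i)"
proof -
  have "val (map (\<lambda>((x, i'), c). (([x], i'), c)) v) = vec_value q form1 v" for v
    by (induction v) (auto simp: bas_def form1_def form_def)
  thus "i \<in> set exps \<Longrightarrow> mon g i * theta e = val (theta_vec i)"
    by (simp add: mon_theta_sound theta_vec_def)
qed

lemma d_idx_sound:
  assumes "k \<in> idx_set n"
  shows "ext_d e n (bas k) = val (d_idx k)"
proof -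
  obtain w i where k: "k = (w, i)" "w \<in> set forms" "length w = n" "i \<in> set exps"
    using assms by (auto simp: idx_set_def)
  have "bas k * theta e = val (foldr (\<lambda>x. lin (wedge_idx x)) w (theta_vec i))"
    using k by (simp add: bas_Pair mult.assoc theta_vec_sound foldr_wedge_sound[OF keys_theta_vec])
  moreover have "theta e * bas k = val (wedge_idx Ga k) + val (wedge_idx Gd k)"
    using wedge_idx_sound[OF assms] by (simp add: theta_def distrib_right)
  ultimately show ?thesis
    by (cases "even n") (simp_all add: k(1,3) ext_d_def vec_value_add_scaled[OF root] theta_vec_def scaleC_one
      complex_vector.scale_minus_left del: wedge_idx.simps)
qed

lemma d_vec_sound:
  assumes "fst ` set v \<subseteq> idx_set n"
  shows "ext_d e n (val v) = val (d_vec v)"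
  unfolding d_vec_def by (rule vec_value_lin[OF root linC_ext_d d_idx_sound[OF subsetD[OF assms]], symmetric])

lemma hodge_idx_sound: "k \<in> idx_set n \<Longrightarrow> star (bas k) = val (hodge_idx k)"
  by (cases k) (auto simp: idx_set_def val_slice hodge_sound[symmetric] bas_Pair star_right_linear[OF mon_in_generated])

lemma hodge_vec_sound:
  assumes "fst ` set v \<subseteq> idx_set n"
  shows "star (val v) = val (lin hodge_idx v)"
  by (rule vec_value_lin[OF root linC_star hodge_idx_sound[OF subsetD[OF assms]], symmetric])

lemma codiff_vec_sound: "fst ` set v \<subseteq> idx_set n \<Longrightarrow> codiff e star n (val v) = val (codiff_vec v)"
  unfolding codiff_def codiff_vec_def
  by (simp add: hodge_vec_sound d_vec_sound[OF keys_hodge_vec] hodge_vec_sound[OF keys_d_vec[OF keys_hodge_vec]])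

lemma maxwell_vec_sound:
  assumes "fst ` set v \<subseteq> idx_set 1"
  shows "Maxwell e star (val v) = val (maxwell_vec v)" "fst ` set (maxwell_vec v) \<subseteq> idx_set 1"
proof -
  have d: "fst ` set (d_vec v) \<subseteq> idx_set 2" using keys_d_vec[OF assms] by (simp add: numeral_2_eq_2)
  show "Maxwell e star (val v) = val (maxwell_vec v)"
    by (simp add: Maxwell_def maxwell_vec_def d_vec_sound[OF assms] codiff_vec_sound[OF d] del: One_nat_def)
  show "fst ` set (maxwell_vec v) \<subseteq> idx_set 1"
    using keys_codiff_vec[OF d] by (simp add: maxwell_vec_def numeral_2_eq_2 numeral_eq_Suc)
qed

lemma Omega_span:
  assumes "n \<le> 1"
  shows "Omega g e n = complex_vector.span (bas ` idx_set n)"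
proof
  have forms: "w \<in> set forms" if "length w = n" for w
  proof (cases w)
    case (Cons x u)
    thus ?thesis using that assms by (cases x) (auto simp: forms_def)
  qed (simp add: forms_def)
  show "Omega g e n \<subseteq> complex_vector.span (bas ` idx_set n)"
    unfolding Omega_def
  proof (intro complex_vector.span_minimal complex_vector.subspace_span subsetI)
    fix \<omega> assume "\<omega> \<in> {prod_list (map e w) * x | w x. length w = n \<and> x \<in> generated g}"
    then obtain w x where wx: "\<omega> = form e w * x" "length w = n" "x \<in> complex_vector.span (mon g ` set exps)"
      by (auto simp: form_def generated_g_span)
    show "\<omega> \<in> complex_vector.span (bas ` idx_set n)" unfolding wx(1)
    proof (rule linC_maps_span[OF linC_mult_left wx(3)])
      fix v assume "v \<in> mon g ` set exps"
      then obtain i where "i \<in> set exps" "form e w * v = bas (w, i)" by (auto simp: bas_def)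
      moreover from this have "(w, i) \<in> idx_set n" using forms wx(2) by (simp add: idx_set_def)
      ultimately show "form e w * v \<in> complex_vector.span (bas ` idx_set n)"
        by (metis complex_vector.span_base imageI)
    qed
  qed
  show "complex_vector.span (bas ` idx_set n) \<subseteq> Omega g e n"
    unfolding Omega_def
  proof (intro complex_vector.span_mono subsetI)
    fix \<omega> assume "\<omega> \<in> bas ` idx_set n"
    then obtain w i where "\<omega> = prod_list (map e w) * mon g i" "length w = n"
      by (auto simp: idx_set_def bas_Pair form_def)
    thus "\<omega> \<in> {prod_list (map e w) * x | w x. length w = n \<and> x \<in> generated g}"
      using mon_in_generated by blast
  qed
qed

lemma one_form_decomposition:
  assumes "A \<in> Omega g e 1"
  obtains ya yb yc yd where "ya \<in> generated g" "yb \<in> generated g" "yc \<in> generated g" "yd \<in> generated g"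
    "A = e Ga * ya + e Gb * yb + e Gc * yc + e Gd * yd"
proof -
  note gen = complex_vector.subspace_add[OF subspace_generated] complex_vector.subspace_scale[OF subspace_generated]
    complex_vector.subspace_0[OF subspace_generated]
  let ?S = "{A. \<exists>y. (\<forall>x. y x \<in> generated g) \<and> A = e Ga * y Ga + e Gb * y Gb + e Gc * y Gc + e Gd * y Gd}"
  have "complex_vector.subspace ?S"
  proof (rule complex_vector.subspaceI)
    show "0 \<in> ?S" by (auto intro!: exI[of _ "\<lambda>_. 0"] gen)
  next
    fix A A' assume "A \<in> ?S" "A' \<in> ?S"
    then obtain y y' where "\<forall>x. y x \<in> generated g" "A = e Ga * y Ga + e Gb * y Gb + e Gc * y Gc + e Gd * y Gd"
      "\<forall>x. y' x \<in> generated g" "A' = e Ga * y' Ga + e Gb * y' Gb + e Gc * y' Gc + e Gd * y' Gd" by auto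
    thus "A + A' \<in> ?S" by (auto intro!: exI[of _ "\<lambda>x. y x + y' x"] gen simp: algebra_simps)
  next
    fix c A assume "A \<in> ?S"
    then obtain y where "\<forall>x. y x \<in> generated g" "A = e Ga * y Ga + e Gb * y Gb + e Gc * y Gc + e Gd * y Gd" by auto
    thus "c *\<^sub>C A \<in> ?S" by (auto intro!: exI[of _ "\<lambda>x. c *\<^sub>C y x"] gen simp: scaleC_add_right mult_scaleC_right)
  qed
  moreover have "bas ` idx_set 1 \<subseteq> ?S"
  proof safe
    fix w i assume "(w, i) \<in> idx_set 1"
    then obtain x where x: "w = [x]" by (auto simp: idx_set_def length_Suc_conv)
    have "bas (w, i) = e x * mon g i" by (simp add: x bas_def form_def)
    thus "\<exists>y. (\<forall>x. y x \<in> generated g) \<and> bas (w, i) = e Ga * y Ga + e Gb * y Gb + e Gc * y Gc + e Gd * y Gd"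
      by (intro exI[of _ "\<lambda>z. if z = x then mon g i else 0"]) (cases x; simp add: mon_in_generated gen)
  qed
  ultimately have "A \<in> ?S" using assms Omega_span[of 1] complex_vector.span_minimal by blast
  thus thesis using that by blast
qed

lemma tau_exists:
  obtains tau where "linC tau" "\<And>v. fst ` set v \<subseteq> idx_set 1 \<Longrightarrow> tau (val v) = val (lin tau_idx v)"
    "\<And>A. A \<in> Omega g e 1 \<Longrightarrow> A \<in> temporal_gauge q g e \<longleftrightarrow> tau A = 0"
proof -
  obtain tau where tau: "linC tau" "\<And>k. k \<in> set low_forms \<times> set exps \<Longrightarrow> tau (bas k) = val (tau_idx k)"
    using linC_extension[OF bas_basis(2,1), of "\<lambda>k. val (tau_idx k)"] by blast
  have tau1: "tau (bas k) = val (tau_idx k)" if "k \<in> idx_set 1" for k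
    using tau(2) that idx_set_low[of 1] by auto
  have "tau (val v) = val (lin tau_idx v)" if "fst ` set v \<subseteq> idx_set 1" for v
  proof -
    have "tau (bas k) = val (tau_idx k)" if "k \<in> fst ` set v" for k
      using that \<open>fst ` set v \<subseteq> idx_set 1\<close> by (intro tau1) blast
    thus ?thesis using vec_value_lin[OF root tau(1), of v bas bas tau_idx] by simp
  qed
  moreover have tau_e: "tau (e x * y) = (case x of Ga \<Rightarrow> q ^ 2 | Gd \<Rightarrow> q | _ \<Rightarrow> 0) *\<^sub>C y" if "y \<in> generated g" for x y
  proof -
    have "linC (\<lambda>y. tau (e x * y) - (case x of Ga \<Rightarrow> q ^ 2 | Gd \<Rightarrow> q | _ \<Rightarrow> 0) *\<^sub>C y)"
      using tau(1) by (simp add: linC_def distrib_left mult_scaleC_right scaleC_add_right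
        complex_vector.scale_right_diff_distrib scaleC_scaleC mult.commute)
    moreover have "y \<in> complex_vector.span (mon g ` set exps)" using that generated_g_span by simp
    moreover have "tau (e x * v) - (case x of Ga \<Rightarrow> q ^ 2 | Gd \<Rightarrow> q | _ \<Rightarrow> 0) *\<^sub>C v = 0"
      if v: "v \<in> mon g ` set exps" for v
    proof -
      obtain i where i: "i \<in> set exps" "v = mon g i" using v by blast
      have "([x], i) \<in> idx_set 1" using i(1) by (cases x) (auto simp: idx_set_def forms_def)
      moreover have "e x * v = bas ([x], i)" by (simp add: bas_def form_def i(2))
      ultimately show ?thesis using tau1[of "([x], i)"] i(2)
        by (cases x) (simp_all add: bas_def form_def eqs complex_vector.scale_left_diff_distrib scaleC_one)
    qed
    ultimately have "tau (e x * y) - (case x of Ga \<Rightarrow> q ^ 2 | Gd \<Rightarrow> q | _ \<Rightarrow> 0) *\<^sub>C y = 0"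
      by (rule linC_vanishes_on_span)
    thus ?thesis by simp
  qed
  have "A \<in> temporal_gauge q g e \<longleftrightarrow> tau A = 0" if A: "A \<in> Omega g e 1" for A
  proof
    note gen = complex_vector.subspace_scale[OF subspace_generated]
    assume "A \<in> temporal_gauge q g e"
    then obtain x y z where xyz: "x \<in> generated g" "y \<in> generated g" "z \<in> generated g"
      "A = e Gb * x + e Gc * y + (q *\<^sub>C e Ga - (1 / q) *\<^sub>C e Gd) * z"
      by (auto simp: temporal_gauge_def Let_def)
    have "A = e Gb * x + e Gc * y + (e Ga * (q *\<^sub>C z) - e Gd * ((1 / q) *\<^sub>C z))"
      by (simp add: xyz(4) left_diff_distrib mult_scaleC_left mult_scaleC_right)
    hence "tau A = q ^ 2 *\<^sub>C q *\<^sub>C z - q *\<^sub>C (1 / q) *\<^sub>C z"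
      using xyz(1-3) by (simp add: linC_add[OF tau(1)] linC_diff[OF tau(1)] tau_e gen)
    also have "\<dots> = 0" using root(1) eqs(5) by (simp add: scaleC_scaleC power3_eq_cube power2_eq_square)
    finally show "tau A = 0" .
  next
    assume t: "tau A = 0"
    obtain ya yb yc yd where y: "ya \<in> generated g" "yb \<in> generated g" "yc \<in> generated g" "yd \<in> generated g"
      "A = e Ga * ya + e Gb * yb + e Gc * yc + e Gd * yd"
      using one_form_decomposition[OF A] .
    have qqq: "q * q ^ 2 = 1" "q ^ 2 * q = 1" using root(1) by (simp_all add: power3_eq_cube power2_eq_square mult.assoc)
    have "q ^ 2 *\<^sub>C ya + q *\<^sub>C yd = 0"
      using t y by (simp add: linC_add[OF tau(1)] tau_e)
    hence "q ^ 2 *\<^sub>C (q ^ 2 *\<^sub>C ya + q *\<^sub>C yd) = 0" by simp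
    hence "q *\<^sub>C ya + yd = 0"
      using qqq by (simp add: scaleC_add_right scaleC_scaleC scaleC_one power2_eq_square mult.assoc)
    hence yd: "yd = - (q *\<^sub>C ya)" by (simp add: eq_neg_iff_add_eq_0 add.commute)
    have "q ^ 2 * (1 / q) = q" using eqs(5) by (simp add: power2_eq_square)
    hence "(q *\<^sub>C e Ga - (1 / q) *\<^sub>C e Gd) * (q ^ 2 *\<^sub>C ya) = e Ga * ya - e Gd * (q *\<^sub>C ya)"
      using qqq(2) by (simp add: left_diff_distrib mult_scaleC_left mult_scaleC_right scaleC_scaleC scaleC_one
        complex_vector.scale_right_diff_distrib)
    hence "A = e Gb * yb + e Gc * yc + (q *\<^sub>C e Ga - (1 / q) *\<^sub>C e Gd) * (q ^ 2 *\<^sub>C ya)"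
      by (simp add: y(5) yd algebra_simps)
    thus "A \<in> temporal_gauge q g e"
      using y(2,3) complex_vector.subspace_scale[OF subspace_generated y(1)]
      unfolding temporal_gauge_def Let_def by blast
  qed
  ultimately show thesis using that tau(1) by blast
qed

lemma triangular_indep_val:
  assumes "triangular ws vs" "n \<le> 2" "\<And>w. w \<in> set ws \<Longrightarrow> fst ` set w \<subseteq> idx_set n"
    "\<And>v. v \<in> set vs \<Longrightarrow> fst ` set v \<subseteq> idx_set n"
  shows "indep_list (map val vs)"
proof -
  obtain phi where phi: "\<forall>k. functional (phi k)"
    "\<forall>k\<in>set low_forms \<times> set exps. \<forall>k'\<in>set low_forms \<times> set exps. phi k (bas k') = (if k = k' then 1 else 0)"
    using bas_basis(3) by blast
  note low = subsetD[OF idx_set_low[OF assms(2)]]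
  show ?thesis
  proof (rule triangular_indep[OF root assms(1)])
    show "functional (phi k)" for k using phi(1) by blast
    show "phi k (bas k') = (if k = k' then 1 else 0)" if "k \<in> idx_set n" "k' \<in> idx_set n" for k k'
      using phi(2) low[OF that(1)] low[OF that(2)] by blast
  qed (rule assms(3,4), assumption)+
qed

end

subsection \<open>Certificates\<close>

text \<open>The lists below were found by Gaussian elimination over $\mathbb{Q}(q)$ in each bidegree of the
  $\mathbb{Z} \times \mathbb{Z}_3$-grading for which the differential and the Hodge operator are homogeneous,
  and then scaled to have coefficients in $\mathbb{Z}[q]$. The exact 1-forms have a basis
  \<open>d f\<close> with \<open>f\<close> in the first two lists; those from the first list are both coclosed and without
  \<open>\<theta>\<close> component. The elements of \<open>lorentz_forms_1\<close> span a complement of \<open>T + E\<close>, and those of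
  \<open>temporal_forms_1\<close> a complement of \<open>L + E\<close>, in the space of zero modes.\<close>

definition harmonic_potentials :: "idx vec list" where
  "harmonic_potentials =
    [[(([], 2, 0, 2), Eis 1 0)], [(([], 1, 0, 2), Eis 1 0)],
     [(([], 1, 0, 1), Eis 1 0), (([], 1, 1, 2), Eis 0 (-1))], [(([], 2, 0, 1), Eis 1 0)],
     [(([], 0, 0, 1), Eis 1 0)], [(([], 1, 0, 0), Eis 1 0)],
     [(([], 2, 0, 0), Eis 0 1), (([], 2, 1, 1), Eis 1 0)], [(([], 2, 1, 0), Eis 1 0)],
     [(([], 0, 1, 0), Eis 1 0)], [(([], 1, 1, 0), Eis 1 0), (([], 1, 2, 1), Eis 0 (-1))],
     [(([], 1, 2, 0), Eis 1 0)], [(([], 2, 2, 0), Eis 1 0)]]"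

definition other_potentials :: "idx vec list" where
  "other_potentials =
    [[(([], 0, 0, 2), Eis 1 0)], [(([], 1, 0, 1), Eis 1 0)], [(([], 2, 1, 2), Eis 1 0)],
     [(([], 0, 1, 2), Eis 1 0)], [(([], 0, 1, 1), Eis 1 0)], [(([], 0, 2, 2), Eis 1 0)],
     [(([], 1, 1, 1), Eis 1 0)], [(([], 1, 2, 2), Eis 1 0)], [(([], 2, 0, 0), Eis 1 0)],
     [(([], 2, 2, 2), Eis 1 0)], [(([], 2, 2, 1), Eis 1 0)], [(([], 0, 2, 1), Eis 1 0)],
     [(([], 1, 1, 0), Eis 1 0)], [(([], 0, 2, 0), Eis 1 0)]]"

definition harmonic_forms :: "idx vec list" where
  "harmonic_forms =
    [[(([Gb], 1, 0, 2), Eis 1 0)], [(([Ga], 0, 0, 0), Eis 1 0), (([Gd], 0, 0, 0), Eis 1 0)],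
     [(([Gb], 1, 1, 0), Eis 1 1), (([Gb], 1, 2, 1), Eis 1 0), (([Gc], 2, 0, 1), Eis 1 0),
      (([Gd], 0, 0, 0), Eis 0 1)],
     [(([Gc], 2, 2, 0), Eis 1 0)]]"

definition lorentz_forms_1 :: "idx vec list" where
  "lorentz_forms_1 =
    [[(([Ga], 2, 0, 2), Eis 1 0), (([Gd], 2, 0, 2), Eis 1 0)],
     [(([Ga], 1, 0, 2), Eis 1 0), (([Gd], 1, 0, 2), Eis 1 0)],
     [(([Ga], 1, 0, 1), Eis 1 0), (([Ga], 1, 1, 2), Eis 0 (-1)), (([Gd], 1, 0, 1), Eis 1 0),
      (([Gd], 1, 1, 2), Eis 0 (-1))],
     [(([Ga], 2, 0, 1), Eis 1 0), (([Gd], 2, 0, 1), Eis 1 0)],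
     [(([Ga], 2, 1, 0), Eis 1 0), (([Gd], 2, 1, 0), Eis 1 0)],
     [(([Ga], 1, 1, 0), Eis 1 0), (([Ga], 1, 2, 1), Eis 0 (-1)), (([Gd], 1, 1, 0), Eis 1 0),
      (([Gd], 1, 2, 1), Eis 0 (-1))],
     [(([Ga], 1, 2, 0), Eis 1 0), (([Gd], 1, 2, 0), Eis 1 0)],
     [(([Ga], 2, 2, 0), Eis 1 0), (([Gd], 2, 2, 0), Eis 1 0)]]"

definition lorentz_forms_2 :: "idx vec list" where
  "lorentz_forms_2 =
    [[(([Ga], 0, 0, 1), Eis 1 0), (([Gd], 0, 0, 1), Eis 1 0)],
     [(([Ga], 0, 0, 1), Eis 1 0), (([Ga], 0, 1, 2), Eis 1 1), (([Gb], 1, 1, 1), Eis 0 1),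
      (([Gc], 2, 0, 2), Eis 0 (-1)), (([Gd], 0, 1, 2), Eis 1 0)],
     [(([Ga], 1, 0, 0), Eis 1 0), (([Gd], 1, 0, 0), Eis 1 0)],
     [(([Ga], 1, 1, 1), Eis 1 0), (([Gb], 2, 1, 0), Eis 0 (-1)), (([Gc], 0, 1, 2), Eis (-1) (-1)),
      (([Gd], 1, 0, 0), Eis 1 0), (([Gd], 1, 1, 1), Eis 0 (-1))],
     [(([Gb], 0, 1, 0), Eis 1 0), (([Gd], 2, 0, 0), Eis 0 1), (([Gd], 2, 1, 1), Eis 1 0)],
     [(([Ga], 2, 0, 0), Eis 1 0), (([Ga], 2, 2, 2), Eis 0 (-1)), (([Gb], 0, 2, 1), Eis 0 1),
      (([Gc], 1, 0, 1), Eis 1 1), (([Gc], 1, 1, 2), Eis 1 0), (([Gd], 2, 1, 1), Eis 1 0),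
      (([Gd], 2, 2, 2), Eis (-1) (-1))],
     [(([Ga], 0, 1, 0), Eis 1 0), (([Gd], 0, 1, 0), Eis 1 0)],
     [(([Ga], 0, 2, 1), Eis 1 1), (([Gb], 1, 2, 0), Eis 0 1), (([Gc], 2, 0, 0), Eis (-1) 0),
      (([Gc], 2, 1, 1), Eis 1 0), (([Gc], 2, 2, 2), Eis (-1) 0), (([Gd], 0, 2, 1), Eis 1 0)]]"

definition temporal_forms_1 :: "idx vec list" where
  "temporal_forms_1 =
    [[(([Ga], 2, 0, 2), Eis 1 0), (([Gb], 0, 1, 2), Eis 0 1), (([Gd], 2, 0, 2), Eis 0 (-1))],
     [(([Gb], 2, 0, 1), Eis 1 0)],
     [(([Ga], 1, 0, 1), Eis 1 1), (([Ga], 1, 1, 2), Eis 1 0), (([Gb], 2, 0, 0), Eis 1 0),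
      (([Gb], 2, 2, 2), Eis 0 (-1)), (([Gd], 1, 0, 1), Eis 1 0), (([Gd], 1, 1, 2), Eis 0 (-1))],
     [(([Gb], 0, 0, 0), Eis 0 1), (([Gc], 1, 0, 2), Eis 1 0)],
     [(([Ga], 2, 1, 0), Eis 1 1), (([Gc], 1, 1, 1), Eis 1 0), (([Gd], 2, 1, 0), Eis 1 0)],
     [(([Gb], 2, 2, 0), Eis 0 1), (([Gc], 0, 0, 0), Eis 1 0)],
     [(([Ga], 1, 2, 0), Eis (-1) 0), (([Gc], 0, 2, 1), Eis 1 0), (([Gd], 1, 2, 0), Eis 0 1)],
     [(([Ga], 2, 2, 0), Eis 1 0), (([Gd], 2, 2, 0), Eis 0 (-1))]]"

definition temporal_forms_2 :: "idx vec list" where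
  "temporal_forms_2 =
    [[(([Gb], 1, 0, 2), Eis 1 0)], [(([Gb], 1, 0, 0), Eis 1 0)],
     [(([Ga], 0, 1, 2), Eis 0 1), (([Gb], 1, 1, 1), Eis (-1) 0), (([Gc], 2, 0, 2), Eis 1 0),
      (([Gd], 0, 1, 2), Eis 1 1)],
     [(([Gb], 1, 1, 0), Eis 1 0), (([Gb], 1, 2, 1), Eis 0 (-1)), (([Gc], 2, 0, 1), Eis 1 0)],
     [(([Ga], 0, 0, 0), Eis 1 0), (([Gc], 2, 0, 1), Eis 1 1), (([Gd], 0, 0, 0), Eis 0 (-1))],
     [(([Gc], 0, 0, 1), Eis 1 0)],
     [(([Ga], 1, 1, 1), Eis 1 1), (([Gb], 2, 1, 0), Eis 1 0), (([Gc], 0, 1, 2), Eis 0 (-1)),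
      (([Gd], 1, 1, 1), Eis 1 0)],
     [(([Gb], 0, 1, 0), Eis 1 0)],
     [(([Ga], 2, 1, 1), Eis 1 0), (([Ga], 2, 2, 2), Eis (-1) (-1)), (([Gb], 0, 2, 1), Eis 1 1),
      (([Gc], 1, 0, 1), Eis 1 0), (([Gc], 1, 1, 2), Eis 0 (-1)), (([Gd], 2, 1, 1), Eis 0 (-1)),
      (([Gd], 2, 2, 2), Eis (-1) 0)],
     [(([Ga], 0, 1, 0), Eis 1 0), (([Gd], 0, 1, 0), Eis 0 (-1))],
     [(([Ga], 0, 2, 1), Eis (-1) 0), (([Gb], 1, 2, 0), Eis (-1) (-1)), (([Gc], 2, 0, 0), Eis 1 0),
      (([Gc], 2, 2, 2), Eis 0 (-1)), (([Gd], 0, 2, 1), Eis 0 1)],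
     [(([Gc], 2, 2, 0), Eis 1 0)]]"

definition non_modes :: "idx vec list" where
  "non_modes =
    [[(([Gb], 2, 0, 2), Eis 1 0)], [(([Gb], 0, 0, 2), Eis 1 0)], [(([Gb], 0, 1, 2), Eis 1 0)],
     [(([Gb], 1, 1, 2), Eis 1 0)], [(([Gb], 1, 0, 1), Eis 1 0)], [(([Gd], 0, 0, 2), Eis 1 0)],
     [(([Gb], 2, 1, 2), Eis 1 0)], [(([Gd], 1, 1, 2), Eis 1 0)], [(([Gb], 2, 1, 1), Eis 1 0)],
     [(([Gc], 0, 0, 2), Eis 1 0)], [(([Ga], 1, 0, 1), Eis 1 0)], [(([Gb], 0, 2, 2), Eis 1 0)],
     [(([Ga], 2, 1, 2), Eis 1 0)], [(([Gd], 2, 1, 2), Eis 1 0)], [(([Ga], 2, 0, 1), Eis 1 0)],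
     [(([Gc], 2, 0, 2), Eis 1 0)], [(([Gb], 1, 2, 2), Eis 1 0)], [(([Gb], 1, 1, 1), Eis 1 0)],
     [(([Gd], 0, 1, 2), Eis 1 0)], [(([Ga], 0, 2, 2), Eis 1 0)], [(([Ga], 0, 1, 1), Eis 1 0)],
     [(([Gb], 1, 2, 1), Eis 1 0)], [(([Gd], 0, 1, 1), Eis 1 0)], [(([Gd], 0, 2, 2), Eis 1 0)],
     [(([Ga], 0, 0, 0), Eis 1 0)], [(([Gb], 2, 2, 1), Eis 1 0)], [(([Gb], 2, 1, 0), Eis 1 0)],
     [(([Gc], 0, 1, 2), Eis 1 0)], [(([Gd], 1, 2, 2), Eis 1 0)], [(([Gd], 1, 1, 1), Eis 1 0)],
     [(([Gc], 1, 1, 2), Eis 1 0)], [(([Gb], 0, 2, 1), Eis 1 0)], [(([Ga], 2, 0, 0), Eis 1 0)],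
     [(([Gd], 2, 1, 1), Eis 1 0)], [(([Gd], 2, 2, 2), Eis 1 0)], [(([Ga], 2, 2, 1), Eis 1 0)],
     [(([Gc], 1, 2, 2), Eis 1 0)], [(([Gd], 2, 2, 1), Eis 1 0)], [(([Gc], 1, 1, 1), Eis 1 0)],
     [(([Gb], 1, 2, 0), Eis 1 0)], [(([Gc], 2, 2, 2), Eis 1 0)], [(([Gd], 0, 2, 1), Eis 1 0)],
     [(([Gc], 2, 0, 0), Eis 1 0)], [(([Gc], 0, 2, 2), Eis 1 0)], [(([Ga], 1, 2, 1), Eis 1 0)],
     [(([Gd], 1, 2, 1), Eis 1 0)], [(([Gb], 2, 2, 0), Eis 1 0)], [(([Ga], 1, 2, 0), Eis 1 0)],
     [(([Gc], 1, 1, 0), Eis 1 0)], [(([Ga], 0, 2, 0), Eis 1 0)], [(([Gd], 0, 2, 0), Eis 1 0)],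
     [(([Gc], 2, 1, 0), Eis 1 0)], [(([Gc], 0, 2, 0), Eis 1 0)], [(([Gc], 1, 2, 0), Eis 1 0)]]"

definition exact_modes_1 :: "idx vec list" where "exact_modes_1 = map d_vec harmonic_potentials"
definition exact_modes_2 :: "idx vec list" where "exact_modes_2 = map d_vec other_potentials"

definition mode_basis :: "idx vec list" where
  "mode_basis = exact_modes_1 @ exact_modes_2 @ harmonic_forms @ lorentz_forms_1 @ lorentz_forms_2 @ temporal_forms_1"

definition modes_covectors :: "idx vec list" where
  "modes_covectors =
    [[(([Gb], 0, 0, 1), Eis 1 0)], [(([Ga], 1, 0, 2), Eis (-1) 0), (([Gd], 1, 0, 2), Eis 1 0)],
     [(([Gb], 2, 1, 1), Eis 1 0)],
     [(([Gb], 0, 0, 0), Eis 1 0), (([Gc], 1, 0, 2), Eis 0 (-1)), (([Gd], 2, 1, 2), Eis 1 0)],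
     [(([Gb], 1, 0, 0), Eis 1 0)],
     [(([Ga], 1, 0, 0), Eis 1 0), (([Ga], 1, 1, 1), Eis 1 0), (([Gc], 0, 0, 1), Eis 1 3),
      (([Gd], 1, 0, 0), Eis (-1) 0)],
     [(([Ga], 2, 1, 1), Eis 1 0)], [(([Gc], 1, 0, 0), Eis 1 0)],
     [(([Ga], 0, 1, 0), Eis (-1) 0), (([Gc], 2, 0, 0), Eis 1 (-1)), (([Gc], 2, 2, 2), Eis (-1) 1),
      (([Gd], 0, 1, 0), Eis 1 0)],
     [(([Ga], 1, 2, 1), Eis (-1) 0), (([Gd], 1, 2, 1), Eis 1 0)], [(([Gc], 0, 1, 0), Eis 1 0)],
     [(([Gc], 1, 1, 0), Eis 1 0)], [(([Ga], 0, 0, 2), Eis 1 0)], [(([Gc], 0, 0, 2), Eis 1 0)],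
     [(([Ga], 2, 1, 2), Eis 1 0)],
     [(([Ga], 0, 0, 1), Eis (-1) 0), (([Gd], 0, 0, 1), Eis 1 0), (([Gd], 0, 1, 2), Eis 1 0)],
     [(([Gb], 1, 1, 0), Eis 0 1), (([Gc], 2, 0, 1), Eis 1 0)], [(([Gc], 2, 1, 2), Eis 1 0)],
     [(([Gc], 0, 0, 1), Eis 1 0)], [(([Ga], 1, 2, 2), Eis 1 0)],
     [(([Gb], 0, 1, 0), Eis 0 (-1)), (([Gd], 2, 0, 0), Eis 1 0)],
     [(([Gc], 1, 0, 1), Eis 1 0), (([Gd], 2, 2, 2), Eis 1 0)], [(([Gb], 0, 2, 0), Eis 1 0)],
     [(([Gc], 2, 0, 0), Eis 1 0), (([Gc], 2, 1, 1), Eis 1 0)], [(([Gc], 0, 1, 1), Eis 1 0)],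
     [(([Ga], 0, 2, 0), Eis 1 0)], [(([Gb], 1, 0, 2), Eis 1 0)], [(([Ga], 0, 0, 0), Eis 1 0)],
     [(([Gb], 1, 1, 0), Eis 1 0)], [(([Gc], 2, 2, 0), Eis 1 0)],
     [(([Gb], 0, 1, 2), Eis 1 0), (([Gd], 2, 0, 2), Eis 1 0)], [(([Ga], 1, 0, 2), Eis 1 0)],
     [(([Ga], 1, 0, 1), Eis 0 1), (([Gb], 2, 0, 0), Eis 1 0)], [(([Ga], 2, 0, 1), Eis 1 0)],
     [(([Ga], 2, 1, 0), Eis 0 1), (([Gc], 1, 1, 1), Eis 1 0)], [(([Ga], 1, 1, 0), Eis 1 0)],
     [(([Ga], 1, 2, 0), Eis 1 0), (([Gc], 0, 2, 1), Eis 1 0)],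
     [(([Ga], 2, 2, 0), Eis 0 1), (([Gd], 2, 2, 0), Eis 1 0)], [(([Gd], 0, 0, 1), Eis 1 0)],
     [(([Ga], 0, 0, 1), Eis 1 0)], [(([Ga], 1, 0, 0), Eis 1 0)], [(([Ga], 1, 1, 1), Eis 1 0)],
     [(([Gb], 0, 1, 0), Eis 1 0)], [(([Ga], 2, 0, 0), Eis 1 0)], [(([Ga], 0, 1, 0), Eis 1 0)],
     [(([Ga], 0, 2, 1), Eis 1 0)], [(([Ga], 2, 0, 2), Eis 1 0)], [(([Gb], 2, 0, 1), Eis 1 0)],
     [(([Ga], 1, 0, 1), Eis 1 0)], [(([Gb], 0, 0, 0), Eis 1 0)], [(([Ga], 2, 1, 0), Eis 1 0)],
     [(([Gb], 2, 2, 0), Eis 1 0)], [(([Ga], 1, 2, 0), Eis 1 0)], [(([Ga], 2, 2, 0), Eis 1 0)]]"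

definition non_modes_covectors :: "idx vec list" where
  "non_modes_covectors =
    [[(([Gb], 2, 0, 2), Eis 1 0)], [(([Gb], 0, 0, 2), Eis 1 0)], [(([Ga], 2, 0, 2), Eis 1 0)],
     [(([Gb], 1, 1, 2), Eis 1 0)], [(([Ga], 0, 0, 2), Eis 1 0)], [(([Gb], 1, 0, 1), Eis 1 0)],
     [(([Gb], 2, 0, 1), Eis 1 0)], [(([Ga], 1, 1, 2), Eis 1 0)],
     [(([Gb], 2, 0, 0), Eis 2 2), (([Gc], 0, 0, 2), Eis 1 (-1)), (([Gd], 1, 0, 1), Eis 1 0)],
     [(([Gc], 0, 0, 2), Eis 2 0), (([Gd], 1, 0, 1), Eis 0 1)], [(([Ga], 1, 0, 1), Eis 1 0)],
     [(([Gb], 0, 2, 2), Eis 1 0)], [(([Ga], 2, 0, 1), Eis 1 0)], [(([Gb], 0, 1, 1), Eis 1 0)],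
     [(([Gb], 0, 0, 0), Eis 1 0)], [(([Ga], 0, 0, 1), Eis 1 0)], [(([Gb], 1, 1, 1), Eis 1 0)],
     [(([Gb], 1, 0, 0), Eis 1 0)], [(([Gc], 2, 0, 2), Eis 1 0)],
     [(([Ga], 0, 0, 0), Eis 0 1), (([Ga], 0, 1, 1), Eis 0 1), (([Gb], 1, 2, 1), Eis (-2) 0),
      (([Gd], 0, 0, 0), Eis 1 0), (([Gd], 0, 1, 1), Eis 1 0)],
     [(([Ga], 0, 1, 1), Eis 1 0), (([Gc], 2, 0, 1), Eis 1 0)],
     [(([Gb], 1, 1, 0), Eis 1 0), (([Gc], 2, 1, 2), Eis 2 0), (([Gd], 0, 1, 1), Eis 1 0)],
     [(([Ga], 0, 1, 1), Eis 1 0)], [(([Ga], 0, 2, 2), Eis 1 0)], [(([Ga], 0, 0, 0), Eis 1 0)],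
     [(([Ga], 1, 1, 1), Eis 1 0)], [(([Ga], 1, 0, 0), Eis 1 0)], [(([Gc], 0, 0, 1), Eis 1 0)],
     [(([Gb], 2, 2, 1), Eis 1 0)], [(([Gb], 2, 1, 0), Eis 1 0)], [(([Ga], 2, 1, 1), Eis 1 0)],
     [(([Gb], 0, 1, 0), Eis 1 0)], [(([Ga], 2, 0, 0), Eis 1 0)], [(([Gc], 1, 0, 1), Eis 1 0)],
     [(([Gc], 1, 1, 2), Eis 1 0)], [(([Ga], 2, 1, 0), Eis 0 1), (([Gc], 1, 0, 0), Eis 1 0)],
     [(([Gc], 1, 2, 2), Eis (-1) 2), (([Gd], 2, 2, 1), Eis 1 0)], [(([Ga], 2, 2, 1), Eis 1 0)],
     [(([Ga], 2, 1, 0), Eis 1 0)], [(([Ga], 0, 1, 0), Eis 1 0)], [(([Gc], 2, 1, 1), Eis 1 0)],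
     [(([Gb], 1, 2, 0), Eis 1 0)], [(([Gc], 2, 0, 0), Eis 1 0)], [(([Ga], 1, 2, 1), Eis 1 0)],
     [(([Ga], 1, 1, 0), Eis 1 0)], [(([Gc], 0, 1, 1), Eis 1 0)], [(([Gc], 0, 0, 0), Eis 1 0)],
     [(([Ga], 1, 2, 0), Eis 1 0)], [(([Gc], 1, 1, 0), Eis 1 0)], [(([Ga], 0, 2, 0), Eis 1 0)],
     [(([Gc], 2, 2, 1), Eis 1 0)], [(([Gc], 2, 1, 0), Eis 1 0)], [(([Gc], 0, 2, 0), Eis 1 0)],
     [(([Gc], 1, 2, 0), Eis 1 0)]]"

definition lorentz_covectors :: "idx vec list" where
  "lorentz_covectors =
    [[(([], 0, 0, 2), Eis 1 0)], [(([], 1, 0, 1), Eis 0 1), (([], 1, 1, 2), Eis 1 0)],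
     [(([], 2, 1, 2), Eis 1 0)], [(([], 0, 0, 1), Eis 1 0)], [(([], 0, 0, 0), Eis 1 0)],
     [(([], 0, 1, 1), Eis 1 0)], [(([], 1, 0, 0), Eis 1 0)], [(([], 1, 1, 1), Eis 1 0)],
     [(([], 2, 0, 0), Eis 1 0)], [(([], 2, 1, 1), Eis 1 0)], [(([], 2, 2, 1), Eis 1 0)],
     [(([], 0, 1, 0), Eis 1 0)], [(([], 1, 1, 0), Eis 0 1), (([], 1, 2, 1), Eis 1 0)],
     [(([], 0, 2, 0), Eis 1 0)], [(([], 2, 0, 2), Eis 1 0)], [(([], 1, 0, 2), Eis 1 0)],
     [(([], 1, 0, 1), Eis 1 0)], [(([], 2, 0, 1), Eis 1 0)], [(([], 2, 1, 0), Eis 1 0)],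
     [(([], 1, 1, 0), Eis 1 0)], [(([], 1, 2, 0), Eis 1 0)], [(([], 2, 2, 0), Eis 1 0)]]"

definition temporal_covectors :: "idx vec list" where
  "temporal_covectors =
    [[(([Gb], 0, 0, 1), Eis 1 0)], [(([Ga], 1, 0, 2), Eis 1 0)], [(([Gb], 2, 1, 1), Eis 1 0)],
     [(([Ga], 2, 0, 1), Eis 1 0)], [(([Ga], 0, 0, 1), Eis 1 0)], [(([Ga], 1, 0, 0), Eis 1 0)],
     [(([Ga], 2, 0, 0), Eis 1 0)], [(([Gc], 1, 0, 0), Eis 1 0)], [(([Gc], 2, 1, 1), Eis 1 0)],
     [(([Ga], 1, 1, 0), Eis 1 0)], [(([Gc], 0, 1, 0), Eis 1 0)], [(([Gc], 1, 1, 0), Eis 1 0)],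
     [(([Ga], 2, 0, 2), Eis 1 0)], [(([Gb], 2, 0, 1), Eis 1 0)], [(([Ga], 1, 0, 1), Eis 1 0)],
     [(([Gb], 0, 0, 0), Eis 1 0)], [(([Ga], 2, 1, 0), Eis 1 0)], [(([Gb], 2, 2, 0), Eis 1 0)],
     [(([Ga], 1, 2, 0), Eis 1 0)], [(([Ga], 2, 2, 0), Eis 1 0)], [(([Gb], 1, 0, 2), Eis 1 0)],
     [(([Gb], 1, 0, 0), Eis 1 0)], [(([Ga], 0, 1, 2), Eis 1 0)], [(([Gb], 1, 1, 0), Eis 1 0)],
     [(([Ga], 0, 0, 0), Eis 1 0)], [(([Gc], 0, 0, 1), Eis 1 0)], [(([Ga], 1, 1, 1), Eis 1 0)],
     [(([Gb], 0, 1, 0), Eis 1 0)], [(([Ga], 2, 1, 1), Eis 1 0)], [(([Ga], 0, 1, 0), Eis 1 0)],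
     [(([Ga], 0, 2, 1), Eis 1 0)], [(([Gc], 2, 2, 0), Eis 1 0)]]"

definition tau_covectors :: "idx vec list" where
  "tau_covectors =
    [[(([], 0, 0, 2), Eis 1 0)], [(([], 1, 0, 1), Eis 0 1), (([], 1, 1, 2), Eis 1 0)],
     [(([], 2, 1, 2), Eis 1 0)], [(([], 0, 0, 1), Eis 1 0)], [(([], 0, 0, 0), Eis 1 0)],
     [(([], 0, 1, 1), Eis 1 0)], [(([], 1, 0, 0), Eis 1 0)], [(([], 1, 1, 1), Eis 1 0)],
     [(([], 2, 0, 0), Eis 1 0)], [(([], 2, 1, 1), Eis 1 0)], [(([], 2, 2, 1), Eis 1 0)],
     [(([], 0, 1, 0), Eis 1 0)], [(([], 1, 1, 0), Eis 0 1), (([], 1, 2, 1), Eis 1 0)],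
     [(([], 0, 2, 0), Eis 1 0)], [(([], 2, 0, 2), Eis 1 0)], [(([], 1, 0, 2), Eis 1 0)],
     [(([], 1, 0, 1), Eis 1 0)], [(([], 2, 0, 1), Eis 1 0)], [(([], 2, 1, 0), Eis 1 0)],
     [(([], 1, 1, 0), Eis 1 0)], [(([], 1, 2, 0), Eis 1 0)], [(([], 2, 2, 0), Eis 1 0)]]"

definition curvature_covectors :: "idx vec list" where
  "curvature_covectors =
    [[(([Ga, Gb], 0, 0, 1), Eis 2 0), (([Gb, Gd], 0, 0, 1), Eis 1 0)], [(([Ga, Gd], 1, 0, 2), Eis 1 0)],
     [(([Ga, Gb], 2, 0, 0), Eis 2 0), (([Gb, Gd], 2, 0, 0), Eis 1 0)], [(([Ga, Gd], 2, 0, 1), Eis 1 0)],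
     [(([Ga, Gc], 1, 0, 0), Eis 1 0), (([Gc, Gd], 1, 0, 0), Eis 0 (-1))], [(([Ga, Gd], 1, 1, 0), Eis 1 0)],
     [(([Ga, Gc], 0, 1, 0), Eis 1 0), (([Gc, Gd], 0, 1, 0), Eis 0 (-1))], [(([Ga, Gd], 2, 2, 0), Eis 1 0)],
     [(([Ga, Gb], 1, 0, 0), Eis 0 1), (([Ga, Gd], 0, 0, 1), Eis 1 0)], [(([Ga, Gb], 1, 0, 0), Eis 1 0)],
     [(([Ga, Gc], 0, 0, 1), Eis 1 2), (([Gc, Gd], 0, 0, 1), Eis 1 0)], [(([Ga, Gc], 0, 0, 1), Eis 1 0)],
     [(([Ga, Gb], 0, 1, 0), Eis 1 0)], [(([Ga, Gd], 2, 0, 0), Eis 1 0)],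
     [(([Ga, Gc], 2, 0, 0), Eis (-1) 0), (([Gc, Gd], 2, 0, 0), Eis 1 0)], [(([Ga, Gc], 2, 0, 0), Eis 1 0)],
     [(([Ga, Gb], 0, 0, 1), Eis 1 0)], [(([Ga, Gb], 2, 0, 1), Eis 1 0)], [(([Ga, Gb], 2, 0, 0), Eis 1 0)],
     [(([Ga, Gb], 0, 0, 0), Eis 1 0)], [(([Ga, Gc], 1, 0, 0), Eis 1 0)], [(([Ga, Gb], 2, 2, 0), Eis 1 0)],
     [(([Ga, Gc], 0, 1, 0), Eis 1 0)], [(([Ga, Gc], 1, 1, 0), Eis 1 0)]]"

definition keys_in :: "nat \<Rightarrow> idx vec list \<Rightarrow> bool" where
  "keys_in n vs \<longleftrightarrow> (\<forall>v\<in>set vs. \<forall>((w, i), c)\<in>set v. w \<in> set forms \<and> length w = n \<and> i \<in> set exps)"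

lemma potentials_keys: "keys_in 0 (harmonic_potentials @ other_potentials @ tau_covectors @ lorentz_covectors)"
  by code_simp

lemma forms_keys:
  "keys_in 1 (harmonic_forms @ lorentz_forms_1 @ lorentz_forms_2 @ temporal_forms_1 @ temporal_forms_2 @ non_modes @
     modes_covectors @ non_modes_covectors @ temporal_covectors)"
  by code_simp

lemma curvature_keys: "keys_in 2 curvature_covectors"
  by code_simp

lemma list_lengths:
  "length harmonic_potentials = 12 \<and> length other_potentials = 14 \<and> length harmonic_forms = 4 \<and>
   length lorentz_forms_1 = 8 \<and> length lorentz_forms_2 = 8 \<and> length temporal_forms_1 = 8 \<and>
   length temporal_forms_2 = 12 \<and> length non_modes = 54"
  by code_simp

lemma mode_basis_triangular: "triangular modes_covectors mode_basis"
  by code_simp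

lemma non_modes_triangular: "triangular non_modes_covectors (map maxwell_vec non_modes)"
  by code_simp

lemma modes_maxwell: "\<forall>v\<in>set (mode_basis @ temporal_forms_2). is_zero (maxwell_vec v)"
  by code_simp

lemma lorentz_triangular: "triangular lorentz_covectors (map codiff_vec (exact_modes_2 @ temporal_forms_1))"
  by code_simp

lemma lorentz_coclosed:
  "\<forall>v\<in>set (exact_modes_1 @ harmonic_forms @ lorentz_forms_1 @ lorentz_forms_2). is_zero (codiff_vec v)"
  by code_simp

lemma temporal_triangular: "triangular temporal_covectors (exact_modes_1 @ temporal_forms_1 @ temporal_forms_2)"
  by code_simp

lemma tau_triangular: "triangular tau_covectors (map (lin tau_idx) (exact_modes_2 @ lorentz_forms_1))"
  by code_simp

lemma temporal_tau: "\<forall>v\<in>set (exact_modes_1 @ temporal_forms_1 @ temporal_forms_2). is_zero (lin tau_idx v)"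
  by code_simp

lemma curvature_triangular:
  "triangular curvature_covectors (map d_vec (lorentz_forms_1 @ lorentz_forms_2 @ temporal_forms_1))"
  by code_simp

lemma closed_forms: "\<forall>v\<in>set (exact_modes_1 @ exact_modes_2 @ harmonic_forms). is_zero (d_vec v)"
  by code_simp

subsection \<open>Zero modes and gauges\<close>

lemma indep_list_sub:
  assumes "indep_list vs" "distinct ws" "set ws \<subseteq> set vs"
  shows "indep_list ws"
  using assms complex_vector.independent_mono[of "set vs" "set ws"] by (auto simp: indep_list_def)

lemma subspace_plus:
  "complex_vector.subspace S \<Longrightarrow> complex_vector.subspace T \<Longrightarrow> complex_vector.subspace (plus_space S T)"
  by (rule complex_vector.subspace_sums)

lemma quot_plus:
  assumes "complex_vector.subspace E"
  shows "quot (plus_space S E) E = quot S E"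
proof -
  have "coset E (x + y) = coset E x" if "y \<in> E" for x y using that assms by (simp add: coset_eq_iff)
  moreover have "x \<in> plus_space S E" if "x \<in> S" for x
  proof -
    have "x = x + 0" "0 \<in> E" using complex_vector.subspace_0[OF assms] by simp_all
    with that show ?thesis by blast
  qed
  ultimately show ?thesis unfolding quot_def by force
qed

lemma quotient_dimensions:
  fixes E Z F L T H :: "'w::complex_algebra set"
  assumes fin: "finite C" "complex_vector.span C = (UNIV :: 'w set)"
    and sub: "complex_vector.subspace E" "complex_vector.subspace Z" "complex_vector.subspace H"
      "complex_vector.subspace L" "complex_vector.subspace T"
    and incl: "E \<subseteq> Z" "L \<subseteq> Z" "T \<subseteq> Z"
    and dims: "complex_vector.dim Z = 54" "complex_vector.dim E = 26" "complex_vector.dim F = 30"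
      "complex_vector.dim L = 32" "complex_vector.dim T = 32"
      "complex_vector.dim (L \<inter> E) = 12" "complex_vector.dim (T \<inter> E) = 12"
    and F: "F = plus_space H E" and Z: "Z \<subseteq> plus_space (plus_space L T) E"
  shows "quot_dim E (quot Z E) = 28" "quot_dim E (quot F E) = 4"
    "\<exists>B\<subseteq>H. card B = 4 \<and> quot_basis E (quot F E) B"
    "quot_dim E (quot L E) = 20" "quot_dim E (quot T E) = 20" "quot_dim E (quot L E \<inter> quot T E) = 12"
proof -
  note qd = quot_dim_quot(1)[OF fin sub(1)] and dp = dim_plus_Int[OF fin]
  show "quot_dim E (quot Z E) = 28"
    using qd[OF sub(2)] dims plus_space_absorb[OF sub(2,1) incl(1)] by simp
  have FH: "quot F E = quot H E" unfolding F by (rule quot_plus[OF sub(1)])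
  show F4: "quot_dim E (quot F E) = 4"
  proof -
    have "complex_vector.dim (plus_space H E) = 30" using dims(3) F by simp
    thus ?thesis using qd[OF sub(3)] dims(2) unfolding FH by simp
  qed
  show "\<exists>B\<subseteq>H. card B = 4 \<and> quot_basis E (quot F E) B"
    using quot_dim_quot(2)[OF fin sub(1,3)] F4 unfolding FH by metis
  have L: "complex_vector.dim (plus_space L E) = 46" using dp[OF sub(4,1)] dims by simp
  have T: "complex_vector.dim (plus_space T E) = 46" using dp[OF sub(5,1)] dims by simp
  show "quot_dim E (quot L E) = 20" using qd[OF sub(4)] L dims(2) by simp
  show "quot_dim E (quot T E) = 20" using qd[OF sub(5)] T dims(2) by simp
  let ?L = "plus_space L E" and ?T = "plus_space T E"
  have subLT: "complex_vector.subspace ?L" "complex_vector.subspace ?T"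
    using sub subspace_plus by blast+
  have E0: "0 \<in> E" by (rule complex_vector.subspace_0[OF sub(1)])
  have "plus_space ?L ?T = Z"
  proof
    show "plus_space ?L ?T \<subseteq> Z"
    proof
      fix z assume "z \<in> plus_space ?L ?T"
      then obtain l y t y' where "l \<in> L" "y \<in> E" "t \<in> T" "y' \<in> E" and z: "z = (l + y) + (t + y')" by blast
      hence "l \<in> Z" "y \<in> Z" "t \<in> Z" "y' \<in> Z" using incl by auto
      thus "z \<in> Z" unfolding z by (intro complex_vector.subspace_add[OF sub(2)])
    qed
    show "Z \<subseteq> plus_space ?L ?T"
    proof
      fix z assume "z \<in> Z"
      hence "z \<in> plus_space (plus_space L T) E" using Z by blast
      then obtain l t y where lty: "l \<in> L" "t \<in> T" "y \<in> E" "z = (l + t) + y" by blast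
      have "z = (l + y) + (t + 0)" by (simp add: lty(4) algebra_simps)
      thus "z \<in> plus_space ?L ?T" using lty(1-3) E0 by blast
    qed
  qed
  hence "complex_vector.dim (?L \<inter> ?T) = 38" using dp[OF subLT] L T dims(1) by simp
  moreover have "E \<subseteq> ?L \<inter> ?T"
  proof
    fix y assume y: "y \<in> E"
    have "y = 0 + y" "0 \<in> L" "0 \<in> T"
      using complex_vector.subspace_0[OF sub(4)] complex_vector.subspace_0[OF sub(5)] by simp_all
    thus "y \<in> ?L \<inter> ?T" using y by blast
  qed
  moreover have subI: "complex_vector.subspace (?L \<inter> ?T)" using subLT by (rule complex_vector.subspace_inter)
  ultimately show "quot_dim E (quot L E \<inter> quot T E) = 12"
    unfolding quot_Int[OF sub(1)] using qd[OF subI] plus_space_absorb[OF subI sub(1)] dims(2) by simp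
qed

lemma keys_inD: "keys_in n vs \<Longrightarrow> v \<in> set vs \<Longrightarrow> fst ` set v \<subseteq> idx_set n"
  unfolding keys_in_def idx_set_def by fastforce

lemma exact_modes_keys:
  assumes "v \<in> set (exact_modes_1 @ exact_modes_2)"
  shows "fst ` set v \<subseteq> idx_set 1"
proof -
  obtain f where f: "f \<in> set (harmonic_potentials @ other_potentials)" "v = d_vec f"
    using assms by (auto simp: exact_modes_1_def exact_modes_2_def)
  have "fst ` set f \<subseteq> idx_set 0" using keys_inD[OF potentials_keys] f(1) by auto
  thus ?thesis using keys_d_vec[of f 0] f(2) by simp
qed

lemma all_keys:
  assumes "v \<in> set (mode_basis @ temporal_forms_2 @ non_modes)"
  shows "fst ` set v \<subseteq> idx_set 1"
  using assms exact_modes_keys[of v] keys_inD[OF forms_keys, of v] by (auto simp: mode_basis_def)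

context SL2_root3
begin

lemma val_kernel:
  assumes "linC f" "\<And>v. fst ` set v \<subseteq> idx_set n \<Longrightarrow> f (val v) = val (F v)"
    and "\<forall>v\<in>set vs. is_zero (F v)" "\<And>v. v \<in> set vs \<Longrightarrow> fst ` set v \<subseteq> idx_set n"
    and "x \<in> set (map val vs)"
  shows "f x = 0"
proof -
  obtain v where "v \<in> set vs" "x = val v" using assms(5) by auto
  hence "f x = val (F v)" using assms(2)[OF assms(4)] by simp
  also have "\<dots> = 0" using assms(3) \<open>v \<in> set vs\<close> by (intro vec_value_is_zero) blast
  finally show ?thesis .
qed

lemma val_image_indep:
  assumes "\<And>v. fst ` set v \<subseteq> idx_set n \<Longrightarrow> f (val v) = val (F v)"
    and "\<And>v. fst ` set v \<subseteq> idx_set n \<Longrightarrow> fst ` set (F v) \<subseteq> idx_set m"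
    and "m \<le> 2" "triangular ws (map F vs)" "\<And>w. w \<in> set ws \<Longrightarrow> fst ` set w \<subseteq> idx_set m"
    and "\<And>v. v \<in> set vs \<Longrightarrow> fst ` set v \<subseteq> idx_set n"
  shows "indep_list (map f (map val vs))"
proof -
  have eq: "map f (map val vs) = map val (map F vs)" using assms(1,6) by simp
  show ?thesis unfolding eq
    using assms(2,6) by (intro triangular_indep_val[OF assms(4,3,5)]) auto
qed

definition idx_list :: "nat \<Rightarrow> idx list" where
  "idx_list n = List.product (filter (\<lambda>w. length w = n) forms) exps"

lemma set_idx_list: "set (idx_list n) = idx_set n"
  by (auto simp: idx_list_def idx_set_def)

lemma idx_list_props: "distinct (idx_list 0) \<and> length (idx_list 0) = 27" "distinct (idx_list 1) \<and> length (idx_list 1) = 108"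
proof -
  have d: "distinct exps" "length exps = 27" unfolding exps_def by (simp_all add: distinct_product)
  have "distinct (idx_list n)" for n
    unfolding idx_list_def by (intro distinct_product distinct_filter d) (simp add: forms_def)
  moreover have "length (idx_list 0) = 27" "length (idx_list 1) = 108"
    unfolding idx_list_def length_product d(2) by (simp_all add: forms_def)
  ultimately show "distinct (idx_list 0) \<and> length (idx_list 0) = 27" "distinct (idx_list 1) \<and> length (idx_list 1) = 108"
    by blast+
qed

lemma indep_idx_list:
  assumes "n \<le> 2" "distinct (idx_list n)"
  shows "indep_list (map bas (idx_list n))"
proof -
  have low: "set (idx_list n) \<subseteq> set low_forms \<times> set exps"
    using idx_set_low[OF assms(1)] by (simp add: set_idx_list)
  have "inj_on bas (set (idx_list n))" using bas_basis(1) low by (rule inj_on_subset)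
  moreover have "complex_vector.independent (bas ` set (idx_list n))"
    by (rule complex_vector.independent_mono[OF bas_basis(2)]) (use low in blast)
  ultimately show ?thesis using assms(2) by (simp add: indep_list_def distinct_map)
qed

lemma Omega_span_list: "n \<le> 1 \<Longrightarrow> Omega g e n = complex_vector.span (set (map bas (idx_list n)))"
  by (simp add: Omega_span set_idx_list)

lemma val_in_Omega: "fst ` set v \<subseteq> idx_set n \<Longrightarrow> n \<le> 1 \<Longrightarrow> val v \<in> Omega g e n"
  by (simp add: Omega_span vec_value_in_span)

lemma indep_mode_basis: "indep_list (map val mode_basis)"
  by (rule triangular_indep_val[OF mode_basis_triangular, where n = 1])
    (use keys_inD[OF forms_keys] all_keys in auto)

lemma zero_modes_eq: "zero_modes g e star = complex_vector.span (set (map val mode_basis))"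
proof -
  have "{x \<in> complex_vector.span (set (map bas (idx_list 1))). Maxwell e star x = 0} =
      complex_vector.span (set (map val mode_basis))"
  proof (rule kernel_span(1)[OF linC_maxwell indep_idx_list])
    show "set (map val mode_basis) \<subseteq> complex_vector.span (set (map bas (idx_list 1)))"
      "set (map val non_modes) \<subseteq> complex_vector.span (set (map bas (idx_list 1)))"
      using val_in_Omega[of _ 1] all_keys Omega_span_list[of 1] by auto
    show "Maxwell e star z = 0" if "z \<in> set (map val mode_basis)" for z
      by (rule val_kernel[OF linC_maxwell maxwell_vec_sound(1) _ _ that])
        (use modes_maxwell all_keys in auto)
    show "indep_list (map (Maxwell e star) (map val non_modes))"
      by (rule val_image_indep[OF maxwell_vec_sound _ non_modes_triangular])
        (use keys_inD[OF forms_keys] all_keys in auto)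
    show "length (map val mode_basis) + length (map val non_modes) = length (map bas (idx_list 1))"
      using list_lengths idx_list_props by (simp add: mode_basis_def exact_modes_1_def exact_modes_2_def)
  qed (use idx_list_props indep_mode_basis in simp_all)
  thus ?thesis by (simp add: zero_modes_def Omega_span_list)
qed

abbreviation exact_list :: "'w list" where
  "exact_list \<equiv> map val (exact_modes_1 @ exact_modes_2)"

lemma indep_exact: "indep_list exact_list"
  using indep_list_append1[of exact_list] indep_mode_basis by (simp add: mode_basis_def)

lemma exact_eq: "exact_1_forms g e = complex_vector.span (set exact_list)"
proof -
  let ?ps = "harmonic_potentials @ other_potentials"
  have keys: "fst ` set v \<subseteq> idx_set 0" if "v \<in> set ?ps" for v
    using keys_inD[OF potentials_keys] that by auto
  have "map (ext_d e 0) (map val ?ps) = exact_list"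
    using d_vec_sound keys by (simp add: exact_modes_1_def exact_modes_2_def)
  hence ind: "indep_list (map (ext_d e 0) (map val ?ps))" using indep_exact by simp
  have one: "1 = bas ([], 0, 0, 0)" by (simp add: bas_def form_def mon_def)
  have one_in: "([], 0, 0, 0) \<in> set (idx_list 0)" by (simp add: set_idx_list idx_set_def forms_def exps_iff)
  have "complex_vector.span (set (map bas (idx_list 0))) = complex_vector.span (set [1] \<union> set (map val ?ps))"
  proof (rule kernel_span(2)[OF linC_ext_d indep_idx_list _ _ _ ind])
    show "indep_list [1 :: 'w]"
      by (rule indep_list_sub[OF indep_idx_list[of 0]]) (use idx_list_props one one_in in auto)
    show "set [1] \<subseteq> complex_vector.span (set (map bas (idx_list 0)))"
      using one one_in by (auto intro!: complex_vector.span_base)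
    show "set (map val ?ps) \<subseteq> complex_vector.span (set (map bas (idx_list 0)))"
      using val_in_Omega[of _ 0] keys Omega_span_list[of 0] by auto
    show "length [1 :: 'w] + length (map val ?ps) = length (map bas (idx_list 0))"
      using list_lengths idx_list_props by simp
  qed (use idx_list_props in \<open>simp_all add: ext_d_def\<close>)
  hence "exact_1_forms g e = complex_vector.span (ext_d e 0 ` (insert 1 (set (map val ?ps))))"
    by (simp add: exact_1_forms_def Omega_span_list linC_image_span[OF linC_ext_d])
  also have "ext_d e 0 ` (insert 1 (set (map val ?ps))) = insert 0 (set exact_list)"
    using \<open>map (ext_d e 0) (map val ?ps) = exact_list\<close>
    by (metis (no_types, lifting) ext_d_def diff_self image_insert list.set_map minus_zero mult_1_left mult_1_right power_0)
  finally show ?thesis by simp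
qed


lemma map_val_subset:
  "set vs \<subseteq> set ws \<Longrightarrow> set (map val vs) \<subseteq> complex_vector.span (set (map val ws))"
  using complex_vector.span_superset[of "set (map val ws)"] by auto

lemma indep_val_sub:
  assumes "indep_list (map val ws)" "distinct (map val vs)" "set vs \<subseteq> set ws"
  shows "indep_list (map val vs)"
  using assms by (intro indep_list_sub[OF assms(1)]) auto

lemma distinct_modes: "distinct (map val mode_basis)"
  using indep_mode_basis by (simp add: indep_list_def)

lemma lorentz_dims:
  shows "{x \<in> zero_modes g e star. codiff e star 1 x = 0} =
      complex_vector.span (set (map val (exact_modes_1 @ harmonic_forms @ lorentz_forms_1 @ lorentz_forms_2)))"
    and "complex_vector.dim {x \<in> zero_modes g e star. codiff e star 1 x = 0} = 32"
    and "complex_vector.dim {x \<in> exact_1_forms g e. codiff e star 1 x = 0} = 12"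
proof -
  let ?zs = "exact_modes_1 @ harmonic_forms @ lorentz_forms_1 @ lorentz_forms_2"
  have coclosed: "codiff e star 1 z = 0" if "z \<in> set (map val ?zs)" for z
    by (rule val_kernel[OF linC_codiff codiff_vec_sound lorentz_coclosed _ that])
      (use all_keys in \<open>auto simp: mode_basis_def\<close>)
  have keys_codiff: "fst ` set (codiff_vec v) \<subseteq> idx_set 0" if "fst ` set v \<subseteq> idx_set 1" for v
    using keys_codiff_vec[OF that] by simp
  have ys: "indep_list (map (codiff e star 1) (map val (exact_modes_2 @ temporal_forms_1)))"
    by (rule val_image_indep[where n = 1 and m = 0, OF codiff_vec_sound keys_codiff _ lorentz_triangular])
      (assumption, assumption, simp, rule keys_inD[OF potentials_keys], simp, rule all_keys, auto simp: mode_basis_def)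
  have zs: "indep_list (map val ?zs)"
    by (rule indep_val_sub[OF indep_mode_basis]) (use distinct_modes in \<open>auto simp: mode_basis_def\<close>)
  show eq: "{x \<in> zero_modes g e star. codiff e star 1 x = 0} = complex_vector.span (set (map val ?zs))"
    unfolding zero_modes_eq
    by (rule kernel_span(1)[OF linC_codiff indep_mode_basis zs map_val_subset coclosed ys map_val_subset])
      (use list_lengths in \<open>auto simp: mode_basis_def exact_modes_1_def exact_modes_2_def\<close>)
  show "complex_vector.dim {x \<in> zero_modes g e star. codiff e star 1 x = 0} = 32"
    unfolding eq dim_span_indep_list[OF zs] using list_lengths by (simp add: exact_modes_1_def)
  have ys': "indep_list (map (codiff e star 1) (map val exact_modes_2))"
    using ys indep_list_append1 by fastforce
  have zs': "indep_list (map val exact_modes_1)"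
    using indep_exact indep_list_append1 by fastforce
  have "{x \<in> exact_1_forms g e. codiff e star 1 x = 0} = complex_vector.span (set (map val exact_modes_1))"
    unfolding exact_eq
    by (rule kernel_span(1)[OF linC_codiff indep_exact zs' map_val_subset coclosed ys' map_val_subset]) auto
  thus "complex_vector.dim {x \<in> exact_1_forms g e. codiff e star 1 x = 0} = 12"
    using dim_span_indep_list[OF zs'] list_lengths by (simp add: exact_modes_1_def)
qed

lemma zero_modes_subset_Omega: "zero_modes g e star \<subseteq> Omega g e 1"
  by (auto simp: zero_modes_def)

lemma exact_subset_zero_modes: "exact_1_forms g e \<subseteq> zero_modes g e star"
  unfolding exact_eq zero_modes_eq by (intro complex_vector.span_mono) (auto simp: mode_basis_def)

lemma temporal_dims:
  shows "zero_modes g e star \<inter> temporal_gauge q g e =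
      complex_vector.span (set (map val (exact_modes_1 @ temporal_forms_1 @ temporal_forms_2)))"
    and "complex_vector.dim (zero_modes g e star \<inter> temporal_gauge q g e) = 32"
    and "complex_vector.dim (exact_1_forms g e \<inter> temporal_gauge q g e) = 12"
proof -
  obtain tau where tau: "linC tau" "\<And>v. fst ` set v \<subseteq> idx_set 1 \<Longrightarrow> tau (val v) = val (lin tau_idx v)"
    "\<And>A. A \<in> Omega g e 1 \<Longrightarrow> A \<in> temporal_gauge q g e \<longleftrightarrow> tau A = 0"
    by (rule tau_exists, rule that, assumption, blast+)
  have Z: "zero_modes g e star \<inter> temporal_gauge q g e = {x \<in> zero_modes g e star. tau x = 0}"
    using tau(3) zero_modes_subset_Omega by blast
  have E: "exact_1_forms g e \<inter> temporal_gauge q g e = {x \<in> exact_1_forms g e. tau x = 0}"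
    using tau(3) zero_modes_subset_Omega exact_subset_zero_modes by blast
  let ?zs = "exact_modes_1 @ temporal_forms_1 @ temporal_forms_2"
  have temporal: "tau z = 0" if "z \<in> set (map val ?zs)" for z
    by (rule val_kernel[OF tau(1,2) temporal_tau _ that])
      (use all_keys in \<open>auto simp: mode_basis_def\<close>)
  have ys: "indep_list (map tau (map val (exact_modes_2 @ lorentz_forms_1)))"
    by (rule val_image_indep[where n = 1 and m = 0, OF tau(2) keys_tau_vec _ tau_triangular])
      (assumption, assumption, simp, rule keys_inD[OF potentials_keys], simp, rule all_keys, auto simp: mode_basis_def)
  have zs: "indep_list (map val ?zs)"
    by (rule triangular_indep_val[OF temporal_triangular, where n = 1])
      (simp, rule keys_inD[OF forms_keys], simp, rule all_keys, auto simp: mode_basis_def)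
  have "Maxwell e star z = 0" if "z \<in> set (map val (mode_basis @ temporal_forms_2))" for z
    by (rule val_kernel[OF linC_maxwell maxwell_vec_sound(1) modes_maxwell _ that]) (use all_keys in auto)
  hence zsZ: "set (map val ?zs) \<subseteq> complex_vector.span (set (map val mode_basis))"
    using val_in_Omega[of _ 1] all_keys
    unfolding zero_modes_eq[symmetric] zero_modes_def by (auto simp: mode_basis_def)
  show eq: "zero_modes g e star \<inter> temporal_gauge q g e = complex_vector.span (set (map val ?zs))"
    unfolding Z unfolding zero_modes_eq
    by (rule kernel_span(1)[OF tau(1) indep_mode_basis zs zsZ temporal ys map_val_subset])
      (use list_lengths in \<open>auto simp: mode_basis_def exact_modes_1_def exact_modes_2_def\<close>)
  show "complex_vector.dim (zero_modes g e star \<inter> temporal_gauge q g e) = 32"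
    unfolding eq dim_span_indep_list[OF zs] using list_lengths by (simp add: exact_modes_1_def)
  have ys': "indep_list (map tau (map val exact_modes_2))"
    using ys indep_list_append1 by fastforce
  have zs': "indep_list (map val exact_modes_1)"
    using indep_exact indep_list_append1 by fastforce
  have "{x \<in> exact_1_forms g e. tau x = 0} = complex_vector.span (set (map val exact_modes_1))"
    unfolding exact_eq
    by (rule kernel_span(1)[OF tau(1) indep_exact zs' map_val_subset temporal ys' map_val_subset]) auto
  thus "complex_vector.dim (exact_1_forms g e \<inter> temporal_gauge q g e) = 12"
    unfolding E using dim_span_indep_list[OF zs'] list_lengths by (simp add: exact_modes_1_def)
qed

lemma flat_dims:
  shows "{x \<in> zero_modes g e star. ext_d e 1 x = 0} =
      complex_vector.span (set (map val (exact_modes_1 @ exact_modes_2 @ harmonic_forms)))"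
    and "complex_vector.dim {x \<in> zero_modes g e star. ext_d e 1 x = 0} = 30"
proof -
  let ?zs = "exact_modes_1 @ exact_modes_2 @ harmonic_forms"
  have closed: "ext_d e 1 z = 0" if "z \<in> set (map val ?zs)" for z
    by (rule val_kernel[OF linC_ext_d d_vec_sound closed_forms _ that])
      (use all_keys in \<open>auto simp: mode_basis_def\<close>)
  have keys_d: "fst ` set (d_vec v) \<subseteq> idx_set 2" if "fst ` set v \<subseteq> idx_set 1" for v
    using keys_d_vec[OF that] by (simp add: numeral_2_eq_2)
  have ys: "indep_list (map (ext_d e 1) (map val (lorentz_forms_1 @ lorentz_forms_2 @ temporal_forms_1)))"
    by (rule val_image_indep[where n = 1 and m = 2, OF d_vec_sound keys_d _ curvature_triangular])
      (assumption, assumption, simp, rule keys_inD[OF curvature_keys], simp, rule all_keys, auto simp: mode_basis_def)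
  have zs: "indep_list (map val ?zs)"
    by (rule indep_val_sub[OF indep_mode_basis]) (use distinct_modes in \<open>auto simp: mode_basis_def\<close>)
  show eq: "{x \<in> zero_modes g e star. ext_d e 1 x = 0} = complex_vector.span (set (map val ?zs))"
    unfolding zero_modes_eq
    by (rule kernel_span(1)[OF linC_ext_d indep_mode_basis zs map_val_subset closed ys map_val_subset])
      (use list_lengths in \<open>auto simp: mode_basis_def exact_modes_1_def exact_modes_2_def\<close>)
  show "complex_vector.dim {x \<in> zero_modes g e star. ext_d e 1 x = 0} = 30"
    unfolding eq dim_span_indep_list[OF zs] using list_lengths by (simp add: exact_modes_1_def exact_modes_2_def)
qed


lemma harmonic_form_membership:
  assumes "v \<in> set harmonic_forms"
  shows "val v \<in> harmonic_1_forms g e star"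
proof -
  have keys: "fst ` set v \<subseteq> idx_set 1" by (rule all_keys) (use assms in \<open>simp add: mode_basis_def\<close>)
  have "is_zero (d_vec v)" "is_zero (codiff_vec v)" using closed_forms lorentz_coclosed assms by auto
  thus ?thesis using val_in_Omega[OF keys] d_vec_sound[OF keys] codiff_vec_sound[OF keys]
    by (simp add: harmonic_1_forms_def vec_value_is_zero)
qed

lemma subspace_kernel:
  assumes "linC f" "complex_vector.subspace S"
  shows "complex_vector.subspace {x \<in> S. f x = 0}"
  using assms(2) by (auto simp: complex_vector.subspace_def linC_zero[OF assms(1)] linC_add[OF assms(1)] linC_scale[OF assms(1)])

lemma subspace_Omega: "complex_vector.subspace (Omega g e n)"
  by (simp add: Omega_def)

lemma subspace_harmonic: "complex_vector.subspace (harmonic_1_forms g e star)"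
proof -
  have "harmonic_1_forms g e star = {A \<in> {A \<in> Omega g e 1. ext_d e 1 A = 0}. codiff e star 1 A = 0}"
    by (auto simp: harmonic_1_forms_def)
  thus ?thesis using subspace_kernel[OF linC_codiff subspace_kernel[OF linC_ext_d subspace_Omega]] by simp
qed

lemma closed_eq: "closed_1_forms g e = {A \<in> zero_modes g e star. ext_d e 1 A = 0}"
  by (auto simp: closed_1_forms_def zero_modes_def Maxwell_def linC_zero[OF linC_codiff])

lemma flat_eq_plus: "{A \<in> zero_modes g e star. ext_d e 1 A = 0} = plus_space (harmonic_1_forms g e star) (exact_1_forms g e)"
proof
  let ?F = "{A \<in> zero_modes g e star. ext_d e 1 A = 0}"
  have subF: "complex_vector.subspace ?F" unfolding flat_dims(1) by simp
  have H: "harmonic_1_forms g e star \<subseteq> ?F"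
    unfolding closed_eq[symmetric] by (auto simp: harmonic_1_forms_def closed_1_forms_def)
  have E: "exact_1_forms g e \<subseteq> ?F"
    unfolding flat_dims(1) exact_eq by (intro complex_vector.span_mono) auto
  show "plus_space (harmonic_1_forms g e star) (exact_1_forms g e) \<subseteq> ?F"
  proof
    fix z assume "z \<in> plus_space (harmonic_1_forms g e star) (exact_1_forms g e)"
    then obtain x y where "x \<in> harmonic_1_forms g e star" "y \<in> exact_1_forms g e" and z: "z = x + y" by blast
    hence "x \<in> ?F" "y \<in> ?F" using H E by blast+
    thus "z \<in> ?F" unfolding z by (rule complex_vector.subspace_add[OF subF])
  qed
  have "?F = plus_space (complex_vector.span (set (map val harmonic_forms))) (complex_vector.span (set exact_list))"
    unfolding flat_dims(1) complex_vector.span_Un[symmetric]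
    by (rule arg_cong[where f = complex_vector.span]) auto
  moreover have "complex_vector.span (set (map val harmonic_forms)) \<subseteq> harmonic_1_forms g e star"
    by (intro complex_vector.span_minimal subspace_harmonic) (auto simp: harmonic_form_membership)
  ultimately show "?F \<subseteq> plus_space (harmonic_1_forms g e star) (exact_1_forms g e)"
    unfolding exact_eq by blast
qed

lemma zero_modes_decomposition:
  "zero_modes g e star \<subseteq> plus_space (plus_space {x \<in> zero_modes g e star. codiff e star 1 x = 0}
     (zero_modes g e star \<inter> temporal_gauge q g e)) (exact_1_forms g e)"
proof -
  let ?l = "set (map val (exact_modes_1 @ harmonic_forms @ lorentz_forms_1 @ lorentz_forms_2))"
  let ?t = "set (map val (exact_modes_1 @ temporal_forms_1 @ temporal_forms_2))"
  have "zero_modes g e star \<subseteq> complex_vector.span ((?l \<union> ?t) \<union> set exact_list)"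
    unfolding zero_modes_eq by (intro complex_vector.span_mono) (auto simp: mode_basis_def)
  thus ?thesis unfolding lorentz_dims(1) temporal_dims(1) exact_eq complex_vector.span_Un .
qed

end

theorem proposition4p6:
  fixes q :: complex
    and g e :: "gen \<Rightarrow> 'w::complex_algebra"
    and star :: "'w \<Rightarrow> 'w"
  assumes "q ^ 3 = 1" and "q \<noteq> 1"
    and "reduced_SL2_calculus q g e star"
  shows
    "let Z = zero_modes g e star;
         E = exact_1_forms g e;
         L = Z \<inter> lorentz_gauge g e star;
         T = Z \<inter> temporal_gauge q g e;
         F = {A \<in> Z. ext_d e 1 A = 0}
     in
       E \<subseteq> Z \<and>
       \<comment> \<open>(i)\<close>
       complex_vector.dim Z = 54 \<and> quot_dim E (quot Z E) = 28 \<and>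
       quot_dim E (quot F E) = 4 \<and> quot F E = H1 g e \<and>
       (\<exists>B \<subseteq> harmonic_1_forms g e star. card B = 4 \<and> quot_basis E (H1 g e) B) \<and>
       \<comment> \<open>(ii)\<close>
       complex_vector.dim L = 32 \<and> quot_dim E (quot L E) = 20 \<and>
       \<comment> \<open>(iii)\<close>
       complex_vector.dim T = 32 \<and> quot_dim E (quot T E) = 20 \<and>
       \<comment> \<open>(iv)\<close>
       (\<forall>A \<in> Z. \<exists>A\<^sub>L \<in> L. \<exists>A\<^sub>T \<in> T. gauge_equivalent g e A (A\<^sub>L + A\<^sub>T)) \<and>
       quot_dim E (quot L E \<inter> quot T E) = 12"
proof -
  interpret reduced_SL2_calculus q g e star by fact
  interpret SL2_root3 q g e star by unfold_locales (use assms in auto)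
  define Z where "Z = zero_modes g e star"
  define E where "E = exact_1_forms g e"
  define L where "L = Z \<inter> lorentz_gauge g e star"
  define T where "T = Z \<inter> temporal_gauge q g e"
  define F where "F = {A \<in> Z. ext_d e 1 A = 0}"
  obtain C :: "'w set" where C: "finite C" "complex_vector.span C = UNIV"
    using finite_spanning by blast
  have EZ: "E \<subseteq> Z" using exact_subset_zero_modes by (simp add: E_def Z_def)
  have L_eq: "L = {x \<in> zero_modes g e star. codiff e star 1 x = 0}"
    using zero_modes_subset_Omega by (auto simp: L_def Z_def lorentz_gauge_def)
  have LE: "L \<inter> E = {x \<in> exact_1_forms g e. codiff e star 1 x = 0}"
    using exact_subset_zero_modes by (auto simp: L_eq E_def)
  have TE: "T \<inter> E = exact_1_forms g e \<inter> temporal_gauge q g e"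
    using exact_subset_zero_modes by (auto simp: T_def Z_def E_def)
  have Z_sub: "Z \<subseteq> plus_space (plus_space L T) E"
    using zero_modes_decomposition by (simp add: Z_def L_eq T_def E_def)
  have dimZ: "complex_vector.dim Z = 54"
    unfolding Z_def zero_modes_eq dim_span_indep_list[OF indep_mode_basis]
    using list_lengths by (simp add: mode_basis_def exact_modes_1_def exact_modes_2_def)
  have dimE: "complex_vector.dim E = 26"
    unfolding E_def exact_eq dim_span_indep_list[OF indep_exact]
    using list_lengths by (simp add: exact_modes_1_def exact_modes_2_def)
  have dimL: "complex_vector.dim L = 32" unfolding L_eq by (rule lorentz_dims(2))
  have dimT: "complex_vector.dim T = 32" unfolding T_def Z_def by (rule temporal_dims(2))
  have dimF: "complex_vector.dim F = 30" unfolding F_def Z_def by (rule flat_dims(2))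
  have F_plus: "F = plus_space (harmonic_1_forms g e star) E"
    unfolding F_def Z_def E_def by (rule flat_eq_plus)
  have H1: "quot F E = H1 g e" by (simp add: H1_def closed_eq F_def Z_def E_def)
  have subspaces: "complex_vector.subspace E" "complex_vector.subspace Z" "complex_vector.subspace L"
    "complex_vector.subspace T"
    unfolding E_def exact_eq Z_def L_eq lorentz_dims(1) T_def temporal_dims(1) unfolding zero_modes_eq by simp_all
  have incl: "L \<subseteq> Z" "T \<subseteq> Z" by (auto simp: L_def T_def)
  have dimLE: "complex_vector.dim (L \<inter> E) = 12" unfolding LE by (rule lorentz_dims(3))
  have dimTE: "complex_vector.dim (T \<inter> E) = 12" unfolding TE by (rule temporal_dims(3))
  note dims = quotient_dimensions[OF C subspaces(1,2) subspace_harmonic subspaces(3,4) EZ incl dimZ dimE dimF dimL dimT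
    dimLE dimTE F_plus Z_sub]
  have "\<exists>A\<^sub>L\<in>L. \<exists>A\<^sub>T\<in>T. gauge_equivalent g e A (A\<^sub>L + A\<^sub>T)" if "A \<in> Z" for A
  proof -
    have "A \<in> plus_space (plus_space L T) E" using that Z_sub by blast
    then obtain l t y where lty: "l \<in> L" "t \<in> T" "y \<in> E" "A = (l + t) + y" by blast
    hence "A - (l + t) \<in> exact_1_forms g e" by (simp add: E_def)
    thus ?thesis using lty(1,2) by (auto simp: gauge_equivalent_def)
  qed
  thus ?thesis
    unfolding Let_def Z_def[symmetric] E_def[symmetric] L_def[symmetric] T_def[symmetric] F_def[symmetric]
    using EZ dimZ dims dimL dimT H1 by simp
qed

end
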